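(* Let $d\ge 2$ and $s>\frac d2$, and let $(X_N)_N$ be a sequence of QMC designs for $\mathbb{H}^s(\mathbb{S}^d)$. Then $(X_N)_N$ is a sequence of QMC designs for $\mathbb{H}^{(\frac d2,\gamma)}(\mathbb{S}^d)$ for all $\gamma>\frac12$.
   Context: $\mathbb{S}^d\subset\mathbb{R}^{d+1}$ is the unit sphere, $\sigma_d$ its normalised surface measure ($\sigma_d(\mathbb{S}^d)=1$). For $X_N=\{\mathbf{x}_1,\dots,\mathbf{x}_N\}\subset\mathbb{S}^d$ let $Q[X_N](f)=\frac1N\sum_{i=1}^Nf(\mathbf{x}_i)$. For a Banach space $B$ of continuous functions on $\mathbb{S}^d$, $\mathrm{wce}(Q;B)=\sup_{f\in B,\ \|f\|_B\le1}|Q(f)-\int_{\mathbb{S}^d}f\,d\sigma_d|$. Let $\{Y^{(d)}_{\ell,k}:k=1,\dots,Z(d,\ell)\}$ be an $L_2(\mathbb{S}^d,\sigma_d)$-orthonormal basis of the real spherical harmonics of degree $\ell$ ($Z(d,\ell)$ is the dimension of that space), $\hat f_{\ell,k}=\int_{\mathbb{S}^d}fY^{(d)}_{\ell,k}\,d\sigma_d$, and $\lambda_\ell=\ell(\ell+d-1)$. The Sobolev space $\mathbb{H}^s(\mathbb{S}^d)$ consists of all $f\in L_2(\mathbb{S}^d)$ with $\|f\|^2_{\mathbb{H}^s}=\sum_{\ell\ge0}\sum_{k}(1+\lambda_\ell)^s|\hat f_{\ell,k}|^2<\infty$. For $\gamma>\frac12$, $\mathbb{H}^{(\frac d2,\gamma)}(\mathbb{S}^d)$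 consists of all $f\in L_2(\mathbb{S}^d)$ with $\|f\|^2_{\mathbb{H}^{(\frac d2,\gamma)}}=\sum_{\ell\ge0}(1+\lambda_\ell)^{\frac d2}(\ln(3+\lambda_\ell))^{2\gamma}\sum_k|\hat f_{\ell,k}|^2<\infty$. For $s>\frac d2$, $\gamma>\frac12$ both embed into $C(\mathbb{S}^d)$ (functions are identified with their continuous representatives). A sequence $(X_N)$ of $N$-point configurations on $\mathbb{S}^d$ with $N\to\infty$ is a sequence of QMC designs for $\mathbb{H}^s(\mathbb{S}^d)$, $s>\frac d2$, if there is $c(s,d)>0$, independent of $N$, with $\mathrm{wce}(Q[X_N];\mathbb{H}^s(\mathbb{S}^d))\le c(s,d)N^{-\frac sd}$. It is a sequence of QMC designs for $\mathbb{H}^{(\frac d2,\gamma)}(\mathbb{S}^d)$, $\gamma>\frac12$, if there is $c(\gamma,d)>0$, independent of $N$, with $\mathrm{wce}(Q[X_N];\mathbb{H}^{(\frac d2,\gamma)}(\mathbb{S}^d))\le c(\gamma,d)N^{-\frac12}(\ln N)^{-\gamma+\frac12}$ (with $N\ge2$). *)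

theory Defs
  imports "HOL-Analysis.Analysis" "HOL-Library.Function_Algebras"
begin

text \<open>
  The sphere of dimension \<open>d\<close> is \<open>sphere 0 1\<close> in a Euclidean space \<open>'a\<close> with \<open>DIM('a) = d + 1\<close>.
  The normalised surface measure is the image of the uniform distribution on the unit ball under
  the radial projection \<open>x \<mapsto> x / |x|\<close>. The final restriction makes \<open>sphere 0 1\<close> the whole space,
  so that measurability and integrals do not depend on the values of a function off the sphere;
  the only point of the ball that is not projected into the sphere is \<open>0\<close>, a null set.
\<close>

definition sphere_measure :: "'a::euclidean_space measure" where
  "sphere_measure =
     restrict_space (distr (uniform_measure lborel (ball 0 1)) borel (\<lambda>x. x /\<^sub>R norm x)) (sphere 0 1)"

definition laplacian :: "('a::euclidean_space \<Rightarrow> real) \<Rightarrow> 'a \<Rightarrow> real" where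
  "laplacian p x = (\<Sum>b\<in>Basis. (deriv ^^ 2) (\<lambda>t. p (x + t *\<^sub>R b)) 0)"

text \<open>
  Functions on the sphere are represented by functions on \<open>'a\<close>; spherical harmonics are set to \<open>0\<close>
  off the sphere, so that distinct representatives are distinct functions on the sphere.
\<close>

definition spherical_harmonics :: "nat \<Rightarrow> ('a::euclidean_space \<Rightarrow> real) set" where
  "spherical_harmonics l =
     {Y. \<exists>p. real_polynomial_function p \<and> (\<forall>c x. p (c *\<^sub>R x) = c ^ l * p x) \<and>
             (\<forall>x. laplacian p x = 0) \<and> Y = (\<lambda>x. if x \<in> sphere 0 1 then p x else 0)}"

interpretation real_fun: vector_space "\<lambda>(c::real) (f :: 'a \<Rightarrow> real) x. c * f x"
  by unfold_locales (auto simp: fun_eq_iff algebra_simps)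

definition harmonic_dim :: "'a::euclidean_space itself \<Rightarrow> nat \<Rightarrow> nat" where
  "harmonic_dim _ l = real_fun.dim (spherical_harmonics l :: ('a \<Rightarrow> real) set)"

text \<open>
  \<open>Y l 1, \<dots>, Y l (harmonic_dim TYPE('a) l)\<close> is an orthonormal basis of the spherical harmonics of
  degree \<open>l\<close>; linear independence is implied by orthonormality.
\<close>

definition harmonic_onb :: "(nat \<Rightarrow> nat \<Rightarrow> 'a::euclidean_space \<Rightarrow> real) \<Rightarrow> bool" where
  "harmonic_onb Y \<longleftrightarrow>
     (\<forall>l. real_fun.span (Y l ` {1..harmonic_dim TYPE('a) l}) = spherical_harmonics l \<and>
          (\<forall>j\<in>{1..harmonic_dim TYPE('a) l}. \<forall>k\<in>{1..harmonic_dim TYPE('a) l}.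
             (\<integral>x. Y l j x * Y l k x \<partial>sphere_measure) = (if j = k then 1 else 0)))"

definition fourier_coeff ::
  "(nat \<Rightarrow> nat \<Rightarrow> 'a::euclidean_space \<Rightarrow> real) \<Rightarrow> ('a \<Rightarrow> real) \<Rightarrow> nat \<Rightarrow> nat \<Rightarrow> real" where
  "fourier_coeff Y f l k = (\<integral>x. f x * Y l k x \<partial>sphere_measure)"

definition eigval :: "nat \<Rightarrow> nat \<Rightarrow> real" where
  "eigval d l = real l * (real l + real d - 1)"

definition sobolev_weight :: "nat \<Rightarrow> real \<Rightarrow> nat \<Rightarrow> real" where
  "sobolev_weight d s l = (1 + eigval d l) powr s"

definition log_sobolev_weight :: "nat \<Rightarrow> real \<Rightarrow> nat \<Rightarrow> real" where
  "log_sobolev_weight d \<gamma> l =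
     (1 + eigval d l) powr (real d / 2) * ln (3 + eigval d l) powr (2 * \<gamma>)"

definition weighted_energy ::
  "(nat \<Rightarrow> nat \<Rightarrow> 'a::euclidean_space \<Rightarrow> real) \<Rightarrow> (nat \<Rightarrow> real) \<Rightarrow> ('a \<Rightarrow> real) \<Rightarrow> nat \<Rightarrow> real" where
  "weighted_energy Y w f l = w l * (\<Sum>k=1..harmonic_dim TYPE('a) l. (fourier_coeff Y f l k)\<^sup>2)"

text \<open>
  Elements of the spaces are identified with their continuous representatives, which are
  automatically square integrable.
\<close>

definition weighted_space ::
  "(nat \<Rightarrow> nat \<Rightarrow> 'a::euclidean_space \<Rightarrow> real) \<Rightarrow> (nat \<Rightarrow> real) \<Rightarrow> ('a \<Rightarrow> real) set" where
  "weighted_space Y w = {f. continuous_on (sphere 0 1) f \<and> summable (weighted_energy Y w f)}"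

definition weighted_norm ::
  "(nat \<Rightarrow> nat \<Rightarrow> 'a::euclidean_space \<Rightarrow> real) \<Rightarrow> (nat \<Rightarrow> real) \<Rightarrow> ('a \<Rightarrow> real) \<Rightarrow> real" where
  "weighted_norm Y w f = sqrt (\<Sum>l. weighted_energy Y w f l)"

text \<open>A configuration of \<open>N\<close> points is an indexed family \<open>x 1, \<dots>, x N\<close>.\<close>

definition qmc_rule :: "nat \<Rightarrow> (nat \<Rightarrow> 'a) \<Rightarrow> ('a \<Rightarrow> real) \<Rightarrow> real" where
  "qmc_rule N x f = (1 / real N) * (\<Sum>i=1..N. f (x i))"

definition wce ::
  "(('a::euclidean_space \<Rightarrow> real) \<Rightarrow> real) \<Rightarrow> ('a \<Rightarrow> real) set \<Rightarrow> (('a \<Rightarrow> real) \<Rightarrow> real) \<Rightarrow> ereal" where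
  "wce Q B nrm = (SUP f\<in>{f\<in>B. nrm f \<le> 1}. ereal \<bar>Q f - (\<integral>x. f x \<partial>sphere_measure)\<bar>)"

text \<open>
  A sequence of \<open>N\<close>-point configurations with \<open>N \<rightarrow> \<infinity>\<close>: the numbers of points \<open>N\<close> range over some
  infinite set \<open>I\<close> of positive integers.
\<close>

definition configuration_sequence :: "nat set \<Rightarrow> (nat \<Rightarrow> nat \<Rightarrow> 'a::euclidean_space) \<Rightarrow> bool" where
  "configuration_sequence I X \<longleftrightarrow>
     infinite I \<and> 0 \<notin> I \<and> (\<forall>N\<in>I. \<forall>i\<in>{1..N}. X N i \<in> sphere 0 1)"

definition qmc_designs_sobolev ::
  "(nat \<Rightarrow> nat \<Rightarrow> 'a::euclidean_space \<Rightarrow> real) \<Rightarrow> nat \<Rightarrow> real \<Rightarrow> nat set \<Rightarrow> (nat \<Rightarrow> nat \<Rightarrow> 'a) \<Rightarrow> bool" where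
  "qmc_designs_sobolev Y d s I X \<longleftrightarrow>
     configuration_sequence I X \<and>
     (\<exists>c>0. \<forall>N\<in>I.
        wce (qmc_rule N (X N)) (weighted_space Y (sobolev_weight d s))
            (weighted_norm Y (sobolev_weight d s))
          \<le> ereal (c * real N powr (- s / real d)))"

definition qmc_designs_log_sobolev ::
  "(nat \<Rightarrow> nat \<Rightarrow> 'a::euclidean_space \<Rightarrow> real) \<Rightarrow> nat \<Rightarrow> real \<Rightarrow> nat set \<Rightarrow> (nat \<Rightarrow> nat \<Rightarrow> 'a) \<Rightarrow> bool" where
  "qmc_designs_log_sobolev Y d \<gamma> I X \<longleftrightarrow>
     configuration_sequence I X \<and>
     (\<exists>c>0. \<forall>N\<in>I. N \<ge> 2 \<longrightarrow>
        wce (qmc_rule N (X N)) (weighted_space Y (log_sobolev_weight d \<gamma>))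
            (weighted_norm Y (log_sobolev_weight d \<gamma>))
          \<le> ereal (c * real N powr (- 1 / 2) * ln (real N) powr (- \<gamma> + 1 / 2)))"

end

theory Submission
  imports Defs "HOL-Real_Asymp.Real_Asymp"
begin

text \<open>
  Both worst-case errors are weighted sums of the numbers \<open>S l\<close>, the sum over \<open>k\<close> of
  \<open>(qmc_rule N x (Y l k))\<^sup>2\<close>: the squared error is the sum of \<open>S l / w l\<close> over \<open>l \<ge> 1\<close>.
  The Sobolev bound directly controls the degrees \<open>l \<lesssim> N powr (1 / d)\<close>. For the higher degrees one
  uses the kernels \<open>((1 + x \<bullet> y) / 2) ^ M\<close>. They decrease pointwise in \<open>M\<close>, and divided by their
  mean, which decays like \<open>M powr (- d / 2)\<close>, they act on the harmonics of degree \<open>l\<close> as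
  multiplication by about \<open>exp (- l\<^sup>2 / M)\<close>. Summed over all pairs of nodes,
  the normalised kernel yields \<open>N\<^sup>2\<close> times the sum of \<open>S l\<close> with these factors. That sum is
  bounded for \<open>M \<approx> N powr (2 / d)\<close> by the Sobolev bound, so the pointwise comparison gives
  \<open>M powr (d / 2) / N\<close> as a bound for larger \<open>M\<close>. Applying this to \<open>M = 2 ^ j * N powr (2 / d)\<close> and
  summing over \<open>j\<close> produces the rate \<open>ln N powr (1 - 2 * \<gamma>) / N\<close> for the squared error.
\<close>

section \<open>Rotation invariance of the surface measure\<close>

text \<open>For degrees above \<open>N powr (1 / d)\<close> the Sobolev bound alone lets the sum of
  \<open>S l\<close> up to degree \<open>L\<close> grow like \<open>L powr (2 * s)\<close>. This
  outgrows the weight, of size \<open>L ^ d\<close> up to logarithms, because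
  \<open>2 * s > d\<close>. Comparing kernels brings the growth down to \<open>L ^ d / N\<close>.
  The powers then cancel, each dyadic block of degrees costs only its logarithm to the power
  \<open>- 2 * \<gamma>\<close>, and the sum over the blocks converges because \<gamma> > 1/2. The
  base \<open>(1 + x \<bullet> y) / 2\<close> lies in [0, 1] on the sphere, so a larger exponent
  gives a smaller kernel. Moreover the spherical Laplacian maps each of its powers to a combination
  of that power and the preceding one, so masses and eigenvalues obey first-order recurrences in
  \<open>M\<close> and have closed forms. The kernels have a second task: they smooth a continuous
  function into a finite sum of harmonics that converges to it at each node, so that Cauchy-Schwarz
  is applied to finite sums only.\<close>

lemma emeasure_lborel_ball_pos:
  fixes c :: "'a::euclidean_space"
  assumes "r > 0"
  shows "emeasure lborel (ball c r) > 0"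
proof -
  have "measure lborel (ball c r) > 0" using content_ball_pos[OF assms] by simp
  then show ?thesis unfolding measure_def by (simp add: enn2real_positive_iff)
qed

lemma nn_integral_lborel_translate:
  fixes f :: "'a::euclidean_space \<Rightarrow> ennreal"
  assumes [measurable]: "f \<in> borel_measurable borel"
  shows "(\<integral>\<^sup>+x. f (c + x) \<partial>lborel) = (\<integral>\<^sup>+x. f x \<partial>lborel)"
proof -
  have "(\<integral>\<^sup>+x. f x \<partial>lborel) = (\<integral>\<^sup>+x. f x \<partial>distr lborel borel ((+) c))"
    by (simp add: lborel_distr_plus)
  also have "\<dots> = (\<integral>\<^sup>+x. f (c + x) \<partial>lborel)"
    by (subst nn_integral_distr) auto
  finally show ?thesis by simp
qed

text \<open>
  This is the uniqueness argument for Haar measure: both measures are compared through the double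
  integral of \<open>indicator A (R x) * indicator (ball 0 1) (y - R x)\<close>.
\<close>

lemma emeasure_lborel_orthogonal_vimage:
  fixes R :: "'a::euclidean_space \<Rightarrow> 'a"
  assumes R: "orthogonal_transformation R" and A[measurable]: "A \<in> sets borel"
  shows "emeasure lborel (R -` A) = emeasure lborel A"
proof -
  interpret lin: bounded_linear R
    using orthogonal_transformation_linear[OF R] by (simp add: linear_conv_bounded_linear)
  have [measurable]: "R \<in> borel_measurable borel"
    by (intro borel_measurable_continuous_onI lin.continuous_on) auto
  define B where "B = (ball 0 1 :: 'a set)"
  have [measurable]: "B \<in> sets borel" by (simp add: B_def)
  have Bn: "x \<in> B \<longleftrightarrow> norm x < 1" for x by (simp add: B_def)
  have Bf: "emeasure lborel B \<noteq> 0" "emeasure lborel B \<noteq> \<infinity>"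
    using emeasure_lborel_ball_pos[of 1 "0::'a"] emeasure_lborel_ball_finite[of "0::'a" 1] by (auto simp: B_def)
  have sw: "(\<integral>\<^sup>+x. \<integral>\<^sup>+y. indicator A (R x) * indicator B (y - R x) \<partial>lborel \<partial>lborel) =
        (\<integral>\<^sup>+y. \<integral>\<^sup>+x. indicator A (R x) * (indicator B (y - R x) :: ennreal) \<partial>lborel \<partial>lborel)"
    by (rule lborel_pair.Fubini'[symmetric]) measurable
  have "(\<integral>\<^sup>+x. \<integral>\<^sup>+y. indicator A (R x) * indicator B (y - R x) \<partial>lborel \<partial>lborel)
      = (\<integral>\<^sup>+x. indicator A (R x) * emeasure lborel B \<partial>lborel)"
  proof (rule nn_integral_cong)
    fix x :: 'a
    have "(\<integral>\<^sup>+y. indicator B (- R x + y) \<partial>lborel) = (\<integral>\<^sup>+y. (indicator B y :: ennreal) \<partial>lborel)"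
      by (rule nn_integral_lborel_translate) measurable
    then show "(\<integral>\<^sup>+y. indicator A (R x) * indicator B (y - R x) \<partial>lborel) = indicator A (R x) * emeasure lborel B"
      by (simp add: nn_integral_cmult)
  qed
  also have "\<dots> = emeasure lborel (R -` A) * emeasure lborel B"
    using measurable_sets[of R borel borel A]
    by (simp add: nn_integral_multc indicator_vimage[symmetric])
  finally have 1: "(\<integral>\<^sup>+x. \<integral>\<^sup>+y. indicator A (R x) * indicator B (y - R x) \<partial>lborel \<partial>lborel)
     = emeasure lborel (R -` A) * emeasure lborel B" .
  have "(\<integral>\<^sup>+y. \<integral>\<^sup>+x. indicator A (R x) * (indicator B (y - R x) :: ennreal) \<partial>lborel \<partial>lborel)
     = (\<integral>\<^sup>+y. \<integral>\<^sup>+x. indicator A (R x + y) * (indicator B x :: ennreal) \<partial>lborel \<partial>lborel)"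
  proof (rule nn_integral_cong)
    fix y :: 'a
    \<comment> \<open>Shifting \<open>x\<close> by a preimage \<open>z\<close> of \<open>y\<close>
      turns \<open>y - R x\<close> into \<open>- R x\<close>. The ball is invariant under
      \<open>R\<close> and under reflection, so the ball condition becomes one on \<open>x\<close>
      alone.\<close>
    obtain z where z: "R z = y"
      using orthogonal_transformation_surj[OF R] by (metis surjD)
    have "(\<integral>\<^sup>+x. indicator A (R x) * (indicator B (y - R x) :: ennreal) \<partial>lborel)
       = (\<integral>\<^sup>+x. indicator A (R (z + x)) * (indicator B (y - R (z + x)) :: ennreal) \<partial>lborel)"
      by (rule nn_integral_lborel_translate[symmetric]) measurable
    also have "\<dots> = (\<integral>\<^sup>+x. indicator A (R x + y) * (indicator B x :: ennreal) \<partial>lborel)"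
      by (intro nn_integral_cong)
         (simp add: lin.add z add.commute indicator_def Bn orthogonal_transformation_norm[OF R])
    finally show "(\<integral>\<^sup>+x. indicator A (R x) * (indicator B (y - R x) :: ennreal) \<partial>lborel) =
       (\<integral>\<^sup>+x. indicator A (R x + y) * (indicator B x :: ennreal) \<partial>lborel)" .
  qed
  also have "\<dots> = (\<integral>\<^sup>+x. \<integral>\<^sup>+y. indicator A (R x + y) * (indicator B x :: ennreal) \<partial>lborel \<partial>lborel)"
    by (rule lborel_pair.Fubini') measurable
  also have "\<dots> = (\<integral>\<^sup>+x. emeasure lborel A * indicator B x \<partial>lborel)"
  proof (rule nn_integral_cong)
    fix x :: 'a
    have "(\<integral>\<^sup>+y. indicator A (R x + y) \<partial>lborel) = (\<integral>\<^sup>+y. (indicator A y :: ennreal) \<partial>lborel)"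
      by (rule nn_integral_lborel_translate) measurable
    then show "(\<integral>\<^sup>+y. indicator A (R x + y) * (indicator B x :: ennreal) \<partial>lborel) = emeasure lborel A * indicator B x"
      by (simp add: nn_integral_multc)
  qed
  also have "\<dots> = emeasure lborel A * emeasure lborel B"
    by (simp add: nn_integral_cmult)
  finally have "emeasure lborel (R -` A) * emeasure lborel B = emeasure lborel A * emeasure lborel B"
    using 1 sw by simp
  with Bf show ?thesis
    by (metis infinity_ennreal_def mult_divide_eq_ennreal)
qed

lemma space_sphere_measure [simp]: "space (sphere_measure :: 'a::euclidean_space measure) = sphere 0 1"
  by (simp add: sphere_measure_def space_restrict_space)

lemma sets_sphere_measure [simp, measurable_cong]:
  "sets (sphere_measure :: 'a::euclidean_space measure) = sets (restrict_space borel (sphere 0 1))"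
  by (simp add: sphere_measure_def sets_restrict_space)

lemma emeasure_sphere_measure:
  fixes A :: "'a::euclidean_space set"
  assumes A: "A \<in> sets borel" "A \<subseteq> sphere 0 1"
  shows "emeasure sphere_measure A =
    emeasure lborel (ball 0 1 \<inter> (\<lambda>x. x /\<^sub>R norm x) -` A) / emeasure lborel (ball 0 1 :: 'a set)"
proof -
  have m: "(\<lambda>x::'a. x /\<^sub>R norm x) \<in> measurable (uniform_measure lborel (ball 0 1)) borel"
    by measurable
  have "(\<lambda>x::'a. x /\<^sub>R norm x) -` A \<in> sets borel"
    using measurable_sets[OF _ A(1), of "\<lambda>x::'a. x /\<^sub>R norm x" borel] by simp
  with A show ?thesis
    by (simp add: sphere_measure_def emeasure_restrict_space emeasure_distr[OF m])
qed

lemma emeasure_sphere_measure_sphere: "emeasure sphere_measure (sphere 0 1 :: 'a::euclidean_space set) = 1"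
proof -
  have "emeasure lborel (ball 0 1 \<inter> (\<lambda>x::'a. x /\<^sub>R norm x) -` sphere 0 1) = emeasure lborel (ball 0 1 :: 'a set)"
  proof (rule emeasure_eq_AE)
    show "AE x::'a in lborel. x \<in> ball 0 1 \<inter> (\<lambda>x. x /\<^sub>R norm x) -` sphere 0 1 \<longleftrightarrow> x \<in> ball 0 1"
      using AE_lborel_singleton[of "0::'a"] by eventually_elim auto
    have "(\<lambda>x::'a. x /\<^sub>R norm x) -` sphere 0 1 \<in> sets borel"
      using measurable_sets[of "\<lambda>x::'a. x /\<^sub>R norm x" borel borel "sphere 0 1"] by simp
    then show "ball 0 1 \<inter> (\<lambda>x::'a. x /\<^sub>R norm x) -` sphere 0 1 \<in> sets lborel" by simp
  qed auto
  moreover have "emeasure lborel (ball 0 1 :: 'a set) \<noteq> 0"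
    using emeasure_lborel_ball_pos[of 1 "0::'a"] by simp
  ultimately show ?thesis
    using emeasure_lborel_ball_finite[of "0::'a" 1]
    by (simp add: emeasure_sphere_measure ennreal_divide_self)
qed

interpretation sphere: finite_measure "sphere_measure :: 'a::euclidean_space measure"
  by standard (simp add: emeasure_sphere_measure_sphere)

lemma measure_sphere_measure_sphere [simp]:
  "measure (sphere_measure :: 'a::euclidean_space measure) (sphere 0 1) = 1"
  by (simp add: measure_def emeasure_sphere_measure_sphere)

lemma borel_measurable_sphere_continuous:
  fixes f :: "'a::euclidean_space \<Rightarrow> real"
  assumes "continuous_on (sphere 0 1) f"
  shows "f \<in> borel_measurable sphere_measure"
  using borel_measurable_continuous_on_restrict[OF assms]
  by (simp cong: measurable_cong_sets)

lemma integrable_sphere_continuous: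
  fixes f :: "'a::euclidean_space \<Rightarrow> real"
  assumes "continuous_on (sphere 0 1) f"
  shows "integrable sphere_measure f"
proof -
  have "compact (f ` sphere 0 1)"
    using assms by (intro compact_continuous_image) auto
  then obtain C where "\<And>x. x \<in> sphere 0 1 \<Longrightarrow> norm (f x) \<le> C"
    by (metis compact_imp_bounded bounded_iff image_eqI)
  then show ?thesis
    by (intro sphere.integrable_const_bound[of _ C] borel_measurable_sphere_continuous assms) auto
qed

text \<open>The radial projection commutes with \<open>R\<close>, so the cone over the preimage of a
  set is the preimage of the cone, and the invariance of Lebesgue measure applies.\<close>

lemma integral_sphere_orthogonal:
  fixes f :: "'a::euclidean_space \<Rightarrow> real" and R :: "'a \<Rightarrow> 'a"
  assumes R: "orthogonal_transformation R" and f: "continuous_on (sphere 0 1) f"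
  shows "(\<integral>x. f (R x) \<partial>sphere_measure) = (\<integral>x. f x \<partial>sphere_measure)"
proof -
  interpret lin: bounded_linear R
    using orthogonal_transformation_linear[OF R] by (simp add: linear_conv_bounded_linear)
  have Rb [measurable]: "R \<in> borel_measurable borel"
    by (intro borel_measurable_continuous_onI lin.continuous_on) auto
  have nR: "norm (R x) = norm x" for x using orthogonal_transformation_norm[OF R] .
  have Rs: "R \<in> measurable sphere_measure sphere_measure"
    by (rule measurable_cong_sets[THEN equalityD1, THEN subsetD, OF refl sets_sphere_measure[symmetric]])
       (auto intro!: measurable_restrict_space2 simp: nR cong: measurable_cong_sets
         intro: measurable_restrict_space1)
  have "distr sphere_measure sphere_measure R = (sphere_measure :: 'a measure)"
  proof (rule measure_eqI)
    fix A assume "A \<in> sets (distr sphere_measure sphere_measure R)"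
    then have A: "A \<in> sets borel" "A \<subseteq> sphere 0 1" and A': "A \<in> sets sphere_measure"
      by (auto simp: sets_restrict_space_iff)
    have A1: "R -` A \<in> sets borel" using measurable_sets[OF Rb A(1)] by simp
    have A2: "R -` A \<subseteq> sphere 0 1" using A(2) nR by auto
    have A3: "(\<lambda>x::'a. x /\<^sub>R norm x) -` A \<in> sets borel"
      using measurable_sets[OF _ A(1), of "\<lambda>x::'a. x /\<^sub>R norm x" borel] by simp
    have "emeasure (distr sphere_measure sphere_measure R) A = emeasure sphere_measure (R -` A)"
      using A2 by (simp add: emeasure_distr[OF Rs A'] Int_absorb2)
    also have "\<dots> = emeasure lborel (ball 0 1 \<inter> (\<lambda>x. x /\<^sub>R norm x) -` (R -` A)) / emeasure lborel (ball 0 1 :: 'a set)"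
      using emeasure_sphere_measure[OF A1 A2] by simp
    also have "ball 0 1 \<inter> (\<lambda>x. x /\<^sub>R norm x) -` (R -` A) = R -` (ball 0 1 \<inter> (\<lambda>x. x /\<^sub>R norm x) -` A)"
      by (auto simp: nR lin.scaleR)
    also have "emeasure lborel \<dots> = emeasure lborel (ball 0 1 \<inter> (\<lambda>x. x /\<^sub>R norm x) -` A)"
      using A3 by (intro emeasure_lborel_orthogonal_vimage R) auto
    finally show "emeasure (distr sphere_measure sphere_measure R) A = emeasure sphere_measure A"
      by (simp add: emeasure_sphere_measure[OF A])
  qed simp
  then have "(\<integral>x. f x \<partial>sphere_measure) = (\<integral>x. f x \<partial>distr sphere_measure sphere_measure R)" by simp
  also have "\<dots> = (\<integral>x. f (R x) \<partial>sphere_measure)"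
    by (intro integral_distr Rs borel_measurable_sphere_continuous f)
  finally show ?thesis by simp
qed

section \<open>Differential calculus of polynomials\<close>

text \<open>Taken from \<open>frechet_derivative\<close> to be linear in \<open>v\<close> for
  polynomials; \<open>laplacian_eq_dir_deriv\<close> translates the one-variable derivatives of
  \<open>laplacian\<close> into it.\<close>

definition dir_deriv :: "'a::euclidean_space \<Rightarrow> ('a \<Rightarrow> real) \<Rightarrow> 'a \<Rightarrow> real" where
  "dir_deriv v p x = frechet_derivative p (at x) v"

lemma real_polynomial_function_inner_left [intro]:
  "real_polynomial_function (\<lambda>x::'a::euclidean_space. x \<bullet> v)"
  by (rule real_polynomial_function.intros(1)) (rule bounded_linear_inner_left)

lemma real_polynomial_function_inner_self [intro]:
  "real_polynomial_function (\<lambda>x::'a::euclidean_space. x \<bullet> x)"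
  by (subst euclidean_inner) (auto intro!: real_polynomial_function_sum)

lemma real_polynomial_function_continuous_on:
  "real_polynomial_function p \<Longrightarrow> continuous_on S (p :: 'a::euclidean_space \<Rightarrow> real)"
  by (metis continuous_on_polymonial_function real_polynomial_function_eq)

lemma has_derivative_dir_deriv:
  assumes "real_polynomial_function p"
  shows "(p has_derivative (\<lambda>v. dir_deriv v p x)) (at x)"
  using differentiable_at_polynomial_function[of p x] assms
  unfolding dir_deriv_def real_polynomial_function_eq[symmetric]
  by (metis frechet_derivative_works real_polynomial_function_eq)

lemma dir_deriv_eqI:
  assumes "(p has_derivative p') (at x)"
  shows "dir_deriv v p x = p' v"
  unfolding dir_deriv_def using frechet_derivative_at[OF assms] by simp

lemma dir_deriv_const [simp]: "dir_deriv v (\<lambda>x. c) x = 0"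
  by (rule dir_deriv_eqI) (rule has_derivative_const)

lemma dir_deriv_inner [simp]: "dir_deriv v (\<lambda>x. x \<bullet> w) x = v \<bullet> w"
  by (rule dir_deriv_eqI) (auto intro!: derivative_eq_intros)

lemma dir_deriv_add:
  assumes "real_polynomial_function f" "real_polynomial_function g"
  shows "dir_deriv v (\<lambda>x. f x + g x) x = dir_deriv v f x + dir_deriv v g x"
  by (rule dir_deriv_eqI[OF has_derivative_add]) (use assms has_derivative_dir_deriv in auto)

lemma dir_deriv_mult:
  assumes "real_polynomial_function f" "real_polynomial_function g"
  shows "dir_deriv v (\<lambda>x. f x * g x) x = f x * dir_deriv v g x + dir_deriv v f x * g x"
  by (rule dir_deriv_eqI[OF has_derivative_mult]) (use assms has_derivative_dir_deriv in auto)

lemma dir_deriv_cmult: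
  assumes "real_polynomial_function f"
  shows "dir_deriv v (\<lambda>x. c * f x) x = c * dir_deriv v f x"
  by (rule dir_deriv_eqI[OF has_derivative_mult_right]) (use assms has_derivative_dir_deriv in auto)

lemma bounded_linear_dir_deriv:
  "real_polynomial_function p \<Longrightarrow> bounded_linear (\<lambda>v. dir_deriv v p x)"
  using has_derivative_dir_deriv has_derivative_bounded_linear by blast

lemma real_polynomial_function_dir_deriv [intro]:
  "real_polynomial_function p \<Longrightarrow> real_polynomial_function (dir_deriv v p)"
proof (induction p rule: real_polynomial_function.induct)
  case (linear f)
  then have "dir_deriv v f = (\<lambda>x. f v)"
    by (intro ext dir_deriv_eqI bounded_linear_imp_has_derivative)
  then show ?case by auto
next
  case (const c)
  have "dir_deriv v (\<lambda>x. c) = (\<lambda>x. 0)" by (intro ext) simp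
  then show ?case by auto
next
  case (add f g)
  have "dir_deriv v (\<lambda>x. f x + g x) = (\<lambda>x. dir_deriv v f x + dir_deriv v g x)"
    by (intro ext dir_deriv_add add)
  then show ?case using add by auto
next
  case (mult f g)
  have "dir_deriv v (\<lambda>x. f x * g x) = (\<lambda>x. f x * dir_deriv v g x + dir_deriv v f x * g x)"
    by (intro ext dir_deriv_mult mult)
  then show ?case using mult by auto
qed

lemma dir_deriv_basis:
  assumes "real_polynomial_function p"
  shows "dir_deriv v p x = (\<Sum>b\<in>Basis. (v \<bullet> b) * dir_deriv b p x)"
proof -
  interpret bounded_linear "\<lambda>v. dir_deriv v p x" by (rule bounded_linear_dir_deriv[OF assms])
  have "dir_deriv v p x = dir_deriv (\<Sum>b\<in>Basis. (v \<bullet> b) *\<^sub>R b) p x"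
    by (simp add: euclidean_representation)
  then show ?thesis by (simp only: sum scaleR real_scaleR_def)
qed

lemma DERIV_dir_deriv:
  assumes "real_polynomial_function p" "(f has_vector_derivative v) (at t)"
  shows "((\<lambda>t. p (f t)) has_real_derivative dir_deriv v p (f t)) (at t)"
proof -
  interpret bounded_linear "\<lambda>v. dir_deriv v p (f t)" by (rule bounded_linear_dir_deriv[OF assms(1)])
  have "((\<lambda>t. p (f t)) has_derivative (\<lambda>s. dir_deriv (s *\<^sub>R v) p (f t))) (at t)"
    using has_derivative_compose[OF assms(2)[unfolded has_vector_derivative_def] has_derivative_dir_deriv[OF assms(1)]] .
  then show ?thesis by (simp add: scaleR has_field_derivative_def mult.commute[of _ "dir_deriv v p (f t)"])
qed

lemma DERIV_dir_deriv_line: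
  assumes "real_polynomial_function p"
  shows "((\<lambda>t. p (x + t *\<^sub>R v)) has_real_derivative dir_deriv v p (x + t *\<^sub>R v)) (at t)"
  by (rule DERIV_dir_deriv[OF assms]) (auto intro!: derivative_eq_intros)

lemma laplacian_eq_dir_deriv:
  assumes "real_polynomial_function p"
  shows "laplacian p x = (\<Sum>b\<in>Basis. dir_deriv b (dir_deriv b p) x)"
proof -
  have "deriv (\<lambda>t. p (x + t *\<^sub>R b)) = (\<lambda>t. dir_deriv b p (x + t *\<^sub>R b))" for b
    by (intro ext DERIV_imp_deriv DERIV_dir_deriv_line assms)
  moreover have "deriv (\<lambda>t. dir_deriv b p (x + t *\<^sub>R b)) 0 = dir_deriv b (dir_deriv b p) (x + 0 *\<^sub>R b)" for b
    using assms by (intro DERIV_imp_deriv DERIV_dir_deriv_line) auto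
  ultimately show ?thesis by (simp add: laplacian_def numeral_2_eq_2)
qed

lemma laplacian_add:
  assumes "real_polynomial_function f" "real_polynomial_function g"
  shows "laplacian (\<lambda>x. f x + g x) x = laplacian f x + laplacian g x"
proof -
  have "dir_deriv b (\<lambda>x. f x + g x) = (\<lambda>x. dir_deriv b f x + dir_deriv b g x)" for b
    by (intro ext dir_deriv_add assms)
  then show ?thesis using assms
    by (auto simp: laplacian_eq_dir_deriv real_polynomial_function.intros(3) dir_deriv_add
        real_polynomial_function_dir_deriv sum.distrib)
qed

lemma laplacian_cmult:
  assumes "real_polynomial_function f"
  shows "laplacian (\<lambda>x. c * f x) x = c * laplacian f x"
proof -
  have "dir_deriv b (\<lambda>x. c * f x) = (\<lambda>x. c * dir_deriv b f x)" for b
    by (intro ext dir_deriv_cmult assms)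
  moreover have "real_polynomial_function (\<lambda>x. c * f x)" using assms by auto
  ultimately show ?thesis using assms
    by (auto simp: laplacian_eq_dir_deriv dir_deriv_cmult
        real_polynomial_function_dir_deriv sum_distrib_left)
qed

lemma laplacian_sum:
  assumes "finite I" "\<And>i. i \<in> I \<Longrightarrow> real_polynomial_function (f i)"
  shows "laplacian (\<lambda>x. \<Sum>i\<in>I. f i x) x = (\<Sum>i\<in>I. laplacian (f i) x)"
  using assms
proof (induction I rule: finite_induct)
  case empty
  have "laplacian (\<lambda>x. 0 * (0::real)) x = 0 * laplacian (\<lambda>x. 0) x"
    by (rule laplacian_cmult) auto
  then show ?case by simp
next
  case (insert i I)
  have "real_polynomial_function (\<lambda>x. \<Sum>i\<in>I. f i x)" using insert by auto
  then show ?case using insert by (auto simp: laplacian_add)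
qed

section \<open>Homogeneous polynomials and Euler's identity\<close>

definition homogeneous :: "nat \<Rightarrow> ('a::real_vector \<Rightarrow> real) \<Rightarrow> bool" where
  "homogeneous l p \<longleftrightarrow> (\<forall>c x. p (c *\<^sub>R x) = c ^ l * p x)"

lemma homogeneous_Euler:
  assumes p: "real_polynomial_function p" and h: "homogeneous l p"
  shows "dir_deriv x p x = real l * p x"
proof -
  have "((\<lambda>t. p (x + t *\<^sub>R x)) has_real_derivative dir_deriv x p (x + 0 *\<^sub>R x)) (at 0)"
    by (rule DERIV_dir_deriv_line[OF p])
  moreover have "p (x + t *\<^sub>R x) = (1 + t) ^ l * p x" for t
    using h[unfolded homogeneous_def, rule_format, of "1 + t" x] by (simp add: scaleR_left_distrib)
  moreover have "((\<lambda>t. (1 + t) ^ l * p x) has_real_derivative real l * p x) (at 0)"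
    by (auto intro!: derivative_eq_intros)
  ultimately show ?thesis by (auto intro: DERIV_unique)
qed

lemma homogeneous_Euler_deriv:
  assumes p: "real_polynomial_function p" and h: "homogeneous l p"
  shows "dir_deriv x (dir_deriv v p) x = (real l - 1) * dir_deriv v p x"
proof -
  \<comment> \<open>Homogeneity of degree \<open>l - 1\<close> of the derivative, multiplied by
    \<open>1 + s\<close> so that \<open>l = 0\<close> is covered as well.\<close>
  have *: "(1 + s) * dir_deriv v p (x + s *\<^sub>R x) = (1 + s) ^ l * dir_deriv v p x" for s
  proof -
    have "((\<lambda>t. p ((1 + s) *\<^sub>R x + t *\<^sub>R ((1 + s) *\<^sub>R v))) has_real_derivative
         dir_deriv ((1 + s) *\<^sub>R v) p ((1 + s) *\<^sub>R x + 0 *\<^sub>R ((1 + s) *\<^sub>R v))) (at 0)"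
      by (rule DERIV_dir_deriv_line[OF p])
    moreover have "p ((1 + s) *\<^sub>R x + t *\<^sub>R ((1 + s) *\<^sub>R v)) = (1 + s) ^ l * p (x + t *\<^sub>R v)" for t
      using h[unfolded homogeneous_def, rule_format, of "1 + s" "x + t *\<^sub>R v"]
      by (simp add: scaleR_right_distrib scaleR_left_commute mult.commute)
    moreover have "((\<lambda>t. (1 + s) ^ l * p (x + t *\<^sub>R v)) has_real_derivative
        (1 + s) ^ l * dir_deriv v p (x + 0 *\<^sub>R v)) (at 0)"
      by (intro DERIV_cmult DERIV_dir_deriv_line[OF p])
    ultimately have "dir_deriv ((1 + s) *\<^sub>R v) p ((1 + s) *\<^sub>R x) = (1 + s) ^ l * dir_deriv v p x"
      by (auto dest: DERIV_unique)
    moreover have "dir_deriv ((1 + s) *\<^sub>R v) p ((1 + s) *\<^sub>R x) = (1 + s) * dir_deriv v p ((1 + s) *\<^sub>R x)"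
      using linear_cmul[OF bounded_linear.linear[OF bounded_linear_dir_deriv[OF p]]] by simp
    ultimately show ?thesis by (simp add: scaleR_left_distrib)
  qed
  have "((\<lambda>s. (1 + s) * dir_deriv v p (x + s *\<^sub>R x)) has_real_derivative
      dir_deriv v p x + dir_deriv x (dir_deriv v p) x) (at 0)"
    using p by (auto intro!: derivative_eq_intros DERIV_dir_deriv_line)
  moreover have "((\<lambda>s. (1 + s) ^ l * dir_deriv v p x) has_real_derivative real l * dir_deriv v p x) (at 0)"
    by (auto intro!: derivative_eq_intros)
  ultimately show ?thesis unfolding * by (auto dest: DERIV_unique simp: algebra_simps)
qed

lemma dir_deriv_norm_sq:
  "dir_deriv v (\<lambda>x::'a::euclidean_space. x \<bullet> x) x = 2 * (x \<bullet> v)"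
  by (rule dir_deriv_eqI[where p' = "\<lambda>v. 2 * (x \<bullet> v)"])
     (auto intro!: derivative_eq_intros simp: inner_commute)

text \<open>In the product rule the cross term is four times the radial derivative of
  \<open>g\<close>, which Euler's identity evaluates; the rest comes from the Laplacian of
  \<open>x \<bullet> x\<close>, which is \<open>2 * DIM('a)\<close>.\<close>

lemma laplacian_norm_sq_mult:
  fixes g :: "'a::euclidean_space \<Rightarrow> real"
  assumes g: "real_polynomial_function g" and h: "homogeneous n g"
  shows "laplacian (\<lambda>x. (x \<bullet> x) * g x) x =
    (x \<bullet> x) * laplacian g x + (4 * real n + 2 * real DIM('a)) * g x"
proof -
  have 1: "dir_deriv b (\<lambda>x. (x \<bullet> x) * g x) = (\<lambda>x. (x \<bullet> x) * dir_deriv b g x + (2 * (x \<bullet> b)) * g x)" for b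
    using g by (auto simp: dir_deriv_mult dir_deriv_norm_sq real_polynomial_function_inner_self)
  have 2: "dir_deriv b (\<lambda>x. (x \<bullet> x) * dir_deriv b g x + (2 * (x \<bullet> b)) * g x) x =
      (x \<bullet> x) * dir_deriv b (dir_deriv b g) x + 4 * ((x \<bullet> b) * dir_deriv b g x) + 2 * (b \<bullet> b) * g x" for b
  proof -
    have r: "real_polynomial_function (\<lambda>x. (x \<bullet> x) * dir_deriv b g x)"
      "real_polynomial_function (\<lambda>x. 2 * (x \<bullet> b))"
      "real_polynomial_function (\<lambda>x. (2 * (x \<bullet> b)) * g x)"
      using g by (auto intro!: real_polynomial_function.intros(4) real_polynomial_function.intros(2))
    have "dir_deriv b (\<lambda>x. 2 * (x \<bullet> b)) x = 2 * (b \<bullet> b)"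
      by (subst dir_deriv_cmult) auto
    with r g have "dir_deriv b (\<lambda>x. (2 * (x \<bullet> b)) * g x) x = 2 * (x \<bullet> b) * dir_deriv b g x + 2 * (b \<bullet> b) * g x"
      by (subst dir_deriv_mult) auto
    moreover have "dir_deriv b (\<lambda>x. (x \<bullet> x) * dir_deriv b g x) x
        = (x \<bullet> x) * dir_deriv b (dir_deriv b g) x + 2 * (x \<bullet> b) * dir_deriv b g x"
      using g by (subst dir_deriv_mult) (auto simp: dir_deriv_norm_sq)
    ultimately show ?thesis
      by (simp add: dir_deriv_add[OF r(1,3)])
  qed
  have "real_polynomial_function (\<lambda>x. (x \<bullet> x) * g x)" using g by auto
  then have "laplacian (\<lambda>x. (x \<bullet> x) * g x) x = (x \<bullet> x) * (\<Sum>b\<in>Basis. dir_deriv b (dir_deriv b g) x)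
      + 4 * (\<Sum>b\<in>Basis. (x \<bullet> b) * dir_deriv b g x) + 2 * real DIM('a) * g x"
    by (simp add: laplacian_eq_dir_deriv 1 2 sum.distrib sum_distrib_left)
  also have "(\<Sum>b\<in>Basis. (x \<bullet> b) * dir_deriv b g x) = real n * g x"
    using homogeneous_Euler[OF g h] dir_deriv_basis[OF g, of x x] by simp
  finally show ?thesis using g by (simp add: laplacian_eq_dir_deriv algebra_simps)
qed

section \<open>Integration by parts on the sphere\<close>

text \<open>For distinct basis vectors this turns \<open>b\<close> towards \<open>c\<close> by the
  angle \<theta>. Written as the identity plus a correction in the plane, it needs no mention of the
  other coordinates.\<close>

definition plane_rotation :: "'a::euclidean_space \<Rightarrow> 'a \<Rightarrow> real \<Rightarrow> 'a \<Rightarrow> 'a" where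
  "plane_rotation b c \<theta> y = y
     + ((cos \<theta> - 1) * (y \<bullet> b) - sin \<theta> * (y \<bullet> c)) *\<^sub>R b
     + ((cos \<theta> - 1) * (y \<bullet> c) + sin \<theta> * (y \<bullet> b)) *\<^sub>R c"

lemma orthogonal_plane_rotation:
  assumes "b \<in> Basis" "c \<in> Basis" "b \<noteq> c"
  shows "orthogonal_transformation (plane_rotation b c \<theta>)"
proof -
  have [simp]: "b \<bullet> b = 1" "c \<bullet> c = 1" "b \<bullet> c = 0" "c \<bullet> b = 0"
    using assms by (simp_all add: inner_Basis)
  have lin: "linear (plane_rotation b c \<theta>)"
    by (rule linearI) (simp_all add: plane_rotation_def algebra_simps inner_add_left scaleR_left_distrib scaleR_left_diff_distrib)
  have "plane_rotation b c \<theta> y \<bullet> plane_rotation b c \<theta> y = y \<bullet> y" for y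
  proof -
    define p q where "p = (cos \<theta> - 1) * (y \<bullet> b) - sin \<theta> * (y \<bullet> c)" and "q = (cos \<theta> - 1) * (y \<bullet> c) + sin \<theta> * (y \<bullet> b)"
    have "plane_rotation b c \<theta> y \<bullet> plane_rotation b c \<theta> y = y \<bullet> y + (2 * (p * (y \<bullet> b) + q * (y \<bullet> c)) + p\<^sup>2 + q\<^sup>2)"
      unfolding plane_rotation_def p_def[symmetric] q_def[symmetric]
      by (simp add: inner_add_left inner_add_right inner_commute[of b y] inner_commute[of c y] power2_eq_square distrib_left)
    also have "2 * (p * (y \<bullet> b) + q * (y \<bullet> c)) + p\<^sup>2 + q\<^sup>2 = ((y \<bullet> b)\<^sup>2 + (y \<bullet> c)\<^sup>2) * ((sin \<theta>)\<^sup>2 + (cos \<theta>)\<^sup>2 - 1)"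
      unfolding p_def q_def by algebra
    finally show ?thesis by simp
  qed
  then have "norm (plane_rotation b c \<theta> y) = norm y" for y
    by (simp add: norm_eq_sqrt_inner)
  with lin show ?thesis by (simp add: orthogonal_transformation)
qed

text \<open>The derivative is expressed at the rotated point, that is, the rotations are the flow of
  a fixed vector field. By the mean value theorem a difference quotient along the flow is then a
  value of one fixed function on the sphere.\<close>

lemma has_vector_derivative_plane_rotation:
  assumes "b \<in> Basis" "c \<in> Basis" "b \<noteq> c"
  shows "((\<lambda>\<theta>. plane_rotation b c \<theta> y) has_vector_derivative
    ((plane_rotation b c \<theta> y \<bullet> b) *\<^sub>R c - (plane_rotation b c \<theta> y \<bullet> c) *\<^sub>R b)) (at \<theta>)"
proof -
  have [simp]: "b \<bullet> b = 1" "c \<bullet> c = 1" "b \<bullet> c = 0" "c \<bullet> b = 0"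
    using assms by (simp_all add: inner_Basis)
  have "((\<lambda>\<theta>. plane_rotation b c \<theta> y) has_vector_derivative
    (- sin \<theta> * (y \<bullet> b) - cos \<theta> * (y \<bullet> c)) *\<^sub>R b + (- sin \<theta> * (y \<bullet> c) + cos \<theta> * (y \<bullet> b)) *\<^sub>R c) (at \<theta>)"
    unfolding plane_rotation_def
    by (auto intro!: derivative_eq_intros simp: has_real_derivative_iff_has_vector_derivative[symmetric])
  moreover
  have "plane_rotation b c \<theta> y \<bullet> b = cos \<theta> * (y \<bullet> b) - sin \<theta> * (y \<bullet> c)"
    "plane_rotation b c \<theta> y \<bullet> c = cos \<theta> * (y \<bullet> c) + sin \<theta> * (y \<bullet> b)"
    by (simp_all add: plane_rotation_def inner_add_left algebra_simps)
  then have "(plane_rotation b c \<theta> y \<bullet> b) *\<^sub>R c - (plane_rotation b c \<theta> y \<bullet> c) *\<^sub>R b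
     = (- sin \<theta> * (y \<bullet> b) - cos \<theta> * (y \<bullet> c)) *\<^sub>R b + (- sin \<theta> * (y \<bullet> c) + cos \<theta> * (y \<bullet> b)) *\<^sub>R c"
    by (simp only:) (simp add: algebra_simps scaleR_left_diff_distrib scaleR_left_distrib)
  ultimately show ?thesis by (simp only:)
qed

text \<open>By rotation invariance the integral of \<open>F\<close> composed with the rotation is
  constant in the angle. Its derivative at angle 0 is computed under the integral by dominated
  convergence along \<open>t n\<close>.\<close>

lemma integral_sphere_rotation_field:
  fixes F :: "'a::euclidean_space \<Rightarrow> real"
  assumes bc: "b \<in> Basis" "c \<in> Basis" "b \<noteq> c" and F: "real_polynomial_function F"
  shows "(\<integral>y. (y \<bullet> b) * dir_deriv c F y - (y \<bullet> c) * dir_deriv b F y \<partial>sphere_measure) = 0"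
proof -
  let ?R = "plane_rotation b c"
  define G where "G y = (y \<bullet> b) * dir_deriv c F y - (y \<bullet> c) * dir_deriv b F y" for y
  have Gpoly: "real_polynomial_function G"
    unfolding G_def using F by (intro real_polynomial_function_diff real_polynomial_function.intros(4)) auto
  have R0: "?R 0 y = y" for y by (simp add: plane_rotation_def)
  have nR: "norm (?R \<theta> y) = norm y" for \<theta> y
    using orthogonal_transformation_norm[OF orthogonal_plane_rotation[OF bc]] .
  have der: "((\<lambda>\<theta>. F (?R \<theta> y)) has_real_derivative G (?R \<theta> y)) (at \<theta>)" for \<theta> y
  proof -
    have "dir_deriv ((?R \<theta> y \<bullet> b) *\<^sub>R c - (?R \<theta> y \<bullet> c) *\<^sub>R b) F (?R \<theta> y) = G (?R \<theta> y)"
    proof -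
      interpret bounded_linear "\<lambda>v. dir_deriv v F (?R \<theta> y)" by (rule bounded_linear_dir_deriv[OF F])
      show ?thesis by (simp add: G_def diff scaleR)
    qed
    then show ?thesis
      using DERIV_dir_deriv[OF F has_vector_derivative_plane_rotation[OF bc, of y \<theta>]] by simp
  qed
  have "compact (G ` sphere 0 1)"
    using Gpoly by (intro compact_continuous_image real_polynomial_function_continuous_on) auto
  then obtain C where C: "\<And>x. x \<in> sphere 0 1 \<Longrightarrow> \<bar>G x\<bar> \<le> C"
    by (metis compact_imp_bounded bounded_iff image_eqI real_norm_def)
  define t :: "nat \<Rightarrow> real" where "t n = inverse (real (Suc n))" for n
  have t: "t \<longlonglongrightarrow> 0" "t n > 0" "t n \<noteq> 0" for n
    unfolding t_def using LIMSEQ_inverse_real_of_nat by auto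
  define q where "q n y = (F (?R (t n) y) - F y) / t n" for n y
  have cR: "continuous_on S (?R \<theta>)" for S \<theta>
    using orthogonal_transformation_linear[OF orthogonal_plane_rotation[OF bc]]
    by (simp add: linear_continuous_on linear_conv_bounded_linear)
  have cFR: "continuous_on S (\<lambda>y. F (?R \<theta> y))" for S \<theta>
    using continuous_on_compose2[OF real_polynomial_function_continuous_on[OF F, of UNIV] cR] by simp
  have cq: "continuous_on (sphere 0 1) (q n)" for n
    unfolding q_def using F t(3)
    by (intro continuous_intros cFR real_polynomial_function_continuous_on) auto
  have "(\<lambda>n. \<integral>y. q n y \<partial>sphere_measure) \<longlonglongrightarrow> (\<integral>y. G y \<partial>sphere_measure)"
  proof (rule integral_dominated_convergence[where w = "\<lambda>_. C"])
    show "AE y in sphere_measure. (\<lambda>n. q n y) \<longlonglongrightarrow> G y"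
    proof (rule AE_I2)
      fix y :: 'a
      have "((\<lambda>h. (F (?R (0 + h) y) - F (?R 0 y)) / h) \<longlongrightarrow> G (?R 0 y)) (at 0)"
        using der[of y 0] unfolding DERIV_def .
      then show "(\<lambda>n. q n y) \<longlonglongrightarrow> G y"
        unfolding q_def R0 using t by (auto simp: tendsto_at_iff_sequentially o_def)
    qed
    show "AE y in sphere_measure. norm (q n y) \<le> C" for n
    proof (rule AE_I2)
      fix y :: 'a assume "y \<in> space sphere_measure"
      then have y: "norm y = 1" by simp
      obtain z where "F (?R (t n) y) - F (?R 0 y) = (t n - 0) * G (?R z y)"
        using MVT2[OF t(2)[of n], of "\<lambda>\<theta>. F (?R \<theta> y)" "\<lambda>\<theta>. G (?R \<theta> y)"] der by blast
      then have "q n y = G (?R z y)" using t(3)[of n] by (simp add: q_def R0)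
      then show "norm (q n y) \<le> C" using C[of "?R z y"] by (simp add: nR y)
    qed
  qed (use Gpoly cq in \<open>simp_all add: borel_measurable_sphere_continuous real_polynomial_function_continuous_on\<close>)
  moreover have "(\<integral>y. q n y \<partial>sphere_measure) = 0" for n
  proof -
    have "(\<integral>y. F (?R (t n) y) \<partial>sphere_measure) = (\<integral>y. F y \<partial>sphere_measure)"
      using integral_sphere_orthogonal[OF orthogonal_plane_rotation[OF bc]] F
      by (simp add: real_polynomial_function_continuous_on)
    then show ?thesis unfolding q_def
      by (simp add: Bochner_Integration.integral_diff integrable_sphere_continuous cFR real_polynomial_function_continuous_on F)
  qed
  ultimately have "(\<integral>y. G y \<partial>sphere_measure) = 0" by (simp add: LIMSEQ_const_iff)
  then show ?thesis unfolding G_def .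
qed

lemma integral_sphere_cong:
  fixes f g :: "'a::euclidean_space \<Rightarrow> real"
  assumes "\<And>x. norm x = 1 \<Longrightarrow> f x = g x"
  shows "(\<integral>x. f x \<partial>sphere_measure) = (\<integral>x. g x \<partial>sphere_measure)"
  by (rule Bochner_Integration.integral_cong) (use assms in auto)

lemma integrable_sphere_polynomial:
  "real_polynomial_function (f :: 'a::euclidean_space \<Rightarrow> real) \<Longrightarrow> integrable sphere_measure f"
  by (intro integrable_sphere_continuous real_polynomial_function_continuous_on)

lemma real_polynomial_function_radial_deriv [intro]:
  "real_polynomial_function (\<phi> :: 'a::euclidean_space \<Rightarrow> real) \<Longrightarrow> real_polynomial_function (\<lambda>y. dir_deriv y \<phi> y)"
  by (subst dir_deriv_basis) (auto intro!: real_polynomial_function_sum)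

text \<open>The rotation fields in the planes spanned by \<open>b\<close> and \<open>c\<close>, applied to \<open>(y \<bullet> c) * \<phi> y\<close> and summed over \<open>c\<close>.\<close>

lemma integral_sphere_dir_deriv:
  fixes \<phi> :: "'a::euclidean_space \<Rightarrow> real"
  assumes \<phi>: "real_polynomial_function \<phi>"
  shows "(\<integral>y. dir_deriv v \<phi> y \<partial>sphere_measure)
    = (\<integral>y. (y \<bullet> v) * ((real DIM('a) - 1) * \<phi> y + dir_deriv y \<phi> y) \<partial>sphere_measure)"
proof -
  define E where "E y = (real DIM('a) - 1) * \<phi> y + dir_deriv y \<phi> y" for y
  have E: "real_polynomial_function E"
    unfolding E_def using \<phi>
    by (intro real_polynomial_function.intros(2-4) real_polynomial_function_radial_deriv)
  have basis: "(\<integral>y. dir_deriv b \<phi> y \<partial>sphere_measure) = (\<integral>y. (y \<bullet> b) * E y \<partial>sphere_measure)"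
    if b: "b \<in> Basis" for b
  proof -
    define F where "F c y = (y \<bullet> c) * \<phi> y" for c y
    have F: "real_polynomial_function (F c)" for c unfolding F_def using \<phi> by auto
    have dF: "dir_deriv v (F c) y = (y \<bullet> c) * dir_deriv v \<phi> y + (v \<bullet> c) * \<phi> y" for c v y
      unfolding F_def using \<phi> by (simp add: dir_deriv_mult real_polynomial_function_inner_left)
    define r where "r c y = (y \<bullet> b) * dir_deriv c (F c) y - (y \<bullet> c) * dir_deriv b (F c) y" for c y
    have r: "real_polynomial_function (r c)" for c
      unfolding r_def using F by (intro real_polynomial_function_diff real_polynomial_function.intros(4)) auto
    have sum_r: "(\<Sum>c\<in>Basis - {b}. r c y) = (y \<bullet> b) * E y - dir_deriv b \<phi> y" if "norm y = 1" for y
    proof -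
      have "(\<Sum>c\<in>Basis - {b}. r c y)
         = (\<Sum>c\<in>Basis - {b}. (y \<bullet> b) * (\<phi> y + (y \<bullet> c) * dir_deriv c \<phi> y) - (y \<bullet> c)\<^sup>2 * dir_deriv b \<phi> y)"
        by (rule sum.cong) (use b in \<open>auto simp: r_def dF inner_Basis power2_eq_square algebra_simps\<close>)
      also have "\<dots> = (y \<bullet> b) * ((real DIM('a) - 1) * \<phi> y) +
          (\<Sum>c\<in>Basis - {b}. (y \<bullet> b) * ((y \<bullet> c) * dir_deriv c \<phi> y) - (y \<bullet> c)\<^sup>2 * dir_deriv b \<phi> y)"
        using b by (simp add: sum_subtractf sum.distrib distrib_left sum_distrib_left[symmetric] card_Diff_singleton of_nat_diff DIM_positive Suc_leI)
      \<comment> \<open>The index \<open>c = b\<close> may be added because its two terms cancel.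
        The sums over the full basis are then a radial derivative and
        \<open>y \<bullet> y\<close>.\<close>
      also have "(\<Sum>c\<in>Basis - {b}. (y \<bullet> b) * ((y \<bullet> c) * dir_deriv c \<phi> y) - (y \<bullet> c)\<^sup>2 * dir_deriv b \<phi> y)
         = (\<Sum>c\<in>Basis. (y \<bullet> b) * ((y \<bullet> c) * dir_deriv c \<phi> y) - (y \<bullet> c)\<^sup>2 * dir_deriv b \<phi> y)"
        using b by (intro sum.mono_neutral_left) (auto simp: power2_eq_square)
      also have "\<dots> = (y \<bullet> b) * dir_deriv y \<phi> y - (y \<bullet> y) * dir_deriv b \<phi> y"
        by (simp add: sum_subtractf dir_deriv_basis[OF \<phi>, of y y] euclidean_inner[of y y]
            sum_distrib_left sum_distrib_right power2_eq_square)
      finally show ?thesis using that by (simp add: E_def algebra_simps dot_square_norm)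
    qed
    have "(\<integral>y. (\<Sum>c\<in>Basis - {b}. r c y) \<partial>sphere_measure) = (\<Sum>c\<in>Basis - {b}. \<integral>y. r c y \<partial>sphere_measure)"
      by (rule Bochner_Integration.integral_sum) (use r in \<open>auto intro: integrable_sphere_polynomial\<close>)
    also have "\<dots> = 0"
      using b F unfolding r_def by (intro sum.neutral ballI integral_sphere_rotation_field) auto
    also have "(\<integral>y. (\<Sum>c\<in>Basis - {b}. r c y) \<partial>sphere_measure)
        = (\<integral>y. (y \<bullet> b) * E y - dir_deriv b \<phi> y \<partial>sphere_measure)"
      by (rule integral_sphere_cong) (rule sum_r)
    also have "\<dots> = (\<integral>y. (y \<bullet> b) * E y \<partial>sphere_measure) - (\<integral>y. dir_deriv b \<phi> y \<partial>sphere_measure)"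
      using E \<phi> by (intro Bochner_Integration.integral_diff integrable_sphere_polynomial) auto
    finally show ?thesis by simp
  qed
  have "(\<integral>y. dir_deriv v \<phi> y \<partial>sphere_measure) = (\<integral>y. (\<Sum>b\<in>Basis. (v \<bullet> b) * dir_deriv b \<phi> y) \<partial>sphere_measure)"
    by (simp add: dir_deriv_basis[OF \<phi>, of v])
  also have "\<dots> = (\<Sum>b\<in>Basis. (v \<bullet> b) * (\<integral>y. dir_deriv b \<phi> y \<partial>sphere_measure))"
    using \<phi> by (subst Bochner_Integration.integral_sum) (auto intro!: integrable_sphere_polynomial)
  also have "\<dots> = (\<Sum>b\<in>Basis. (v \<bullet> b) * (\<integral>y. (y \<bullet> b) * E y \<partial>sphere_measure))"
    by (simp add: basis)
  also have "\<dots> = (\<integral>y. (\<Sum>b\<in>Basis. (v \<bullet> b) * ((y \<bullet> b) * E y)) \<partial>sphere_measure)"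
    using E by (subst Bochner_Integration.integral_sum) (auto intro!: integrable_sphere_polynomial)
  also have "\<dots> = (\<integral>y. (y \<bullet> v) * E y \<partial>sphere_measure)"
  proof (rule integral_sphere_cong)
    fix y :: 'a
    show "(\<Sum>b\<in>Basis. (v \<bullet> b) * ((y \<bullet> b) * E y)) = (y \<bullet> v) * E y"
      by (subst (2) euclidean_inner) (simp add: sum_distrib_right sum_distrib_left mult_ac)
  qed
  finally show ?thesis unfolding E_def .
qed

text \<open>Members of \<open>spherical_harmonics\<close> are cut off outside the sphere and so
  cannot be differentiated; the calculus works with the polynomial itself.\<close>

definition harmonic_polynomial :: "nat \<Rightarrow> ('a::euclidean_space \<Rightarrow> real) \<Rightarrow> bool" where
  "harmonic_polynomial l h \<longleftrightarrow>
     real_polynomial_function h \<and> homogeneous l h \<and> (\<forall>x. laplacian h x = 0)"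

text \<open>On functions of \<open>t = y \<bullet> x\<close> the spherical Laplacian is (1 - t^2)
  g'' - d t g' with d = DIM - 1. The identity moves it onto \<open>h\<close>, where it acts as -
  \<open>eigval\<close>. It follows by eliminating the mixed term \<open>?A\<close> from two
  integrations by parts.\<close>

lemma integral_sphere_zonal_harmonic:
  fixes h :: "'a::euclidean_space \<Rightarrow> real"
  assumes h: "harmonic_polynomial l h" and x: "norm x = 1"
    and g: "real_polynomial_function g" "real_polynomial_function g'" "real_polynomial_function g''"
    and dg: "\<And>t. (g has_real_derivative g' t) (at t)" "\<And>t. (g' has_real_derivative g'' t) (at t)"
  shows "(\<integral>y. g'' (y \<bullet> x) * h y \<partial>sphere_measure) =
    (\<integral>y. ((real DIM('a) - 1) * (y \<bullet> x) * g' (y \<bullet> x) + (y \<bullet> x)\<^sup>2 * g'' (y \<bullet> x)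
       - eigval (DIM('a) - 1) l * g (y \<bullet> x)) * h y \<partial>sphere_measure)"
proof -
  have hp: "real_polynomial_function h" and hh: "homogeneous l h" and hl: "\<And>y. laplacian h y = 0"
    using h by (auto simp: harmonic_polynomial_def)
  define d where "d = real DIM('a) - 1"
  have zp: "real_polynomial_function (\<lambda>y. G (y \<bullet> x))" if "real_polynomial_function G" for G
    using real_polynomial_function_compose[OF _ that, of "\<lambda>y. y \<bullet> x"] real_polynomial_function_inner_left[of x]
    by (simp add: o_def real_polynomial_function_eq)
  have zd: "dir_deriv v (\<lambda>y. G (y \<bullet> x)) y = G' (y \<bullet> x) * (v \<bullet> x)"
    if "\<And>t. (G has_real_derivative G' t) (at t)" for G G' v y
  proof (rule dir_deriv_eqI)
    show "((\<lambda>y. G (y \<bullet> x)) has_derivative (\<lambda>v. G' (y \<bullet> x) * (v \<bullet> x))) (at y)"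
      using has_derivative_compose[OF has_derivative_inner_left[OF has_derivative_ident]
          that[unfolded has_field_derivative_def], of x y] by simp
  qed
  note polys = zp[OF g(1)] zp[OF g(2)] zp[OF g(3)] hp
  let ?A = "\<integral>y. g' (y \<bullet> x) * dir_deriv x h y \<partial>sphere_measure"
  \<comment> \<open>The divergence of g(y . x) times the gradient of \<open>h\<close> is exactly the
    integrand of \<open>?A\<close>, because \<open>h\<close> is harmonic.\<close>
  have 1: "?A = (\<integral>y. real l * ((d + real l - 1) * g (y \<bullet> x) + (y \<bullet> x) * g' (y \<bullet> x)) * h y \<partial>sphere_measure)"
  proof -
    define \<phi> where "\<phi> b y = g (y \<bullet> x) * dir_deriv b h y" for b y
    have \<phi>: "real_polynomial_function (\<phi> b)" for b unfolding \<phi>_def using polys by auto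
    have d\<phi>: "dir_deriv v (\<phi> b) y = g (y \<bullet> x) * dir_deriv v (dir_deriv b h) y + g' (y \<bullet> x) * (v \<bullet> x) * dir_deriv b h y" for v b y
      unfolding \<phi>_def using polys by (subst dir_deriv_mult) (auto simp: zd[OF dg(1)])
    have "?A = (\<integral>y. (\<Sum>b\<in>Basis. dir_deriv b (\<phi> b) y) \<partial>sphere_measure)"
    proof (rule integral_sphere_cong)
      fix y :: 'a
      have "(\<Sum>b\<in>Basis. dir_deriv b (\<phi> b) y) =
         g (y \<bullet> x) * laplacian h y + g' (y \<bullet> x) * (\<Sum>b\<in>Basis. (x \<bullet> b) * dir_deriv b h y)"
        by (simp add: d\<phi> laplacian_eq_dir_deriv[OF hp] sum.distrib sum_distrib_left inner_commute mult.assoc)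
      then show "g' (y \<bullet> x) * dir_deriv x h y = (\<Sum>b\<in>Basis. dir_deriv b (\<phi> b) y)"
        by (simp add: hl dir_deriv_basis[OF hp, of x])
    qed
    also have "\<dots> = (\<Sum>b\<in>Basis. \<integral>y. dir_deriv b (\<phi> b) y \<partial>sphere_measure)"
      using \<phi> by (intro Bochner_Integration.integral_sum integrable_sphere_polynomial) auto
    also have "\<dots> = (\<Sum>b\<in>Basis. \<integral>y. (y \<bullet> b) * (d * \<phi> b y + dir_deriv y (\<phi> b) y) \<partial>sphere_measure)"
      unfolding d_def using \<phi> by (intro sum.cong refl integral_sphere_dir_deriv)
    also have "\<dots> = (\<integral>y. (\<Sum>b\<in>Basis. (y \<bullet> b) * (d * \<phi> b y + dir_deriv y (\<phi> b) y)) \<partial>sphere_measure)"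
      using \<phi> by (intro Bochner_Integration.integral_sum[symmetric] integrable_sphere_polynomial
          real_polynomial_function.intros(4) real_polynomial_function.intros(3)
          real_polynomial_function_radial_deriv real_polynomial_function_inner_left real_polynomial_function.intros(2))
    also have "\<dots> = (\<integral>y. real l * ((d + real l - 1) * g (y \<bullet> x) + (y \<bullet> x) * g' (y \<bullet> x)) * h y \<partial>sphere_measure)"
    proof (rule integral_sphere_cong)
      fix y :: 'a
      have *: "d * \<phi> b y + dir_deriv y (\<phi> b) y = ((d + real l - 1) * g (y \<bullet> x) + (y \<bullet> x) * g' (y \<bullet> x)) * dir_deriv b h y" for b
        by (simp add: d\<phi> \<phi>_def homogeneous_Euler_deriv[OF hp hh] algebra_simps)
      have "(\<Sum>b\<in>Basis. (y \<bullet> b) * (d * \<phi> b y + dir_deriv y (\<phi> b) y))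
         = ((d + real l - 1) * g (y \<bullet> x) + (y \<bullet> x) * g' (y \<bullet> x)) * (\<Sum>b\<in>Basis. (y \<bullet> b) * dir_deriv b h y)"
        by (simp only: * sum_distrib_left sum_distrib_right mult_ac)
      also have "(\<Sum>b\<in>Basis. (y \<bullet> b) * dir_deriv b h y) = real l * h y"
        using homogeneous_Euler[OF hp hh] dir_deriv_basis[OF hp, of y y] by simp
      finally show "(\<Sum>b\<in>Basis. (y \<bullet> b) * (d * \<phi> b y + dir_deriv y (\<phi> b) y))
         = real l * ((d + real l - 1) * g (y \<bullet> x) + (y \<bullet> x) * g' (y \<bullet> x)) * h y" by simp
    qed
    finally show ?thesis .
  qed
  \<comment> \<open>Here the derivative in direction \<open>x\<close> of g'(y . x) h is integrated;
    \<open>norm x = 1\<close> makes the coefficient of g'' equal to 1.\<close>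
  have 2: "(\<integral>y. g'' (y \<bullet> x) * h y \<partial>sphere_measure) + ?A =
     (\<integral>y. (y \<bullet> x) * ((d + real l) * g' (y \<bullet> x) + (y \<bullet> x) * g'' (y \<bullet> x)) * h y \<partial>sphere_measure)"
  proof -
    define \<phi> where "\<phi> y = g' (y \<bullet> x) * h y" for y
    have \<phi>: "real_polynomial_function \<phi>" unfolding \<phi>_def using polys by auto
    have d\<phi>: "dir_deriv v \<phi> y = g' (y \<bullet> x) * dir_deriv v h y + g'' (y \<bullet> x) * (v \<bullet> x) * h y" for v y
      unfolding \<phi>_def using polys by (subst dir_deriv_mult) (auto simp: zd[OF dg(2)])
    have "(\<integral>y. g'' (y \<bullet> x) * h y \<partial>sphere_measure) + ?A = (\<integral>y. g'' (y \<bullet> x) * h y + g' (y \<bullet> x) * dir_deriv x h y \<partial>sphere_measure)"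
      using polys by (intro Bochner_Integration.integral_add[symmetric] integrable_sphere_polynomial) auto
    also have "\<dots> = (\<integral>y. dir_deriv x \<phi> y \<partial>sphere_measure)"
      using x by (intro integral_sphere_cong) (simp add: d\<phi> dot_square_norm)
    also have "\<dots> = (\<integral>y. (y \<bullet> x) * (d * \<phi> y + dir_deriv y \<phi> y) \<partial>sphere_measure)"
      unfolding d_def by (rule integral_sphere_dir_deriv[OF \<phi>])
    also have "\<dots> = (\<integral>y. (y \<bullet> x) * ((d + real l) * g' (y \<bullet> x) + (y \<bullet> x) * g'' (y \<bullet> x)) * h y \<partial>sphere_measure)"
      by (intro integral_sphere_cong) (simp add: d\<phi> \<phi>_def homogeneous_Euler[OF hp hh] algebra_simps)
    finally show ?thesis .
  qed
  have "(\<integral>y. g'' (y \<bullet> x) * h y \<partial>sphere_measure) =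
     (\<integral>y. (y \<bullet> x) * ((d + real l) * g' (y \<bullet> x) + (y \<bullet> x) * g'' (y \<bullet> x)) * h y \<partial>sphere_measure)
     - (\<integral>y. real l * ((d + real l - 1) * g (y \<bullet> x) + (y \<bullet> x) * g' (y \<bullet> x)) * h y \<partial>sphere_measure)"
    using 1 2 by simp
  also have "\<dots> = (\<integral>y. (y \<bullet> x) * ((d + real l) * g' (y \<bullet> x) + (y \<bullet> x) * g'' (y \<bullet> x)) * h y
     - real l * ((d + real l - 1) * g (y \<bullet> x) + (y \<bullet> x) * g' (y \<bullet> x)) * h y \<partial>sphere_measure)"
    using polys by (intro Bochner_Integration.integral_diff[symmetric] integrable_sphere_polynomial)
      (auto intro!: real_polynomial_function.intros(3,4))
  also have "\<dots> = (\<integral>y. (d * (y \<bullet> x) * g' (y \<bullet> x) + (y \<bullet> x)\<^sup>2 * g'' (y \<bullet> x)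
       - eigval (DIM('a) - 1) l * g (y \<bullet> x)) * h y \<partial>sphere_measure)"
    by (intro integral_sphere_cong)
       (simp add: eigval_def d_def of_nat_diff DIM_positive Suc_leI power2_eq_square algebra_simps)
  finally show ?thesis unfolding d_def .
qed

text \<open>Integrating the product of the ambient gradients by parts gives m (d + l + m - 1) times
  the integral of g h. The left side is symmetric in the two functions, hence (m - l) (d + l + m -
  1) annihilates that integral; for l \<noteq> m and d \<ge> 1 both factors are nonzero.\<close>

lemma integral_sphere_harmonic_orthogonal:
  fixes g h :: "'a::euclidean_space \<Rightarrow> real"
  assumes g: "harmonic_polynomial l g" and h: "harmonic_polynomial m h" and lm: "l \<noteq> m"
    and DIM: "DIM('a) \<ge> 2"
  shows "(\<integral>y. g y * h y \<partial>sphere_measure) = 0"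
proof -
  define d where "d = real DIM('a) - 1"
  have "d \<ge> 1" using DIM unfolding d_def by linarith
  have Green: "(\<integral>y. (\<Sum>b\<in>Basis. dir_deriv b g y * dir_deriv b h y) \<partial>sphere_measure)
      = real m * (d + real l + real m - 1) * (\<integral>y. g y * h y \<partial>sphere_measure)"
    if g: "harmonic_polynomial l g" and h: "harmonic_polynomial m h" for l m and g h :: "'a \<Rightarrow> real"
  proof -
    have gp: "real_polynomial_function g" "homogeneous l g"
      and hp: "real_polynomial_function h" "homogeneous m h" "\<And>y. laplacian h y = 0"
      using g h by (auto simp: harmonic_polynomial_def)
    define \<phi> where "\<phi> b y = g y * dir_deriv b h y" for b y
    have \<phi>: "real_polynomial_function (\<phi> b)" for b unfolding \<phi>_def using gp hp by auto
    have d\<phi>: "dir_deriv v (\<phi> b) y = g y * dir_deriv v (dir_deriv b h) y + dir_deriv v g y * dir_deriv b h y" for v b y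
      unfolding \<phi>_def using gp hp by (subst dir_deriv_mult) auto
    have "(\<Sum>b\<in>Basis. dir_deriv b g y * dir_deriv b h y) = (\<Sum>b\<in>Basis. dir_deriv b (\<phi> b) y)" for y
      using hp(3)[of y] by (simp add: d\<phi> sum.distrib laplacian_eq_dir_deriv[OF hp(1)] flip: sum_distrib_left)
    then have "(\<integral>y. (\<Sum>b\<in>Basis. dir_deriv b g y * dir_deriv b h y) \<partial>sphere_measure)
        = (\<Sum>b\<in>Basis. \<integral>y. dir_deriv b (\<phi> b) y \<partial>sphere_measure)"
      using \<phi> by (simp only:) (intro Bochner_Integration.integral_sum integrable_sphere_polynomial, auto)
    also have "\<dots> = (\<Sum>b\<in>Basis. \<integral>y. (y \<bullet> b) * (d * \<phi> b y + dir_deriv y (\<phi> b) y) \<partial>sphere_measure)"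
      unfolding d_def using \<phi> by (intro sum.cong refl integral_sphere_dir_deriv)
    also have "\<dots> = (\<integral>y. (\<Sum>b\<in>Basis. (y \<bullet> b) * (d * \<phi> b y + dir_deriv y (\<phi> b) y)) \<partial>sphere_measure)"
      using \<phi> by (intro Bochner_Integration.integral_sum[symmetric] integrable_sphere_polynomial
          real_polynomial_function.intros(2-4) real_polynomial_function_radial_deriv real_polynomial_function_inner_left)
    also have "\<dots> = (\<integral>y. real m * (d + real l + real m - 1) * (g y * h y) \<partial>sphere_measure)"
    proof (rule integral_sphere_cong)
      fix y :: 'a
      have *: "d * \<phi> b y + dir_deriv y (\<phi> b) y = (d + real l + real m - 1) * g y * dir_deriv b h y" for b
        by (simp add: d\<phi> \<phi>_def homogeneous_Euler_deriv[OF hp(1,2)] homogeneous_Euler[OF gp] algebra_simps)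
      have "(\<Sum>b\<in>Basis. (y \<bullet> b) * (d * \<phi> b y + dir_deriv y (\<phi> b) y))
         = (d + real l + real m - 1) * g y * (\<Sum>b\<in>Basis. (y \<bullet> b) * dir_deriv b h y)"
        by (simp only: * sum_distrib_left sum_distrib_right mult_ac)
      also have "(\<Sum>b\<in>Basis. (y \<bullet> b) * dir_deriv b h y) = real m * h y"
        using homogeneous_Euler[OF hp(1,2)] dir_deriv_basis[OF hp(1), of y y] by simp
      finally show "(\<Sum>b\<in>Basis. (y \<bullet> b) * (d * \<phi> b y + dir_deriv y (\<phi> b) y))
         = real m * (d + real l + real m - 1) * (g y * h y)" by simp
    qed
    finally show ?thesis by simp
  qed
  have "(real m - real l) * (d + real l + real m - 1) * (\<integral>y. g y * h y \<partial>sphere_measure) = 0"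
  proof -
    have "(\<lambda>y. \<Sum>b\<in>Basis. dir_deriv b h y * dir_deriv b g y) = (\<lambda>y. \<Sum>b\<in>Basis. dir_deriv b g y * dir_deriv b h y)"
      "(\<lambda>y. h y * g y) = (\<lambda>y. g y * h y)"
      by (intro ext sum.cong refl mult.commute)+
    then have "real l * (d + real m + real l - 1) * (\<integral>y. g y * h y \<partial>sphere_measure)
       = real m * (d + real l + real m - 1) * (\<integral>y. g y * h y \<partial>sphere_measure)"
      using Green[OF g h] Green[OF h g] by (simp only:)
    then show ?thesis by (simp add: algebra_simps)
  qed
  moreover have "d + real l + real m - 1 \<noteq> 0"
    using lm \<open>d \<ge> 1\<close> by linarith
  ultimately show ?thesis using lm by simp
qed

section \<open>The zonal kernels and the Funk--Hecke formula\<close>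

text \<open>For unit vectors the base is \<open>1 - (dist x y)\<^sup>2 / 4\<close>, the squared
  cosine of half the angle between them. The kernel therefore peaks at \<open>x\<close>, at angular
  scale \<open>M powr (- 1 / 2)\<close>.\<close>

definition zonal :: "nat \<Rightarrow> 'a::euclidean_space \<Rightarrow> 'a \<Rightarrow> real" where
  "zonal M x y = ((1 + y \<bullet> x) / 2) ^ M"

text \<open>The integral of \<open>zonal M x\<close> over the sphere of dimension \<open>d\<close>.\<close>

definition zonal_mass :: "nat \<Rightarrow> nat \<Rightarrow> real" where
  "zonal_mass d M = (\<Prod>j<M. (real j + real d / 2) / (real j + real d))"

text \<open>The eigenvalue of convolution with the normalised \<open>zonal M\<close> on the spherical harmonics of degree \<open>l\<close>.\<close>

definition multiplier :: "nat \<Rightarrow> nat \<Rightarrow> nat \<Rightarrow> real" where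
  "multiplier d M l = (\<Prod>j<l. (real M - real j) / (real M + real d + real j))"

lemma real_polynomial_function_zonal: "real_polynomial_function (zonal M x)"
  unfolding zonal_def[abs_def]
  by (intro real_polynomial_function_power real_polynomial_function_divide real_polynomial_function.intros(2,3)
      real_polynomial_function_inner_left)

lemma zonal_mass_pos: "d > 0 \<Longrightarrow> zonal_mass d M > 0"
  unfolding zonal_mass_def by (intro prod_pos) auto

lemma zonal_mass_Suc:
  "zonal_mass d (Suc M) = zonal_mass d M * ((real M + real d / 2) / (real M + real d))"
  by (simp add: zonal_mass_def)

lemma zonal_nonneg:
  assumes "norm x = 1" "norm y = 1"
  shows "zonal M x y \<ge> 0" "(1 + y \<bullet> x) / 2 \<le> 1" "(1 + y \<bullet> x) / 2 \<ge> 0"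
proof -
  have "\<bar>y \<bullet> x\<bar> \<le> 1" using Cauchy_Schwarz_ineq2[of y x] assms by simp
  then show "zonal M x y \<ge> 0" "(1 + y \<bullet> x) / 2 \<le> 1" "(1 + y \<bullet> x) / 2 \<ge> 0"
    by (auto simp: zonal_def)
qed

text \<open>With u = (1 + t) / 2 one has 1 - t^2 = 4 u (1 - u), so the Legendre-type operator of
  \<open>integral_sphere_zonal_harmonic\<close> sends u^(M+1) to a combination of u^(M+1) and
  u^M.\<close>

lemma zonal_moment_Suc:
  fixes h :: "'a::euclidean_space \<Rightarrow> real"
  assumes h: "harmonic_polynomial l h" and x: "norm x = 1" and d: "DIM('a) = d + 1"
  shows "((real M + 1) * (real M + real d) - eigval d l) * (\<integral>y. zonal (Suc M) x y * h y \<partial>sphere_measure)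
    = (real M + 1) * (real M + real d / 2) * (\<integral>y. zonal M x y * h y \<partial>sphere_measure)"
proof -
  define g where "g t = ((1 + t) / 2) ^ Suc M" for t :: real
  define g' where "g' t = (real M + 1) / 2 * ((1 + t) / 2) ^ M" for t :: real
  define g'' where "g'' t = (real M + 1) * real M / 4 * ((1 + t) / 2) ^ (M - 1)" for t :: real
  have id: "real_polynomial_function (\<lambda>t::real. t)"
    using real_polynomial_function.intros(1)[OF bounded_linear_ident] .
  have pol: "real_polynomial_function (\<lambda>t::real. ((1 + t) / 2) ^ n)" for n
    by (intro real_polynomial_function_power real_polynomial_function_divide real_polynomial_function.intros(2,3) id)
  have gp: "real_polynomial_function g" "real_polynomial_function g'" "real_polynomial_function g''"
    unfolding g_def g'_def g''_def by (intro pol real_polynomial_function.intros(4) real_polynomial_function.intros(2))+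
  have dg: "(g has_real_derivative g' t) (at t)" "(g' has_real_derivative g'' t) (at t)" for t
    unfolding g_def g'_def g''_def by (rule derivative_eq_intros refl | simp add: field_simps)+
  have hp: "real_polynomial_function h" using h by (simp add: harmonic_polynomial_def)
  have zp: "real_polynomial_function (\<lambda>y. G (y \<bullet> x))" if "real_polynomial_function G" for G
    using real_polynomial_function_compose[OF _ that, of "\<lambda>y. y \<bullet> x"] real_polynomial_function_inner_left[of x]
    by (simp add: o_def real_polynomial_function_eq)
  have "0 = (\<integral>y. (real d * (y \<bullet> x) * g' (y \<bullet> x) + (y \<bullet> x)\<^sup>2 * g'' (y \<bullet> x) - eigval d l * g (y \<bullet> x)) * h y \<partial>sphere_measure)
      - (\<integral>y. g'' (y \<bullet> x) * h y \<partial>sphere_measure)"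
    using integral_sphere_zonal_harmonic[OF h x gp dg] d by simp
  also have "\<dots> = (\<integral>y. (real d * (y \<bullet> x) * g' (y \<bullet> x) + (y \<bullet> x)\<^sup>2 * g'' (y \<bullet> x) - eigval d l * g (y \<bullet> x)) * h y
       - g'' (y \<bullet> x) * h y \<partial>sphere_measure)"
    by (intro Bochner_Integration.integral_diff[symmetric] integrable_sphere_polynomial
        real_polynomial_function.intros(2-4) real_polynomial_function_diff real_polynomial_function_power
        zp gp hp real_polynomial_function_inner_left)
  also have "\<dots> = (\<integral>y. ((real M + 1) * (real M + real d) - eigval d l) * (zonal (Suc M) x y * h y)
      - (real M + 1) * (real M + real d / 2) * (zonal M x y * h y) \<partial>sphere_measure)"
  proof (rule integral_sphere_cong)
    fix y :: 'a
    define u where "u = (1 + y \<bullet> x) / 2"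
    have t: "y \<bullet> x = 2 * u - 1" by (simp add: u_def field_simps)
    \<comment> \<open>Covers the truncated exponent \<open>M - 1\<close> in \<open>g''\<close>: for
      \<open>M = 0\<close> both sides vanish.\<close>
    have M: "real M * u ^ M = real M * (u ^ (M - 1) * u)" by (cases M) auto
    have 2: "(y \<bullet> x)\<^sup>2 * g'' (y \<bullet> x) - g'' (y \<bullet> x) = (real M + 1) * (real M * u ^ M) * (u - 1)"
      unfolding M unfolding g''_def u_def[symmetric] unfolding t by (simp add: field_simps power2_eq_square)
    have "real d * (y \<bullet> x) * g' (y \<bullet> x) + (y \<bullet> x)\<^sup>2 * g'' (y \<bullet> x) - eigval d l * g (y \<bullet> x) - g'' (y \<bullet> x)
        = ((real M + 1) * (real M + real d) - eigval d l) * u ^ Suc M - (real M + 1) * (real M + real d / 2) * u ^ M"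
    proof -
      have "real d * (y \<bullet> x) * g' (y \<bullet> x) + (y \<bullet> x)\<^sup>2 * g'' (y \<bullet> x) - eigval d l * g (y \<bullet> x) - g'' (y \<bullet> x)
          = real d * (y \<bullet> x) * g' (y \<bullet> x) - eigval d l * g (y \<bullet> x) + ((y \<bullet> x)\<^sup>2 * g'' (y \<bullet> x) - g'' (y \<bullet> x))"
        by simp
      also have "\<dots> = real d * (2 * u - 1) * ((real M + 1) / 2 * u ^ M) - eigval d l * u ^ Suc M
          + (real M + 1) * (real M * u ^ M) * (u - 1)"
        unfolding 2 unfolding g'_def g_def u_def[symmetric] unfolding t ..
      also have "\<dots> = ((real M + 1) * (real M + real d) - eigval d l) * u ^ Suc M - (real M + 1) * (real M + real d / 2) * u ^ M"
        by (simp add: field_simps)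
      finally show ?thesis .
    qed
    then have "(real d * (y \<bullet> x) * g' (y \<bullet> x) + (y \<bullet> x)\<^sup>2 * g'' (y \<bullet> x) - eigval d l * g (y \<bullet> x) - g'' (y \<bullet> x)) * h y
        = (((real M + 1) * (real M + real d) - eigval d l) * u ^ Suc M - (real M + 1) * (real M + real d / 2) * u ^ M) * h y"
      by simp
    then show "(real d * (y \<bullet> x) * g' (y \<bullet> x) + (y \<bullet> x)\<^sup>2 * g'' (y \<bullet> x) - eigval d l * g (y \<bullet> x)) * h y - g'' (y \<bullet> x) * h y
        = ((real M + 1) * (real M + real d) - eigval d l) * (zonal (Suc M) x y * h y)
           - (real M + 1) * (real M + real d / 2) * (zonal M x y * h y)"
      unfolding zonal_def u_def[symmetric] by (simp only: left_diff_distrib mult.assoc)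
  qed
  also have "\<dots> = ((real M + 1) * (real M + real d) - eigval d l) * (\<integral>y. zonal (Suc M) x y * h y \<partial>sphere_measure)
      - (real M + 1) * (real M + real d / 2) * (\<integral>y. zonal M x y * h y \<partial>sphere_measure)"
    by (subst Bochner_Integration.integral_diff)
      (auto intro!: integrable_sphere_polynomial real_polynomial_function.intros(4) real_polynomial_function_zonal hp)
  finally show ?thesis by simp
qed

text \<open>The start of the recurrence, from the constant profile g = 1.\<close>

lemma zonal_moment_0:
  fixes h :: "'a::euclidean_space \<Rightarrow> real"
  assumes h: "harmonic_polynomial l h" and x: "norm x = 1" and d: "DIM('a) = d + 1"
  shows "eigval d l * (\<integral>y. zonal 0 x y * h y \<partial>sphere_measure) = 0"
proof -
  have "(\<integral>y. 0 * h y \<partial>sphere_measure) = (\<integral>y. ((real DIM('a) - 1) * (y \<bullet> x) * 0 + (y \<bullet> x)\<^sup>2 * 0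
       - eigval (DIM('a) - 1) l * 1) * h y \<partial>sphere_measure)"
    by (rule integral_sphere_zonal_harmonic[OF h x]) auto
  then show ?thesis using d by (simp add: zonal_def)
qed

lemma harmonic_polynomial_const: "harmonic_polynomial 0 (\<lambda>x::'a::euclidean_space. c)"
proof -
  have "dir_deriv b (\<lambda>x. c) = (\<lambda>x. 0)" for b :: 'a by (intro ext) simp
  then show ?thesis
    by (auto simp: harmonic_polynomial_def homogeneous_def laplacian_eq_dir_deriv real_polynomial_function.intros(2))
qed

lemma integral_zonal:
  fixes x :: "'a::euclidean_space"
  assumes x: "norm x = 1" and d: "DIM('a) = d + 1" "d > 0"
  shows "(\<integral>y. zonal M x y \<partial>sphere_measure) = zonal_mass d M"
proof (induction M)
  case 0
  show ?case by (simp add: zonal_def zonal_mass_def)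
next
  case (Suc M)
  have "(real M + 1) * ((real M + real d) * (\<integral>y. zonal (Suc M) x y \<partial>sphere_measure))
      = (real M + 1) * ((real M + real d / 2) * (\<integral>y. zonal M x y \<partial>sphere_measure))"
    using zonal_moment_Suc[OF harmonic_polynomial_const[of 1] x d(1), of M] by (simp add: eigval_def mult.assoc)
  then have "(real M + real d) * (\<integral>y. zonal (Suc M) x y \<partial>sphere_measure)
      = (real M + real d / 2) * (\<integral>y. zonal M x y \<partial>sphere_measure)" by simp
  then show ?case using d by (simp add: Suc zonal_mass_def field_simps)
qed

text \<open>
  Korovkin's argument: \<open>1 - y \<bullet> x\<close> dominates \<open>\<bar>f y - f x\<bar>\<close> up to a small constant, and its mean
  with respect to the normalised kernel is \<open>d / (M + d)\<close>.
\<close>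

lemma zonal_approximate_identity:
  fixes f :: "'a::euclidean_space \<Rightarrow> real"
  assumes f: "continuous_on (sphere 0 1) f" and x: "norm x = 1" and d: "DIM('a) = d + 1" "d > 0"
  shows "(\<lambda>M. (\<integral>y. zonal M x y * f y \<partial>sphere_measure) / zonal_mass d M) \<longlonglongrightarrow> f x"
proof -
  have zc: "continuous_on S (zonal M x)" for S M
    by (intro real_polynomial_function_continuous_on real_polynomial_function_zonal)
  have dom: "\<exists>C\<ge>0. \<forall>y. norm y = 1 \<longrightarrow> \<bar>f y - f x\<bar> \<le> e + C * (1 - y \<bullet> x)" if e: "e > 0" for e
  proof -
    have "compact (f ` sphere 0 1)"
      using f by (intro compact_continuous_image) auto
    then obtain B where B: "\<And>x. x \<in> sphere 0 1 \<Longrightarrow> \<bar>f x\<bar> \<le> B"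
      by (metis compact_imp_bounded bounded_iff image_eqI real_norm_def)
    have B0: "B \<ge> 0" using B[of x] x by auto
    obtain \<delta> where \<delta>: "\<delta> > 0" "\<And>y. norm y = 1 \<Longrightarrow> dist y x < \<delta> \<Longrightarrow> \<bar>f y - f x\<bar> < e"
      using f[unfolded continuous_on_iff, rule_format, of x e] e x by (auto simp: dist_real_def)
    \<comment> \<open>Since \<open>(dist y x)\<^sup>2 = 2 * (1 - y \<bullet> x)\<close>, the last
      term is at least \<open>2 * B\<close> once \<open>dist y x\<close> reaches \<delta>, and
      \<open>2 * B\<close> bounds any difference of values of \<open>f\<close>.\<close>
    have "\<bar>f y - f x\<bar> \<le> e + 4 * B / \<delta>\<^sup>2 * (1 - y \<bullet> x)" if y: "norm y = 1" for y
    proof (cases "dist y x < \<delta>")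
      case True
      have "0 \<le> 4 * B / \<delta>\<^sup>2 * (1 - y \<bullet> x)"
        using B0 zonal_nonneg(2)[OF x y] by (intro mult_nonneg_nonneg) auto
      then show ?thesis using \<delta>(2)[OF y True] by linarith
    next
      case False
      then have "\<delta>\<^sup>2 \<le> (dist y x)\<^sup>2" using \<delta>(1) by (intro power_mono) auto
      also have "\<dots> = 2 * (1 - y \<bullet> x)"
      proof -
        have "x \<bullet> x = 1" "y \<bullet> y = 1" using x y by (simp_all add: dot_square_norm)
        then show ?thesis
          by (simp add: dist_norm power2_norm_eq_inner inner_diff_left inner_diff_right inner_commute[of x y])
      qed
      finally have "1 \<le> 2 / \<delta>\<^sup>2 * (1 - y \<bullet> x)" using \<delta>(1) by (simp add: field_simps)
      then have "2 * B * 1 \<le> 2 * B * (2 / \<delta>\<^sup>2 * (1 - y \<bullet> x))" using B0 by (intro mult_left_mono) auto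
      moreover have "\<bar>f y - f x\<bar> \<le> 2 * B" using B[of x] B[of y] x y by auto
      moreover have "2 * B * (2 / \<delta>\<^sup>2 * (1 - y \<bullet> x)) = 4 * B / \<delta>\<^sup>2 * (1 - y \<bullet> x)" by simp
      ultimately show ?thesis using e by linarith
    qed
    then show ?thesis using B0 by (intro exI[of _ "4 * B / \<delta>\<^sup>2"]) auto
  qed
  have bound: "\<bar>(\<integral>y. zonal M x y * f y \<partial>sphere_measure) / zonal_mass d M - f x\<bar> \<le> e + C * (real d / (real M + real d))"
    if C: "C \<ge> 0" "\<And>y. norm y = 1 \<Longrightarrow> \<bar>f y - f x\<bar> \<le> e + C * (1 - y \<bullet> x)" for e C M
  proof -
    let ?m = "zonal_mass d M"
    have m: "?m > 0" using zonal_mass_pos d by auto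
    have int: "integrable sphere_measure (\<lambda>y. zonal M x y * f y)" "integrable sphere_measure (\<lambda>y. zonal M x y * f x)"
      by (intro integrable_sphere_continuous continuous_intros zc f)+
    have int2: "integrable sphere_measure (zonal M' x)" for M'
      by (intro integrable_sphere_continuous zc)
    have "(\<integral>y. zonal M x y * f y \<partial>sphere_measure) - ?m * f x = (\<integral>y. zonal M x y * f y - zonal M x y * f x \<partial>sphere_measure)"
      using int by (simp add: integral_zonal[OF x d])
    then have "\<bar>(\<integral>y. zonal M x y * f y \<partial>sphere_measure) - ?m * f x\<bar>
        \<le> (\<integral>y. \<bar>zonal M x y * f y - zonal M x y * f x\<bar> \<partial>sphere_measure)"
      using integral_norm_bound[of sphere_measure "\<lambda>y. zonal M x y * f y - zonal M x y * f x"] by simp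
    \<comment> \<open>As \<open>1 - y \<bullet> x\<close> is twice one minus the base of the kernel,
      the majorant is a combination of two consecutive kernels, whose integrals are known.\<close>
    also have "\<dots> \<le> (\<integral>y. (e + 2 * C) * zonal M x y - 2 * C * zonal (Suc M) x y \<partial>sphere_measure)"
    proof (rule integral_mono)
      show "integrable sphere_measure (\<lambda>y. \<bar>zonal M x y * f y - zonal M x y * f x\<bar>)"
        using int by auto
      show "integrable sphere_measure (\<lambda>y. (e + 2 * C) * zonal M x y - 2 * C * zonal (Suc M) x y)"
        using int2 by auto
      fix y :: 'a assume "y \<in> space sphere_measure"
      then have y: "norm y = 1" by simp
      have "\<bar>zonal M x y * f y - zonal M x y * f x\<bar> = zonal M x y * \<bar>f y - f x\<bar>"
        using zonal_nonneg(1)[OF x y] by (simp add: abs_mult flip: right_diff_distrib)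
      also have "\<dots> \<le> zonal M x y * (e + C * (1 - y \<bullet> x))"
        using C(2)[OF y] zonal_nonneg(1)[OF x y] by (intro mult_left_mono) auto
      also have "\<dots> = (e + 2 * C) * zonal M x y - 2 * C * zonal (Suc M) x y"
        by (simp add: zonal_def field_simps)
      finally show "\<bar>zonal M x y * f y - zonal M x y * f x\<bar> \<le> (e + 2 * C) * zonal M x y - 2 * C * zonal (Suc M) x y" .
    qed
    also have "\<dots> = (e + 2 * C) * ?m - 2 * C * zonal_mass d (Suc M)"
      using int2 by (subst Bochner_Integration.integral_diff) (auto simp: integral_zonal[OF x d])
    also have "\<dots> = (e + C * (real d / (real M + real d))) * ?m"
    proof -
      define q where "q = real d / (real M + real d)"
      have "(real M + real d / 2) / (real M + real d) = 1 - q / 2"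
        using d(2) by (simp add: q_def field_simps)
      then show ?thesis unfolding zonal_mass_Suc q_def[symmetric] by (simp only:) (simp add: algebra_simps)
    qed
    finally have "\<bar>(\<integral>y. zonal M x y * f y \<partial>sphere_measure) - ?m * f x\<bar> / ?m \<le> (e + C * (real d / (real M + real d)))"
      by (simp only: pos_divide_le_eq[OF m])
    also have "\<bar>(\<integral>y. zonal M x y * f y \<partial>sphere_measure) - ?m * f x\<bar> / ?m =
      \<bar>(\<integral>y. zonal M x y * f y \<partial>sphere_measure) / ?m - f x\<bar>"
      unfolding abs_div_pos[OF m] using m by (simp add: diff_divide_distrib)
    finally show ?thesis .
  qed
  show ?thesis
  proof (rule LIMSEQ_I)
    fix r :: real assume r: "r > 0"
    obtain C where C: "C \<ge> 0" "\<And>y. norm y = 1 \<Longrightarrow> \<bar>f y - f x\<bar> \<le> r / 2 + C * (1 - y \<bullet> x)"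
      using dom[OF half_gt_zero[OF r]] by blast
    have "(\<lambda>M. C * (real d / (real M + real d))) \<longlonglongrightarrow> 0" by real_asymp
    from LIMSEQ_D[OF this half_gt_zero[OF r]] obtain n0
      where n0: "\<forall>n\<ge>n0. norm (C * (real d / (real n + real d)) - 0) < r / 2" by blast
    show "\<exists>no. \<forall>n\<ge>no. norm ((\<integral>y. zonal n x y * f y \<partial>sphere_measure) / zonal_mass d n - f x) < r"
    proof (intro exI allI impI)
      fix n assume "n \<ge> n0"
      then show "norm ((\<integral>y. zonal n x y * f y \<partial>sphere_measure) / zonal_mass d n - f x) < r"
        using bound[OF C, of n] n0[rule_format, of n] unfolding real_norm_def by linarith
    qed
  qed
qed

section \<open>Recurrences, bounds and limit of the multipliers\<close>

lemma multiplier_Suc_right: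
  "multiplier d M (Suc l) = multiplier d M l * ((real M - real l) / (real M + real d + real l))"
  by (simp add: multiplier_def)

text \<open>The quotient of the recurrences for the moments and for the mass. It stays multiplied
  out because \<open>M + 1 - l\<close> vanishes at \<open>l = M + 1\<close>.\<close>

lemma multiplier_Suc_left:
  assumes "d > 0"
  shows "multiplier d (Suc M) l * ((real M + 1 - real l) * (real M + real d + real l))
    = multiplier d M l * ((real M + 1) * (real M + real d))"
proof (induction l)
  case 0
  show ?case by (simp add: multiplier_def)
next
  case (Suc l)
  define m m' a b p q where "m = multiplier d M l" and "m' = multiplier d (Suc M) l"
    and "a = real M + real d + real l" and "b = real M + 1 + real d + real l"
    and "p = real M + 1 - real l" and "q = real M - real l"
  have nz: "a \<noteq> 0" "b \<noteq> 0" using assms by (auto simp: a_def b_def)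
  have IH: "m' * (p * a) = m * ((real M + 1) * (real M + real d))"
    using Suc by (simp add: m_def m'_def p_def a_def)
  have "multiplier d (Suc M) (Suc l) * (q * b) = m' * (p / b) * (q * b)"
    by (simp add: multiplier_Suc_right m'_def p_def b_def add_ac)
  also have "\<dots> = m' * (p * a) * (q / a)" using nz by simp
  also have "\<dots> = multiplier d M (Suc l) * ((real M + 1) * (real M + real d))"
    unfolding IH by (simp add: multiplier_Suc_right m_def q_def a_def)
  finally show ?case by (simp add: q_def b_def algebra_simps)
qed

lemma multiplier_eq_0: "M < l \<Longrightarrow> multiplier d M l = 0"
  unfolding multiplier_def by (rule prod_zero) auto

lemma multiplier_pos: "d > 0 \<Longrightarrow> l \<le> M \<Longrightarrow> multiplier d M l > 0"
  unfolding multiplier_def by (intro prod_pos) auto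

lemma multiplier_nonneg: "d > 0 \<Longrightarrow> multiplier d M l \<ge> 0"
  using multiplier_eq_0 multiplier_pos by (metis less_eq_real_def not_le)

lemma multiplier_le_1: "d > 0 \<Longrightarrow> multiplier d M l \<le> 1"
proof (cases "M < l")
  case False
  assume "d > 0"
  with False show ?thesis
    unfolding multiplier_def by (intro prod_le_1) (auto simp: divide_le_eq)
qed (simp add: multiplier_eq_0)

lemma multiplier_tendsto: "(\<lambda>M. multiplier d M l) \<longlonglongrightarrow> 1"
proof -
  have "(\<lambda>M. multiplier d M l) \<longlonglongrightarrow> (\<Prod>j<l. 1)"
    unfolding multiplier_def
  proof (rule tendsto_prod)
    fix j
    show "(\<lambda>M. (real M - real j) / (real M + real d + real j)) \<longlonglongrightarrow> 1" by real_asymp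
  qed
  then show ?thesis by simp
qed

lemma eigval_diff_factor:
  "(real M + 1) * (real M + real d) - eigval d l = (real M + 1 - real l) * (real M + real d + real l)"
  by (simp add: eigval_def algebra_simps)

text \<open>From \<open>M = l\<close> on, the moments and the product of mass and multiplier obey
  the same recurrence, so their ratio is constant. Its value is read off as \<open>M\<close> tends
  to infinity: the normalised kernels reproduce \<open>h x\<close> and the multipliers tend to
  1.\<close>

theorem Funk_Hecke_zonal:
  fixes h :: "'a::euclidean_space \<Rightarrow> real"
  assumes h: "harmonic_polynomial l h" and x: "norm x = 1" and d: "DIM('a) = d + 1" "d > 0"
  shows "(\<integral>y. zonal M x y * h y \<partial>sphere_measure) = zonal_mass d M * multiplier d M l * h x"
proof -
  define T where "T M = (\<integral>y. zonal M x y * h y \<partial>sphere_measure)" for M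
  have T0: "eigval d l * T 0 = 0"
    unfolding T_def by (rule zonal_moment_0[OF h x d(1)])
  have TS: "((real M + 1 - real l) * (real M + real d + real l)) * T (Suc M) = (real M + 1) * (real M + real d / 2) * T M" for M
    unfolding T_def eigval_diff_factor[symmetric] by (rule zonal_moment_Suc[OF h x d(1)])
  \<comment> \<open>The recurrence passes the zero on only up to \<open>M = l - 1\<close>. In the
    step to \<open>M = l\<close> its leading factor vanishes, so that \<open>T l\<close> remains
    free and has to be found from the limit.\<close>
  have low: "M < l \<Longrightarrow> T M = 0" for M
  proof (induction M)
    case 0
    then have "eigval d l \<noteq> 0" using d(2) by (auto simp: eigval_def)
    then show ?case using T0 by simp
  next
    case (Suc M)
    then have "(real M + 1 - real l) * (real M + real d + real l) \<noteq> 0" using d(2) by auto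
    then show ?case using TS[of M] Suc by simp
  qed
  define r where "r M = T M / (zonal_mass d M * multiplier d M l)" for M
  have rS: "r (Suc M) = r M" if "l \<le> M" for M
  proof -
    define A where "A = (real M + 1 - real l) * (real M + real d + real l)"
    have A: "A > 0" unfolding A_def using that d(2) by (intro mult_pos_pos) auto
    have B: "(real M + 1) * (real M + real d) > 0" "(real M + 1) * (real M + real d / 2) > 0" using d(2) by auto
    have "T (Suc M) = (real M + 1) * (real M + real d / 2) * T M / A"
      using TS[of M] A unfolding A_def[symmetric] by (simp add: field_simps)
    moreover have "multiplier d (Suc M) l = multiplier d M l * ((real M + 1) * (real M + real d)) / A"
      using multiplier_Suc_left[OF d(2), of M l] A unfolding A_def[symmetric] by (simp add: field_simps)
    moreover note zonal_mass_Suc[of d M]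
    ultimately have "r (Suc M) = ((real M + 1) * (real M + real d / 2) * T M / A) /
        (zonal_mass d M * ((real M + real d / 2) / (real M + real d)) * (multiplier d M l * ((real M + 1) * (real M + real d)) / A))"
      by (simp add: r_def)
    also have "\<dots> = r M"
      using A d(2) zonal_mass_pos[OF d(2), of M] multiplier_pos[OF d(2) that]
      unfolding r_def by (simp add: divide_simps)
    finally show ?thesis .
  qed
  have const: "l \<le> M \<Longrightarrow> r M = r l" for M
    by (induction M rule: dec_induct) (auto simp: rS)
  have "continuous_on (sphere 0 1) h"
    using h by (auto simp: harmonic_polynomial_def intro: real_polynomial_function_continuous_on)
  then have "(\<lambda>M. T M / zonal_mass d M / multiplier d M l) \<longlonglongrightarrow> h x / 1"
    unfolding T_def by (intro tendsto_divide zonal_approximate_identity multiplier_tendsto x d) auto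
  then have "r \<longlonglongrightarrow> h x" by (simp add: r_def[abs_def] field_simps)
  moreover have "r \<longlonglongrightarrow> r l"
    by (rule tendsto_eventually) (use const in \<open>unfold eventually_sequentially, blast\<close>)
  ultimately have rl: "r l = h x" using LIMSEQ_unique by blast
  show ?thesis
  proof (cases "M < l")
    case True
    then show ?thesis using low[OF True] by (simp add: T_def multiplier_eq_0)
  next
    case False
    then have "T M / (zonal_mass d M * multiplier d M l) = h x" using const[of M] rl by (simp add: r_def)
    then show ?thesis
      using zonal_mass_pos[OF d(2), of M] multiplier_pos[OF d(2), of l M] False
      by (simp add: T_def field_simps)
  qed
qed

section \<open>Decomposition of the kernels into harmonics\<close>

lemma harmonic_polynomial_cmult:
  "harmonic_polynomial l h \<Longrightarrow> harmonic_polynomial l (\<lambda>x. c * h x)"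
  by (auto simp: harmonic_polynomial_def homogeneous_def laplacian_cmult intro!: real_polynomial_function.intros(2,4))

lemma harmonic_polynomial_add:
  "harmonic_polynomial l g \<Longrightarrow> harmonic_polynomial l h \<Longrightarrow> harmonic_polynomial l (\<lambda>x. g x + h x)"
  by (auto simp: harmonic_polynomial_def homogeneous_def laplacian_add algebra_simps intro!: real_polynomial_function.intros(3))

lemma homogeneous_norm_sq_power_mult:
  "homogeneous m h \<Longrightarrow> homogeneous (2 * i + m) (\<lambda>y. (y \<bullet> y) ^ i * h y)"
  by (simp add: homogeneous_def power_add power_mult power_mult_distrib mult_ac power2_eq_square)

text \<open>Each further factor \<open>y \<bullet> y\<close> adds a positive amount to the constant.
  Positivity allows dividing by it, which inverts the Laplacian on such terms.\<close>

lemma laplacian_norm_sq_power_mult: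
  fixes h :: "'a::euclidean_space \<Rightarrow> real"
  assumes h: "harmonic_polynomial m h"
  shows "\<exists>c>0. \<forall>y. laplacian (\<lambda>y. (y \<bullet> y) ^ Suc i * h y) y = c * ((y \<bullet> y) ^ i * h y)"
proof (induction i)
  case 0
  have "laplacian (\<lambda>y. (y \<bullet> y) * h y) y = (4 * real m + 2 * real DIM('a)) * h y" for y
    using h by (subst laplacian_norm_sq_mult[of h m]) (auto simp: harmonic_polynomial_def)
  moreover have "4 * real m + 2 * real DIM('a) > 0" by (simp add: add_nonneg_pos)
  ultimately show ?case by (intro exI[of _ "4 * real m + 2 * real DIM('a)"]) simp
next
  case (Suc i)
  then obtain c where c: "c > 0" "\<And>y. laplacian (\<lambda>y. (y \<bullet> y) ^ Suc i * h y) y = c * ((y \<bullet> y) ^ i * h y)"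
    by blast
  have hp: "real_polynomial_function h" "homogeneous m h" using h by (auto simp: harmonic_polynomial_def)
  define n where "n = 2 * Suc i + m"
  have poly: "real_polynomial_function (\<lambda>y. (y \<bullet> y) ^ Suc i * h y)"
    by (intro real_polynomial_function.intros(4) real_polynomial_function_power real_polynomial_function_inner_self hp)
  have "laplacian (\<lambda>y. (y \<bullet> y) * ((y \<bullet> y) ^ Suc i * h y)) y
     = (c + (4 * real n + 2 * real DIM('a))) * ((y \<bullet> y) ^ Suc i * h y)" for y
    unfolding laplacian_norm_sq_mult[OF poly homogeneous_norm_sq_power_mult[OF hp(2)]] c(2) n_def
    by (simp add: algebra_simps)
  moreover have "c + (4 * real n + 2 * real DIM('a)) > 0" using c(1) by (simp add: add_pos_nonneg)
  ultimately show ?case by (intro exI[of _ "c + (4 * real n + 2 * real DIM('a))"]) (simp add: mult.assoc)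
qed

lemma dir_deriv_power_inner:
  "dir_deriv v (\<lambda>y. (y \<bullet> x) ^ Suc k) y = (real k + 1) * (v \<bullet> x) * (y \<bullet> x) ^ k"
proof (induction k)
  case (Suc k)
  have "dir_deriv v (\<lambda>y. (y \<bullet> x) * (y \<bullet> x) ^ Suc k) y
      = (y \<bullet> x) * dir_deriv v (\<lambda>y. (y \<bullet> x) ^ Suc k) y + dir_deriv v (\<lambda>y. y \<bullet> x) y * (y \<bullet> x) ^ Suc k"
    by (intro dir_deriv_mult real_polynomial_function_power real_polynomial_function_inner_left)
  then show ?case
    unfolding power_Suc[of _ "Suc k"] Suc by (simp add: algebra_simps)
qed simp

lemma laplacian_power_inner:
  fixes x :: "'a::euclidean_space"
  assumes x: "norm x = 1"
  shows "laplacian (\<lambda>y. (y \<bullet> x) ^ Suc (Suc k)) y = (real k + 2) * (real k + 1) * (y \<bullet> x) ^ k"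
proof -
  have p: "real_polynomial_function (\<lambda>y. (y \<bullet> x) ^ n)" for n
    by (intro real_polynomial_function_power real_polynomial_function_inner_left)
  have 1: "dir_deriv b (\<lambda>y. (y \<bullet> x) ^ Suc (Suc k)) = (\<lambda>y. ((real k + 2) * (b \<bullet> x)) * (y \<bullet> x) ^ Suc k)" for b
    by (intro ext, subst dir_deriv_power_inner) simp
  have 2: "dir_deriv b (dir_deriv b (\<lambda>y. (y \<bullet> x) ^ Suc (Suc k))) y
      = (real k + 2) * (real k + 1) * (y \<bullet> x) ^ k * ((x \<bullet> b) * (x \<bullet> b))" for b
    unfolding 1 dir_deriv_cmult[OF p] dir_deriv_power_inner by (simp add: inner_commute[of b x])
  have "(\<Sum>b\<in>Basis. (x \<bullet> b) * (x \<bullet> b)) = 1"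
    using x by (simp add: dot_square_norm flip: euclidean_inner)
  then show ?thesis
    unfolding laplacian_eq_dir_deriv[OF p] 2 by (simp flip: sum_distrib_left)
qed

text \<open>
  The harmonic part in degree \<open>k + 2\<close> is obtained by subtracting from \<open>(y \<bullet> x) ^ (k + 2)\<close> a solution
  \<open>q\<close> of \<open>\<Delta> q = \<Delta> ((y \<bullet> x) ^ (k + 2))\<close>, which is written down from the decomposition in degree \<open>k\<close>.
\<close>

lemma power_inner_harmonic_decomposition:
  fixes x :: "'a::euclidean_space"
  assumes x: "norm x = 1"
  shows "\<exists>h. (\<forall>i\<le>k div 2. harmonic_polynomial (k - 2 * i) (h i)) \<and>
    (\<forall>y. (y \<bullet> x) ^ k = (\<Sum>i\<le>k div 2. (y \<bullet> y) ^ i * h i y))"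
proof (induction k rule: nat_induct2)
  case 0
  show ?case by (intro exI[of _ "\<lambda>_ _. 1"]) (simp add: harmonic_polynomial_const)
next
  case 1
  have "dir_deriv b (\<lambda>y. y \<bullet> x) = (\<lambda>y. b \<bullet> x)" for b by (intro ext) simp
  then have "harmonic_polynomial 1 (\<lambda>y. y \<bullet> x)"
    using real_polynomial_function_inner_left[of x]
    by (simp add: harmonic_polynomial_def homogeneous_def laplacian_eq_dir_deriv)
  then show ?case by (intro exI[of _ "\<lambda>_ y. y \<bullet> x"]) simp
next
  case (step k)
  then obtain h where h: "\<And>i. i \<le> k div 2 \<Longrightarrow> harmonic_polynomial (k - 2 * i) (h i)"
    and eq: "\<And>y. (y \<bullet> x) ^ k = (\<Sum>i\<le>k div 2. (y \<bullet> y) ^ i * h i y)" by blast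
  have "\<forall>i. \<exists>c. i \<le> k div 2 \<longrightarrow> c > 0 \<and>
      (\<forall>y. laplacian (\<lambda>y. (y \<bullet> y) ^ Suc i * h i y) y = c * ((y \<bullet> y) ^ i * h i y))"
    using laplacian_norm_sq_power_mult[OF h] by blast
  from choice[OF this] obtain c where c: "\<And>i. i \<le> k div 2 \<Longrightarrow> c i > 0"
    "\<And>i y. i \<le> k div 2 \<Longrightarrow> laplacian (\<lambda>y. (y \<bullet> y) ^ Suc i * h i y) y = c i * ((y \<bullet> y) ^ i * h i y)"
    by blast
  define K where "K = (real k + 2) * (real k + 1)"
  \<comment> \<open>Each term of the decomposition in degree \<open>k\<close> gets one more factor
    \<open>y \<bullet> y\<close> and is divided by the constant that the Laplacian then produces;
    \<open>K\<close> is the factor from \<open>laplacian_power_inner\<close>.\<close>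
  define q where "q y = (\<Sum>i\<le>k div 2. (K / c i) * ((y \<bullet> y) ^ Suc i * h i y))" for y
  have tp: "real_polynomial_function (\<lambda>y. (y \<bullet> y) ^ Suc i * h i y)" if "i \<le> k div 2" for i
    using h[OF that]
    by (intro real_polynomial_function.intros(4) real_polynomial_function_power real_polynomial_function_inner_self)
       (auto simp: harmonic_polynomial_def)
  have tp': "real_polynomial_function (\<lambda>y. (K / c i) * ((y \<bullet> y) ^ Suc i * h i y))" if "i \<le> k div 2" for i
    by (rule real_polynomial_function.intros(4)[OF real_polynomial_function.intros(2) tp[OF that]])
  have qp: "real_polynomial_function q"
    unfolding q_def using tp' by (intro real_polynomial_function_sum) auto
  have ql: "laplacian q y = K * (y \<bullet> x) ^ k" for y
  proof -
    have "laplacian q y = (\<Sum>i\<le>k div 2. laplacian (\<lambda>y. (K / c i) * ((y \<bullet> y) ^ Suc i * h i y)) y)"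
      unfolding q_def[abs_def] using tp' by (intro laplacian_sum) auto
    also have "\<dots> = (\<Sum>i\<le>k div 2. K * ((y \<bullet> y) ^ i * h i y))"
    proof (rule sum.cong)
      fix i assume "i \<in> {..k div 2}"
      then have i: "i \<le> k div 2" by simp
      have "laplacian (\<lambda>y. (K / c i) * ((y \<bullet> y) ^ Suc i * h i y)) y = K / c i * (c i * ((y \<bullet> y) ^ i * h i y))"
        unfolding laplacian_cmult[OF tp[OF i]] c(2)[OF i] ..
      then show "laplacian (\<lambda>y. (K / c i) * ((y \<bullet> y) ^ Suc i * h i y)) y = K * ((y \<bullet> y) ^ i * h i y)"
        using c(1)[OF i] by simp
    qed simp
    finally show ?thesis unfolding eq by (simp add: sum_distrib_left)
  qed
  have qh: "homogeneous (k + 2) q"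
    unfolding homogeneous_def
  proof (intro allI)
    fix s :: real and y
    show "q (s *\<^sub>R y) = s ^ (k + 2) * q y"
      unfolding q_def sum_distrib_left
    proof (rule sum.cong)
      fix i assume "i \<in> {..k div 2}"
      then have i: "i \<le> k div 2" by simp
      have "homogeneous (2 * Suc i + (k - 2 * i)) (\<lambda>y. (y \<bullet> y) ^ Suc i * h i y)"
        using h[OF i] by (intro homogeneous_norm_sq_power_mult) (simp add: harmonic_polynomial_def)
      moreover have "2 * Suc i + (k - 2 * i) = k + 2" using i by presburger
      ultimately have "(s *\<^sub>R y \<bullet> s *\<^sub>R y) ^ Suc i * h i (s *\<^sub>R y) = s ^ (k + 2) * ((y \<bullet> y) ^ Suc i * h i y)"
        unfolding homogeneous_def by metis
      then show "K / c i * ((s *\<^sub>R y \<bullet> s *\<^sub>R y) ^ Suc i * h i (s *\<^sub>R y)) = s ^ (k + 2) * (K / c i * ((y \<bullet> y) ^ Suc i * h i y))"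
        by (simp only: mult_ac)
    qed simp
  qed
  define p where "p y = (y \<bullet> x) ^ Suc (Suc k) + (- 1) * q y" for y
  have zp: "real_polynomial_function (\<lambda>y. (y \<bullet> x) ^ Suc (Suc k))"
    by (intro real_polynomial_function_power real_polynomial_function_inner_left)
  have mq: "real_polynomial_function (\<lambda>y. (- 1) * q y)"
    by (intro real_polynomial_function.intros(4) real_polynomial_function.intros(2) qp)
  have pharm: "harmonic_polynomial (k + 2) p"
    unfolding harmonic_polynomial_def
  proof (intro conjI allI)
    show "real_polynomial_function p"
      unfolding p_def[abs_def] by (intro real_polynomial_function.intros(3) zp mq)
    show "homogeneous (k + 2) p"
      using qh by (simp add: homogeneous_def p_def power_mult_distrib algebra_simps)
    show "laplacian p y = 0" for y
      unfolding p_def[abs_def] laplacian_add[OF zp mq] laplacian_cmult[OF qp] ql laplacian_power_inner[OF x] K_def by simp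
  qed
  \<comment> \<open>The old components move up one place, since \<open>q\<close> carries one more
    factor \<open>y \<bullet> y\<close>; the new harmonic part \<open>p\<close> takes place
    0.\<close>
  define h' where "h' i = (case i of 0 \<Rightarrow> p | Suc j \<Rightarrow> (\<lambda>y. K / c j * h j y))" for i
  have "harmonic_polynomial (k + 2 - 2 * i) (h' i)" if "i \<le> (k + 2) div 2" for i
  proof (cases i)
    case 0
    then show ?thesis using pharm by (simp add: h'_def)
  next
    case (Suc j)
    then have "harmonic_polynomial (k - 2 * j) (\<lambda>y. K / c j * h j y)"
      using that by (intro harmonic_polynomial_cmult h) simp
    then show ?thesis using Suc by (simp add: h'_def)
  qed
  moreover have "(y \<bullet> x) ^ (k + 2) = (\<Sum>i\<le>(k + 2) div 2. (y \<bullet> y) ^ i * h' i y)" for y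
  proof -
    have "(\<Sum>i\<le>(k + 2) div 2. (y \<bullet> y) ^ i * h' i y) = p y + (\<Sum>i\<le>k div 2. (y \<bullet> y) ^ Suc i * (K / c i * h i y))"
    proof -
      have "(k + 2) div 2 = Suc (k div 2)" by simp
      then show ?thesis by (simp only: sum.atMost_Suc_shift) (simp add: h'_def)
    qed
    also have "\<dots> = p y + q y"
      unfolding q_def by (simp only: mult_ac)
    finally show ?thesis by (simp add: p_def)
  qed
  ultimately show ?case by blast
qed

text \<open>Expand the kernel binomially in powers of \<open>y \<bullet> x\<close>; on the sphere
  the factors \<open>y \<bullet> y\<close> become 1. The decomposable functions \<open>H\<close>
  form a vector space, so the components need not be tracked.\<close>

lemma zonal_harmonic_decomposition:
  fixes x :: "'a::euclidean_space"
  assumes x: "norm x = 1"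
  obtains h where "\<And>l. harmonic_polynomial l (h l)"
    "\<And>y. norm y = 1 \<Longrightarrow> zonal M x y = (\<Sum>l\<le>M. h l y)"
proof -
  define H where "H f \<longleftrightarrow> (\<exists>h. (\<forall>l. harmonic_polynomial l (h l)) \<and> (\<forall>y. norm y = 1 \<longrightarrow> f y = (\<Sum>l\<le>M. h l y)))"
    for f :: "'a \<Rightarrow> real"
  have zero: "harmonic_polynomial l (\<lambda>y::'a. 0)" for l
    using harmonic_polynomial_const[of 0] by (simp add: harmonic_polynomial_def homogeneous_def)
  have Hadd: "H (\<lambda>y. f y + g y)" if "H f" "H g" for f g
  proof -
    obtain h where "\<And>l. harmonic_polynomial l (h l)" "\<And>y. norm y = 1 \<Longrightarrow> f y = (\<Sum>l\<le>M. h l y)"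
      using \<open>H f\<close> unfolding H_def by blast
    moreover obtain h' where "\<And>l. harmonic_polynomial l (h' l)" "\<And>y. norm y = 1 \<Longrightarrow> g y = (\<Sum>l\<le>M. h' l y)"
      using \<open>H g\<close> unfolding H_def by blast
    ultimately show ?thesis unfolding H_def
      by (intro exI[of _ "\<lambda>l y. h l y + h' l y"]) (simp add: harmonic_polynomial_add sum.distrib)
  qed
  have Hscale: "H (\<lambda>y. c * f y)" if "H f" for f c
  proof -
    obtain h where "\<And>l. harmonic_polynomial l (h l)" "\<And>y. norm y = 1 \<Longrightarrow> f y = (\<Sum>l\<le>M. h l y)"
      using \<open>H f\<close> unfolding H_def by blast
    then show ?thesis unfolding H_def
      by (intro exI[of _ "\<lambda>l y. c * h l y"]) (simp add: harmonic_polynomial_cmult sum_distrib_left)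
  qed
  have H0: "H (\<lambda>y. 0)"
    unfolding H_def by (intro exI[of _ "\<lambda>_ _. 0"]) (simp add: zero)
  have Hsum: "H (\<lambda>y. \<Sum>i\<in>I. f i y)" if "finite I" "\<And>i. i \<in> I \<Longrightarrow> H (f i)" for I :: "nat set" and f
    using that by (induction I rule: finite_induct) (auto simp: H0 Hadd)
  have Hharm: "H g" if "harmonic_polynomial l g" "l \<le> M" for g l
  proof -
    have "(\<Sum>l'\<le>M. (if l' = l then g else (\<lambda>y. 0)) y) = g y" for y
      using that(2) by (simp add: if_distribR)
    then show ?thesis unfolding H_def
      using that(1) zero by (intro exI[of _ "\<lambda>l'. if l' = l then g else (\<lambda>y. 0)"]) auto
  qed
  have Hcong: "H g" if "H f" "\<And>y. norm y = 1 \<Longrightarrow> f y = g y" for f g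
    using that unfolding H_def by metis
  have Hpow: "H (\<lambda>y. (y \<bullet> x) ^ k)" if k: "k \<le> M" for k
  proof -
    obtain h where h: "\<And>i. i \<le> k div 2 \<Longrightarrow> harmonic_polynomial (k - 2 * i) (h i)"
      and eq: "\<And>y. (y \<bullet> x) ^ k = (\<Sum>i\<le>k div 2. (y \<bullet> y) ^ i * h i y)"
      using power_inner_harmonic_decomposition[OF x, of k] by blast
    have "H (\<lambda>y. \<Sum>i\<le>k div 2. h i y)"
    proof (rule Hsum)
      fix i assume "i \<in> {..k div 2}"
      then show "H (h i)" using h[of i] k by (intro Hharm[of "k - 2 * i"]) auto
    qed simp
    then show ?thesis
      by (rule Hcong) (simp add: eq dot_square_norm)
  qed
  have "H (zonal M x)"
  proof (rule Hcong)
    show "H (\<lambda>y. \<Sum>k\<le>M. (real (M choose k) / 2 ^ M) * (y \<bullet> x) ^ k)"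
      by (intro Hsum Hscale Hpow) auto
    show "(\<Sum>k\<le>M. (real (M choose k) / 2 ^ M) * (y \<bullet> x) ^ k) = zonal M x y" for y
      using binomial_ring[of "y \<bullet> x" 1 M]
      by (simp add: zonal_def power_divide add.commute sum_divide_distrib)
  qed
  then show ?thesis using that unfolding H_def by blast
qed

section \<open>Worst-case errors in terms of the basis\<close>

text \<open>The index set is a parameter fixed by an equation, so that sums over it are unfolded
  only on demand.\<close>

locale harmonic_basis =
  fixes Y :: "nat \<Rightarrow> nat \<Rightarrow> 'a::euclidean_space \<Rightarrow> real" and d :: nat
    and indices :: "nat \<Rightarrow> nat set"
  assumes DIM: "DIM('a) = d + 1" and d2: "d \<ge> 2" and onb: "harmonic_onb Y"
    and indices: "indices l = {1..harmonic_dim TYPE('a) l}"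
begin

lemma d_pos: "d > 0" using d2 by simp

lemma finite_indices [simp]: "finite (indices l)"
  by (simp add: indices)

lemma span_basis: "real_fun.span (Y l ` indices l) = spherical_harmonics l"
  using onb unfolding harmonic_onb_def indices by blast

lemma weighted_energy_eq: "weighted_energy Y w f l = w l * (\<Sum>k\<in>indices l. (fourier_coeff Y f l k)\<^sup>2)"
  by (simp add: weighted_energy_def indices)

lemma basis_harmonic_polynomial:
  assumes "k \<in> indices l"
  obtains p where "harmonic_polynomial l p" "\<And>x. norm x = 1 \<Longrightarrow> Y l k x = p x"
proof -
  have "Y l k \<in> spherical_harmonics l"
    using span_basis assms real_fun.span_base[of "Y l k" "Y l ` indices l"] by blast
  then show ?thesis using that
    unfolding spherical_harmonics_def harmonic_polynomial_def homogeneous_def by auto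
qed

lemma continuous_on_basis:
  assumes "k \<in> indices l"
  shows "continuous_on (sphere 0 1) (Y l k)"
proof -
  obtain p where p: "harmonic_polynomial l p" "\<And>x. norm x = 1 \<Longrightarrow> Y l k x = p x"
    using basis_harmonic_polynomial[OF assms] by blast
  then have "continuous_on (sphere 0 1) p"
    by (auto simp: harmonic_polynomial_def intro: real_polynomial_function_continuous_on)
  then show ?thesis by (rule continuous_on_eq) (use p in auto)
qed

lemma integral_basis_mult_harmonic:
  assumes k: "k \<in> indices l" and h: "harmonic_polynomial m h" and "l \<noteq> m"
  shows "(\<integral>y. h y * Y l k y \<partial>sphere_measure) = 0"
proof -
  obtain p where p: "harmonic_polynomial l p" "\<And>x. norm x = 1 \<Longrightarrow> Y l k x = p x"
    using basis_harmonic_polynomial[OF k] by blast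
  have "(\<integral>y. h y * Y l k y \<partial>sphere_measure) = (\<integral>y. h y * p y \<partial>sphere_measure)"
    by (rule integral_sphere_cong) (simp add: p)
  also have "\<dots> = 0"
    using \<open>l \<noteq> m\<close> DIM d2 by (intro integral_sphere_harmonic_orthogonal[OF h p(1)]) auto
  finally show ?thesis .
qed

lemma integral_basis_mult_basis:
  assumes j: "j \<in> indices l" and k: "k \<in> indices m"
  shows "(\<integral>y. Y l j y * Y m k y \<partial>sphere_measure) = (if l = m \<and> j = k then 1 else 0)"
proof (cases "l = m")
  case True
  then show ?thesis using onb j k unfolding harmonic_onb_def indices by auto
next
  case False
  obtain p where p: "harmonic_polynomial l p" "\<And>x. norm x = 1 \<Longrightarrow> Y l j x = p x"
    using basis_harmonic_polynomial[OF j] by blast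
  have "(\<integral>y. Y l j y * Y m k y \<partial>sphere_measure) = (\<integral>y. p y * Y m k y \<partial>sphere_measure)"
    by (rule integral_sphere_cong) (simp add: p)
  also have "\<dots> = 0" using False by (intro integral_basis_mult_harmonic[OF k p(1)]) auto
  finally show ?thesis using False by simp
qed

lemma integral_zonal_basis:
  assumes k: "k \<in> indices l" and x: "norm x = 1"
  shows "(\<integral>y. zonal M x y * Y l k y \<partial>sphere_measure) = zonal_mass d M * multiplier d M l * Y l k x"
proof -
  obtain p where p: "harmonic_polynomial l p" "\<And>x. norm x = 1 \<Longrightarrow> Y l k x = p x"
    using basis_harmonic_polynomial[OF k] by blast
  have "(\<integral>y. zonal M x y * Y l k y \<partial>sphere_measure) = (\<integral>y. zonal M x y * p y \<partial>sphere_measure)"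
    by (rule integral_sphere_cong) (simp add: p)
  then show ?thesis using Funk_Hecke_zonal[OF p(1) x DIM d_pos, of M] p(2)[OF x] by simp
qed

text \<open>The identity is linear in the function and holds for each basis element by
  orthonormality, hence on the span. Continuity is part of \<open>P\<close> because the integrals
  have to be additive.\<close>

lemma harmonic_polynomial_expansion:
  assumes h: "harmonic_polynomial l h" and x: "norm x = 1"
  shows "h x = (\<Sum>k\<in>indices l. (\<integral>y. h y * Y l k y \<partial>sphere_measure) * Y l k x)"
proof -
  define P where "P f \<longleftrightarrow> continuous_on (sphere 0 1) f \<and>
    (\<forall>x. (\<Sum>k\<in>indices l. (\<integral>y. f y * Y l k y \<partial>sphere_measure) * Y l k x) = f x)" for f :: "'a \<Rightarrow> real"
  have int: "integrable sphere_measure (\<lambda>y. f y * Y l k y)"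
    if "continuous_on (sphere 0 1) f" "k \<in> indices l" for f k
    using that by (intro integrable_sphere_continuous continuous_intros continuous_on_basis)
  have "real_fun.subspace {f. P f}"
  proof (rule real_fun.subspaceI)
    show "0 \<in> {f. P f}" by (auto simp: P_def)
    show "f + g \<in> {f. P f}" if "f \<in> {f. P f}" "g \<in> {f. P f}" for f g
    proof -
      have fg: "P f" "P g" using that by auto
      have "(\<Sum>k\<in>indices l. (\<integral>y. (f + g) y * Y l k y \<partial>sphere_measure) * Y l k x) = f x + g x" for x
      proof -
        have "(\<Sum>k\<in>indices l. (\<integral>y. (f + g) y * Y l k y \<partial>sphere_measure) * Y l k x)
          = (\<Sum>k\<in>indices l. (\<integral>y. f y * Y l k y \<partial>sphere_measure) * Y l k x + (\<integral>y. g y * Y l k y \<partial>sphere_measure) * Y l k x)"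
        proof (intro sum.cong refl)
          fix k assume k: "k \<in> indices l"
          have "(\<integral>y. (f + g) y * Y l k y \<partial>sphere_measure) = (\<integral>y. f y * Y l k y + g y * Y l k y \<partial>sphere_measure)"
            by (simp add: distrib_right)
          also have "\<dots> = (\<integral>y. f y * Y l k y \<partial>sphere_measure) + (\<integral>y. g y * Y l k y \<partial>sphere_measure)"
            using fg k unfolding P_def by (intro Bochner_Integration.integral_add int) blast+
          finally show "(\<integral>y. (f + g) y * Y l k y \<partial>sphere_measure) * Y l k x =
             (\<integral>y. f y * Y l k y \<partial>sphere_measure) * Y l k x + (\<integral>y. g y * Y l k y \<partial>sphere_measure) * Y l k x"
            by (simp only: distrib_right)
        qed
        also have "\<dots> = f x + g x" using fg unfolding sum.distrib P_def by metis
        finally show ?thesis .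
      qed
      moreover have "continuous_on (sphere 0 1) (f + g)"
        using fg unfolding P_def plus_fun_def by (intro continuous_intros) auto
      ultimately show ?thesis by (simp add: P_def)
    qed
    show "(\<lambda>x. c * f x) \<in> {f. P f}" if "f \<in> {f. P f}" for c f
    proof -
      have f: "P f" using that by auto
      have "(\<Sum>k\<in>indices l. (\<integral>y. (c * f y) * Y l k y \<partial>sphere_measure) * Y l k x) = c * f x" for x
      proof -
        have "(\<Sum>k\<in>indices l. (\<integral>y. (c * f y) * Y l k y \<partial>sphere_measure) * Y l k x)
          = c * (\<Sum>k\<in>indices l. (\<integral>y. f y * Y l k y \<partial>sphere_measure) * Y l k x)"
          by (simp add: sum_distrib_left mult.assoc)
        also have "\<dots> = c * f x" using f unfolding P_def by metis
        finally show ?thesis .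
      qed
      moreover have "continuous_on (sphere 0 1) (\<lambda>x. c * f x)"
        using f unfolding P_def by (intro continuous_intros) auto
      ultimately show ?thesis by (simp add: P_def)
    qed
  qed
  moreover have "P (Y l j)" if j: "j \<in> indices l" for j
  proof -
    have "(\<Sum>k\<in>indices l. (\<integral>y. Y l j y * Y l k y \<partial>sphere_measure) * Y l k x) = (\<Sum>k\<in>indices l. if k = j then Y l k x else 0)" for x
      using j by (intro sum.cong) (auto simp: integral_basis_mult_basis)
    then show ?thesis using j continuous_on_basis[OF j] by (auto simp: P_def)
  qed
  ultimately have P: "P f" if "f \<in> real_fun.span (Y l ` indices l)" for f
    using real_fun.span_induct[OF that, of P] by auto
  \<comment> \<open>The span consists of functions vanishing off the sphere, so \<open>h\<close> is
    cut off before \<open>P\<close> is applied.\<close>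
  define f where "f x = (if x \<in> sphere 0 1 then h x else 0)" for x
  have "f \<in> spherical_harmonics l"
    using h unfolding spherical_harmonics_def f_def[abs_def] harmonic_polynomial_def homogeneous_def by blast
  then have "(\<Sum>k\<in>indices l. (\<integral>y. f y * Y l k y \<partial>sphere_measure) * Y l k x) = f x"
    using P span_basis unfolding P_def by blast
  moreover have "(\<integral>y. f y * Y l k y \<partial>sphere_measure) = (\<integral>y. h y * Y l k y \<partial>sphere_measure)" for k
    by (rule integral_sphere_cong) (simp add: f_def)
  moreover have "f x = h x" using x by (simp add: f_def)
  ultimately show ?thesis by simp
qed

text \<open>Split the kernel into harmonic components. By orthogonality between degrees, the
  coefficients of the component of degree \<open>l\<close> are those of the whole kernel, and these
  are computed by \<open>Funk_Hecke_zonal\<close>.\<close>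

lemma zonal_expansion:
  assumes x: "norm x = 1" and y: "norm y = 1"
  shows "zonal M x y = zonal_mass d M * (\<Sum>l\<le>M. multiplier d M l * (\<Sum>k\<in>indices l. Y l k x * Y l k y))"
proof -
  obtain h where h: "\<And>l. harmonic_polynomial l (h l)"
    "\<And>y. norm y = 1 \<Longrightarrow> zonal M x y = (\<Sum>l\<le>M. h l y)"
    using zonal_harmonic_decomposition[OF x] by blast
  have hc: "continuous_on (sphere 0 1) (h l)" for l
    using h(1)[of l] by (auto simp: harmonic_polynomial_def intro: real_polynomial_function_continuous_on)
  have coeff: "(\<integral>z. h l z * Y l k z \<partial>sphere_measure) = zonal_mass d M * multiplier d M l * Y l k x"
    if l: "l \<le> M" and k: "k \<in> indices l" for l k
  proof -
    have "(\<integral>z. zonal M x z * Y l k z \<partial>sphere_measure) = (\<integral>z. (\<Sum>m\<le>M. h m z * Y l k z) \<partial>sphere_measure)"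
      by (rule integral_sphere_cong) (simp add: h(2) sum_distrib_right)
    also have "\<dots> = (\<Sum>m\<le>M. \<integral>z. h m z * Y l k z \<partial>sphere_measure)"
      by (intro Bochner_Integration.integral_sum integrable_sphere_continuous continuous_intros hc continuous_on_basis k)
    also have "\<dots> = (\<Sum>m\<le>M. if m = l then (\<integral>z. h l z * Y l k z \<partial>sphere_measure) else 0)"
      by (intro sum.cong) (auto simp: integral_basis_mult_harmonic[OF k h(1)])
    also have "\<dots> = (\<integral>z. h l z * Y l k z \<partial>sphere_measure)" using l by simp
    finally show ?thesis using integral_zonal_basis[OF k x, of M] by simp
  qed
  have "zonal M x y = (\<Sum>l\<le>M. \<Sum>k\<in>indices l. (\<integral>z. h l z * Y l k z \<partial>sphere_measure) * Y l k y)"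
    unfolding h(2)[OF y] by (intro sum.cong refl harmonic_polynomial_expansion h(1) y)
  also have "\<dots> = (\<Sum>l\<le>M. \<Sum>k\<in>indices l. zonal_mass d M * (multiplier d M l * (Y l k x * Y l k y)))"
    by (intro sum.cong refl) (simp add: coeff)
  finally show ?thesis by (simp add: sum_distrib_left)
qed

text \<open>The kernel with \<open>M = 0\<close> is constantly 1 and consists of degree 0 alone.
  This identifies the degree 0 part of a function with its mean.\<close>

lemma addition_degree_0:
  assumes "norm x = 1" "norm y = 1"
  shows "(\<Sum>k\<in>indices 0. Y 0 k x * Y 0 k y) = 1"
  using zonal_expansion[OF assms, of 0] by (simp add: zonal_def zonal_mass_def multiplier_def)

lemma integral_basis:
  assumes "k \<in> indices l" "l \<noteq> 0"
  shows "(\<integral>y. Y l k y \<partial>sphere_measure) = 0"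
  using integral_basis_mult_harmonic[OF assms(1) harmonic_polynomial_const[of 1]] assms(2) by simp

text \<open>Degree 0 is split off because it reproduces the integral exactly: the error of a rule on
  the smoothed function involves only degrees from 1 on.\<close>

lemma convolution_zonal:
  assumes x: "norm x = 1" and f: "continuous_on (sphere 0 1) f"
  shows "(\<integral>y. zonal M x y * f y \<partial>sphere_measure) / zonal_mass d M = (\<integral>y. f y \<partial>sphere_measure) +
     (\<Sum>l=1..M. multiplier d M l * (\<Sum>k\<in>indices l. fourier_coeff Y f l k * Y l k x))"
proof -
  have int: "integrable sphere_measure (\<lambda>y. f y * Y l k y)" if "k \<in> indices l" for l k
    using that f by (intro integrable_sphere_continuous continuous_intros continuous_on_basis)
  let ?S = "\<lambda>l. multiplier d M l * (\<Sum>k\<in>indices l. fourier_coeff Y f l k * Y l k x)"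
  have "(\<integral>y. zonal M x y * f y \<partial>sphere_measure)
    = (\<integral>y. (\<Sum>l\<le>M. \<Sum>k\<in>indices l. (zonal_mass d M * multiplier d M l * Y l k x) * (f y * Y l k y)) \<partial>sphere_measure)"
    by (rule integral_sphere_cong)
       (simp add: zonal_expansion[OF x] sum_distrib_left sum_distrib_right mult_ac)
  also have "\<dots> = (\<Sum>l\<le>M. \<integral>y. (\<Sum>k\<in>indices l. (zonal_mass d M * multiplier d M l * Y l k x) * (f y * Y l k y)) \<partial>sphere_measure)"
    using int by (intro Bochner_Integration.integral_sum Bochner_Integration.integrable_sum integrable_mult_right) auto
  also have "\<dots> = (\<Sum>l\<le>M. \<Sum>k\<in>indices l. \<integral>y. (zonal_mass d M * multiplier d M l * Y l k x) * (f y * Y l k y) \<partial>sphere_measure)"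
    using int by (intro sum.cong refl Bochner_Integration.integral_sum integrable_mult_right) auto
  also have "\<dots> = zonal_mass d M * (\<Sum>l\<le>M. ?S l)"
    unfolding integral_mult_right_zero by (simp only: fourier_coeff_def sum_distrib_left mult_ac)
  finally have "(\<integral>y. zonal M x y * f y \<partial>sphere_measure) / zonal_mass d M = (\<Sum>l\<le>M. ?S l)"
    using zonal_mass_pos[OF d_pos, of M] by simp
  also have "\<dots> = ?S 0 + (\<Sum>l=1..M. ?S l)"
    by (simp add: sum.atMost_shift atLeastLessThanSuc_atLeastAtMost sum.atLeast1_atMost_eq lessThan_Suc_atMost)
  also have "?S 0 = (\<integral>y. f y \<partial>sphere_measure)"
  proof -
    have "?S 0 = (\<integral>y. (\<Sum>k\<in>indices 0. (f y * Y 0 k y) * Y 0 k x) \<partial>sphere_measure)"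
      using int by (subst Bochner_Integration.integral_sum) (auto simp: multiplier_def fourier_coeff_def)
    also have "\<dots> = (\<integral>y. f y \<partial>sphere_measure)"
    proof (rule integral_sphere_cong)
      fix y :: 'a assume y: "norm y = 1"
      have "(\<Sum>k\<in>indices 0. (f y * Y 0 k y) * Y 0 k x) = f y * (\<Sum>k\<in>indices 0. Y 0 k x * Y 0 k y)"
        by (simp only: sum_distrib_left mult_ac)
      then show "(\<Sum>k\<in>indices 0. (f y * Y 0 k y) * Y 0 k x) = f y"
        by (simp add: addition_degree_0[OF x y])
    qed
    finally show ?thesis .
  qed
  finally show ?thesis .
qed

section \<open>Quadrature errors split by degree; \<open>degree_power\<close> is the
  \<open>S l\<close> of the overview\<close>

definition degree_power :: "nat \<Rightarrow> (nat \<Rightarrow> 'a) \<Rightarrow> nat \<Rightarrow> real" where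
  "degree_power N x l = (\<Sum>k\<in>indices l. (qmc_rule N x (Y l k))\<^sup>2)"

lemma degree_power_nonneg: "degree_power N x l \<ge> 0"
  unfolding degree_power_def by (intro sum_nonneg) auto

lemma qmc_rule_sum: "qmc_rule N x (\<lambda>y. \<Sum>i\<in>A. f i y) = (\<Sum>i\<in>A. qmc_rule N x (f i))"
  unfolding qmc_rule_def by (subst sum.swap) (simp add: sum_distrib_left)

lemma qmc_rule_cmult: "qmc_rule N x (\<lambda>y. c * f y) = c * qmc_rule N x f"
  unfolding qmc_rule_def by (simp add: sum_distrib_left)

lemma sum_zonal_eq:
  assumes x: "\<And>i. i \<in> {1..N} \<Longrightarrow> norm (x i) = 1"
  shows "(\<Sum>i=1..N. \<Sum>j=1..N. zonal M (x i) (x j)) / (real N)\<^sup>2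
    = zonal_mass d M * (\<Sum>l\<le>M. multiplier d M l * degree_power N x l)"
proof -
  have sq: "(\<Sum>i=1..N. \<Sum>j=1..N. Y l k (x i) * Y l k (x j)) / (real N)\<^sup>2 = (qmc_rule N x (Y l k))\<^sup>2" for l k
    by (simp add: qmc_rule_def power2_eq_square sum_product)
  have "(\<Sum>i=1..N. \<Sum>j=1..N. zonal M (x i) (x j))
     = (\<Sum>i=1..N. \<Sum>j=1..N. \<Sum>l\<le>M. \<Sum>k\<in>indices l. zonal_mass d M * multiplier d M l * (Y l k (x i) * Y l k (x j)))"
    by (intro sum.cong refl) (simp add: zonal_expansion x sum_distrib_left mult.assoc)
  also have "\<dots> = (\<Sum>l\<le>M. \<Sum>k\<in>indices l. \<Sum>i=1..N. \<Sum>j=1..N. zonal_mass d M * multiplier d M l * (Y l k (x i) * Y l k (x j)))"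
    by (simp only: sum.swap[of _ "{..M}"] sum.swap[of _ "indices _" "{1..N}"])
  also have "\<dots> = (\<Sum>l\<le>M. \<Sum>k\<in>indices l. zonal_mass d M * multiplier d M l * (\<Sum>i=1..N. \<Sum>j=1..N. Y l k (x i) * Y l k (x j)))"
    by (simp only: sum_distrib_left)
  finally have "(\<Sum>i=1..N. \<Sum>j=1..N. zonal M (x i) (x j)) / (real N)\<^sup>2
      = (\<Sum>l\<le>M. \<Sum>k\<in>indices l. zonal_mass d M * multiplier d M l * ((\<Sum>i=1..N. \<Sum>j=1..N. Y l k (x i) * Y l k (x j)) / (real N)\<^sup>2))"
    by (simp only: sum_divide_distrib[of _ "{..M}"] sum_divide_distrib[of _ "indices _"] times_divide_eq_right)
  then show ?thesis
    unfolding sq by (simp add: degree_power_def sum_distrib_left mult.assoc)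
qed

lemma degree_power_0:
  assumes "\<And>i. i \<in> {1..N} \<Longrightarrow> norm (x i) = 1" "N > 0"
  shows "degree_power N x 0 = 1"
  using sum_zonal_eq[of N x 0, OF assms(1)] assms(2)
  by (simp add: zonal_def zonal_mass_def multiplier_def power2_eq_square)

text \<open>Powers of a base in [0, 1] decrease in the exponent, for every pair of nodes. The masses
  stay in place: their quotient is the price of the comparison.\<close>

lemma multiplier_sum_mono:
  assumes x: "\<And>i. i \<in> {1..N} \<Longrightarrow> norm (x i) = 1" and mM: "m \<le> M"
  shows "zonal_mass d M * (\<Sum>l\<le>M. multiplier d M l * degree_power N x l)
    \<le> zonal_mass d m * (\<Sum>l\<le>m. multiplier d m l * degree_power N x l)"
proof -
  have "zonal M (x i) (x j) \<le> zonal m (x i) (x j)" if "i \<in> {1..N}" "j \<in> {1..N}" for i j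
    unfolding zonal_def using zonal_nonneg(2,3)[OF x[OF that(1)] x[OF that(2)]] mM
    by (intro power_decreasing) auto
  then have "(\<Sum>i=1..N. \<Sum>j=1..N. zonal M (x i) (x j)) \<le> (\<Sum>i=1..N. \<Sum>j=1..N. zonal m (x i) (x j))"
    by (intro sum_mono) auto
  then have "(\<Sum>i=1..N. \<Sum>j=1..N. zonal M (x i) (x j)) / (real N)\<^sup>2 \<le> (\<Sum>i=1..N. \<Sum>j=1..N. zonal m (x i) (x j)) / (real N)\<^sup>2"
    by (rule divide_right_mono) simp
  then show ?thesis by (simp only: sum_zonal_eq[of N x, OF x])
qed

text \<open>Test the worst-case error with the normalised Riesz representer of the error functional
  on the degrees 1 to \<open>L\<close>; its error is \<open>sqrt A\<close>.\<close>

lemma weighted_error_le_wce: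
  assumes w: "\<And>l. w l > 0" and C: "C \<ge> 0"
    and wce: "wce (qmc_rule N x) (weighted_space Y w) (weighted_norm Y w) \<le> ereal C"
  shows "(\<Sum>l=1..L. degree_power N x l / w l) \<le> C\<^sup>2"
proof -
  define A where "A = (\<Sum>l=1..L. degree_power N x l / w l)"
  have A0: "A \<ge> 0"
    unfolding A_def using degree_power_nonneg w by (intro sum_nonneg divide_nonneg_nonneg) (auto simp: less_imp_le)
  show ?thesis
  proof (cases "A = 0")
    case True
    then show ?thesis unfolding A_def[symmetric] by simp
  next
    case False
    then have A: "A > 0" using A0 by simp
    define q where "q l k = qmc_rule N x (Y l k)" for l k
    \<comment> \<open>The equality case of Cauchy-Schwarz: coefficients proportional to
      \<open>q l k / w l\<close>, scaled to norm 1.\<close>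
    define c where "c l k = q l k / (w l * sqrt A)" for l k
    define f where "f y = (\<Sum>l=1..L. \<Sum>k\<in>indices l. c l k * Y l k y)" for y
    have fc: "continuous_on (sphere 0 1) f"
      unfolding f_def by (intro continuous_intros continuous_on_basis)
    have coeff: "fourier_coeff Y f m j = (if m \<in> {1..L} then c m j else 0)" if j: "j \<in> indices m" for m j
    proof -
      have "fourier_coeff Y f m j = (\<integral>y. (\<Sum>l=1..L. \<Sum>k\<in>indices l. c l k * (Y l k y * Y m j y)) \<partial>sphere_measure)"
        unfolding fourier_coeff_def f_def by (simp add: sum_distrib_right mult.assoc)
      also have "\<dots> = (\<Sum>l=1..L. \<Sum>k\<in>indices l. \<integral>y. c l k * (Y l k y * Y m j y) \<partial>sphere_measure)"
      proof (subst Bochner_Integration.integral_sum)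
        show "(\<Sum>l=1..L. \<integral>y. (\<Sum>k\<in>indices l. c l k * (Y l k y * Y m j y)) \<partial>sphere_measure) =
            (\<Sum>l=1..L. \<Sum>k\<in>indices l. \<integral>y. c l k * (Y l k y * Y m j y) \<partial>sphere_measure)"
          by (intro sum.cong refl Bochner_Integration.integral_sum integrable_sphere_continuous continuous_intros
              continuous_on_basis j)
      qed (intro integrable_sphere_continuous continuous_intros continuous_on_basis j)
      also have "\<dots> = (\<Sum>l=1..L. \<Sum>k\<in>indices l. if l = m \<and> k = j then c l k else 0)"
        using j by (intro sum.cong refl) (auto simp: integral_basis_mult_basis)
      also have "\<dots> = (\<Sum>l=1..L. if l = m then c m j else 0)"
        using j by (intro sum.cong refl) auto
      finally show ?thesis by simp
    qed
    have energy: "weighted_energy Y w f l = (if l \<in> {1..L} then degree_power N x l / w l / A else 0)" for l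
    proof (cases "l \<in> {1..L}")
      case True
      then have "weighted_energy Y w f l = w l * (\<Sum>k\<in>indices l. (c l k)\<^sup>2)"
        unfolding weighted_energy_eq by (simp add: coeff)
      also have "(\<Sum>k\<in>indices l. (c l k)\<^sup>2) = degree_power N x l / ((w l)\<^sup>2 * A)"
        using A by (simp add: c_def degree_power_def q_def power_divide power_mult_distrib sum_divide_distrib)
      finally show ?thesis using True w[of l] by (simp add: power2_eq_square)
    qed (auto simp: weighted_energy_eq coeff)
    have energy_sums: "weighted_energy Y w f sums 1"
    proof -
      have "weighted_energy Y w f sums (\<Sum>l\<in>{1..L}. weighted_energy Y w f l)"
        by (rule sums_finite) (auto simp: energy)
      also have "(\<Sum>l\<in>{1..L}. weighted_energy Y w f l) = A / A"
        unfolding A_def sum_divide_distrib by (simp add: energy A_def)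
      finally show ?thesis using A by simp
    qed
    have fB: "f \<in> weighted_space Y w" and fn: "weighted_norm Y w f \<le> 1"
      using fc energy_sums by (auto simp: weighted_space_def weighted_norm_def sums_iff)
    have "(\<integral>y. f y \<partial>sphere_measure) = (\<Sum>l=1..L. \<Sum>k\<in>indices l. \<integral>y. c l k * Y l k y \<partial>sphere_measure)"
      unfolding f_def
    proof (subst Bochner_Integration.integral_sum)
      show "(\<Sum>l=1..L. \<integral>y. (\<Sum>k\<in>indices l. c l k * Y l k y) \<partial>sphere_measure) =
          (\<Sum>l=1..L. \<Sum>k\<in>indices l. \<integral>y. c l k * Y l k y \<partial>sphere_measure)"
        by (intro sum.cong refl Bochner_Integration.integral_sum integrable_sphere_continuous continuous_intros
            continuous_on_basis)
    qed (intro integrable_sphere_continuous continuous_intros continuous_on_basis)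
    also have "\<dots> = 0" by (intro sum.neutral ballI) (simp add: integral_basis)
    finally have int0: "(\<integral>y. f y \<partial>sphere_measure) = 0" .
    have "qmc_rule N x f = (\<Sum>l=1..L. \<Sum>k\<in>indices l. c l k * q l k)"
      unfolding f_def[abs_def] q_def by (simp only: qmc_rule_sum qmc_rule_cmult)
    also have "\<dots> = (\<Sum>l=1..L. degree_power N x l / w l / sqrt A)"
      by (intro sum.cong refl)
         (simp add: c_def degree_power_def q_def power2_eq_square sum_divide_distrib)
    also have "\<dots> = A / sqrt A" unfolding A_def sum_divide_distrib ..
    also have "\<dots> = sqrt A" using A by (simp add: real_div_sqrt)
    finally have Qf: "qmc_rule N x f = sqrt A" .
    have "ereal \<bar>qmc_rule N x f - (\<integral>y. f y \<partial>sphere_measure)\<bar> \<le> wce (qmc_rule N x) (weighted_space Y w) (weighted_norm Y w)"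
      unfolding wce_def by (rule SUP_upper) (use fB fn in auto)
    also note wce
    finally have "sqrt A \<le> C" using A by (simp add: Qf int0)
    then have "(sqrt A)\<^sup>2 \<le> C\<^sup>2" using A by (intro power_mono) auto
    then show ?thesis using A by (simp add: A_def)
  qed
qed

text \<open>Cauchy-Schwarz is applied to the smoothed functions \<open>g M\<close>. The multipliers
  lie in [0, 1], so the bound is uniform in \<open>M\<close> and survives the limit at the finitely
  many nodes.\<close>

lemma wce_leI:
  assumes w: "\<And>l. w l > 0" and C: "C \<ge> 0" and N: "N > 0"
    and x: "\<And>i. i \<in> {1..N} \<Longrightarrow> norm (x i) = 1"
    and error: "\<And>L. (\<Sum>l=1..L. degree_power N x l / w l) \<le> C\<^sup>2"
  shows "wce (qmc_rule N x) (weighted_space Y w) (weighted_norm Y w) \<le> ereal C"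
  unfolding wce_def
proof (rule SUP_least)
  fix f assume "f \<in> {f \<in> weighted_space Y w. weighted_norm Y w f \<le> 1}"
  then have f: "continuous_on (sphere 0 1) f" and sm: "summable (weighted_energy Y w f)"
    and nf: "weighted_norm Y w f \<le> 1" by (auto simp: weighted_space_def)
  let ?I = "\<integral>y. f y \<partial>sphere_measure"
  define a where "a l = (\<Sum>k\<in>indices l. (fourier_coeff Y f l k)\<^sup>2)" for l
  have a: "a l \<ge> 0" for l unfolding a_def by (intro sum_nonneg) auto
  have we: "weighted_energy Y w f = (\<lambda>l. w l * a l)" by (intro ext) (simp add: weighted_energy_eq a_def)
  have "suminf (weighted_energy Y w f) \<le> 1" using nf by (simp add: weighted_norm_def)
  moreover have "(\<Sum>l=1..M. w l * a l) \<le> suminf (weighted_energy Y w f)" for M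
    using sm w a unfolding we by (intro sum_le_suminf) (auto simp: less_imp_le)
  ultimately have energy: "(\<Sum>l=1..M. w l * a l) \<le> 1" for M by (meson order_trans)
  define g where "g M y = (\<integral>z. zonal M y z * f z \<partial>sphere_measure) / zonal_mass d M" for M y
  have bound: "\<bar>qmc_rule N x (g M) - ?I\<bar> \<le> C" for M
  proof -
    have "qmc_rule N x (g M) = qmc_rule N x (\<lambda>y. ?I * 1 + (\<Sum>l=1..M. multiplier d M l * (\<Sum>k\<in>indices l. fourier_coeff Y f l k * Y l k y)))"
      unfolding qmc_rule_def using x f
      by (intro arg_cong[where f = "\<lambda>s. 1 / real N * s"] sum.cong) (auto simp: g_def convolution_zonal)
    also have "\<dots> = ?I + qmc_rule N x (\<lambda>y. \<Sum>l=1..M. multiplier d M l * (\<Sum>k\<in>indices l. fourier_coeff Y f l k * Y l k y))"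
      using N unfolding qmc_rule_def by (simp add: sum.distrib distrib_left)
    also have "qmc_rule N x (\<lambda>y. \<Sum>l=1..M. multiplier d M l * (\<Sum>k\<in>indices l. fourier_coeff Y f l k * Y l k y))
        = (\<Sum>l=1..M. multiplier d M l * (\<Sum>k\<in>indices l. fourier_coeff Y f l k * qmc_rule N x (Y l k)))"
      by (simp only: qmc_rule_sum qmc_rule_cmult)
    finally have "\<bar>qmc_rule N x (g M) - ?I\<bar>
        = \<bar>\<Sum>l=1..M. multiplier d M l * (\<Sum>k\<in>indices l. fourier_coeff Y f l k * qmc_rule N x (Y l k))\<bar>" by simp
    also have "\<dots> \<le> (\<Sum>l=1..M. \<bar>multiplier d M l * (\<Sum>k\<in>indices l. fourier_coeff Y f l k * qmc_rule N x (Y l k))\<bar>)"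
      by (rule sum_abs)
    also have "\<dots> \<le> (\<Sum>l=1..M. \<bar>sqrt (w l * a l)\<bar> * \<bar>sqrt (degree_power N x l / w l)\<bar>)"
    proof (rule sum_mono)
      fix l
      have "\<bar>\<Sum>k\<in>indices l. fourier_coeff Y f l k * qmc_rule N x (Y l k)\<bar>
          \<le> (\<Sum>k\<in>indices l. \<bar>fourier_coeff Y f l k\<bar> * \<bar>qmc_rule N x (Y l k)\<bar>)"
        by (rule order_trans[OF sum_abs]) (simp add: abs_mult)
      also have "\<dots> \<le> sqrt (a l) * sqrt (degree_power N x l)"
        unfolding a_def degree_power_def L2_set_def[symmetric] by (rule L2_set_mult_ineq)
      also have "\<dots> = \<bar>sqrt (w l * a l)\<bar> * \<bar>sqrt (degree_power N x l / w l)\<bar>"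
        using w[of l] a[of l] degree_power_nonneg[of N x l] by (simp add: real_sqrt_mult real_sqrt_divide)
      finally have "\<bar>multiplier d M l\<bar> * \<bar>\<Sum>k\<in>indices l. fourier_coeff Y f l k * qmc_rule N x (Y l k)\<bar>
          \<le> 1 * (\<bar>sqrt (w l * a l)\<bar> * \<bar>sqrt (degree_power N x l / w l)\<bar>)"
        using multiplier_nonneg[OF d_pos, of M l] multiplier_le_1[OF d_pos, of M l]
        by (intro mult_mono) auto
      then show "\<bar>multiplier d M l * (\<Sum>k\<in>indices l. fourier_coeff Y f l k * qmc_rule N x (Y l k))\<bar>
          \<le> \<bar>sqrt (w l * a l)\<bar> * \<bar>sqrt (degree_power N x l / w l)\<bar>"
        by (simp only: abs_mult mult_1)
    qed
    also have "\<dots> \<le> L2_set (\<lambda>l. sqrt (w l * a l)) {1..M} * L2_set (\<lambda>l. sqrt (degree_power N x l / w l)) {1..M}"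
      by (rule L2_set_mult_ineq)
    also have "\<dots> = sqrt (\<Sum>l=1..M. w l * a l) * sqrt (\<Sum>l=1..M. degree_power N x l / w l)"
      using w a degree_power_nonneg by (simp add: L2_set_def less_imp_le)
    also have "\<dots> \<le> 1 * C"
      using energy[of M] error[of M] C degree_power_nonneg w
      by (intro mult_mono) (auto intro!: real_le_lsqrt sum_nonneg divide_nonneg_nonneg simp: less_imp_le)
    finally show ?thesis by simp
  qed
  have "(\<lambda>M. g M (x i)) \<longlonglongrightarrow> f (x i)" if "i \<in> {1..N}" for i
    unfolding g_def by (rule zonal_approximate_identity[OF f x[OF that] DIM d_pos])
  then have "(\<lambda>M. \<bar>qmc_rule N x (g M) - ?I\<bar>) \<longlonglongrightarrow> \<bar>qmc_rule N x f - ?I\<bar>"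
    unfolding qmc_rule_def by (intro tendsto_intros) auto
  then have "\<bar>qmc_rule N x f - ?I\<bar> \<le> C"
    by (rule LIMSEQ_le_const2) (use bound in auto)
  then show "ereal \<bar>qmc_rule N x f - ?I\<bar> \<le> ereal C" by simp
qed

end

section \<open>Estimates of the kernel coefficients\<close>

text \<open>One half of the asymptotics \<open>M powr (- d / 2)\<close> of the mass. With a = d / 2
  a single step asks for (1 + 1/M)^a \<ge> 1 + a / (M + a). The left side is at least 1 + a / (M +
  1), and a \<ge> 1.\<close>

lemma zonal_mass_powr_mono:
  assumes d: "d \<ge> 2" and m: "m \<ge> 1" "m \<le> M"
  shows "zonal_mass d m * real m powr (real d / 2) \<le> zonal_mass d M * real M powr (real d / 2)"
  using m(2)
proof (induction M rule: dec_induct)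
  case (step M)
  have M: "real M \<ge> 1" using step(1) m(1) by simp
  define a where "a = real d / 2"
  have a: "a \<ge> 1" using d by (simp add: a_def)
  have "ln (real M / (real M + 1)) \<le> real M / (real M + 1) - 1"
    using M by (intro ln_le_minus_one) auto
  then have "1 / (real M + 1) \<le> ln ((real M + 1) / real M)"
    using M by (simp add: ln_div field_simps)
  then have "a * (1 / (real M + 1)) \<le> a * ln ((real M + 1) / real M)"
    using a by (intro mult_left_mono) auto
  then have "1 + a * (1 / (real M + 1)) \<le> exp (a * ln ((real M + 1) / real M))"
    using exp_ge_add_one_self[of "a * ln ((real M + 1) / real M)"] by linarith
  moreover have "a / (real M + a) \<le> a * (1 / (real M + 1))"
    using divide_left_mono[of "real M + 1" "real M + a" a] a M by simp
  moreover have "1 + a / (real M + a) = (real M + 2 * a) / (real M + a)"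
    using a M by (simp add: field_simps)
  moreover have "exp (a * ln ((real M + 1) / real M)) = (real M + 1) powr a / real M powr a"
    using M by (simp add: powr_def ln_div exp_diff right_diff_distrib)
  ultimately have "(real M + 2 * a) / (real M + a) \<le> (real M + 1) powr a / real M powr a" by linarith
  then have "real M powr a \<le> (real M + a) / (real M + 2 * a) * (real M + 1) powr a"
    using a M by (simp add: field_simps)
  then have "zonal_mass d M * real M powr a \<le> zonal_mass d M * ((real M + a) / (real M + 2 * a) * (real M + 1) powr a)"
    using zonal_mass_pos[of d M] d by (intro mult_left_mono) auto
  also have "\<dots> = zonal_mass d (Suc M) * real (Suc M) powr a"
    by (simp add: zonal_mass_Suc a_def add.commute)
  finally show ?case using step(3) unfolding a_def by linarith
qed simp

text \<open>These are the numerators of one minus the factors of \<open>multiplier\<close>; through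
  their sum the product becomes an exponential of the eigenvalue.\<close>

lemma sum_eigval: "(\<Sum>j<l. 2 * real j + real d) = eigval d l"
  by (induction l) (simp_all add: eigval_def algebra_simps)

lemma eigval_nonneg: "d \<ge> 2 \<Longrightarrow> eigval d l \<ge> 0"
  by (auto simp: eigval_def)

lemma eigval_ge:
  assumes "d \<ge> 2" "l \<ge> 1"
  shows "eigval d l \<ge> 2 * real l" "eigval d l \<ge> 1"
proof -
  have "real l * 2 \<le> real l * (real l + real d - 1)"
    using assms by (intro mult_left_mono) auto
  then show "eigval d l \<ge> 2 * real l" by (simp add: eigval_def)
  then show "eigval d l \<ge> 1" using assms by linarith
qed

text \<open>Each factor is 1 - (2 j + d) / (M + d + j), and j \<le> M bounds the denominator by 2 M
  + d.\<close>

lemma multiplier_le_exp: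
  assumes d: "d \<ge> 2" and M: "M \<ge> 1"
  shows "multiplier d M l \<le> exp (- eigval d l / (2 * real M + real d))"
proof (cases "M < l")
  case False
  have "multiplier d M l \<le> (\<Prod>j<l. exp (- (2 * real j + real d) / (2 * real M + real d)))"
    unfolding multiplier_def
  proof (rule prod_mono)
    fix j assume "j \<in> {..<l}"
    then have j: "real j \<le> real M" using False by auto
    have "(2 * real j + real d) / (2 * real M + real d) \<le> (2 * real j + real d) / (real M + real d + real j)"
      using j d by (intro divide_left_mono) auto
    also have "\<dots> = 1 - (real M - real j) / (real M + real d + real j)"
      using d by (simp add: field_simps)
    finally have "(real M - real j) / (real M + real d + real j) \<le> 1 - (2 * real j + real d) / (2 * real M + real d)"
      by linarith
    also have "\<dots> = 1 + (- (2 * real j + real d) / (2 * real M + real d))"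
      by (simp only: diff_conv_add_uminus minus_divide_left)
    also have "\<dots> \<le> exp (- (2 * real j + real d) / (2 * real M + real d))" by (rule exp_ge_add_one_self)
    finally show "0 \<le> (real M - real j) / (real M + real d + real j) \<and>
        (real M - real j) / (real M + real d + real j) \<le> exp (- (2 * real j + real d) / (2 * real M + real d))"
      using j by auto
  qed
  also have "\<dots> = exp (\<Sum>j<l. - (2 * real j + real d) / (2 * real M + real d))"
    by (simp add: exp_sum)
  also have "(\<Sum>j<l. - (2 * real j + real d) / (2 * real M + real d)) = - eigval d l / (2 * real M + real d)"
    unfolding sum_eigval[symmetric] by (simp only: sum_divide_distrib[symmetric] sum_negf)
  finally show ?thesis .
qed (simp add: multiplier_eq_0)

text \<open>Trades exponential decay for the power in the Sobolev weight. The constant collects 1 +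
  \<open>eigval\<close> \<le> 2 \<open>eigval\<close> and 2 M + d \<le> (2 + d) M.\<close>

lemma multiplier_le_powr:
  assumes d: "d \<ge> 2" and M: "M \<ge> 1" and l: "l \<ge> 1" and s: "s > 0"
  shows "multiplier d M l \<le> (2 * s * (2 + real d)) powr s * real M powr s / (1 + eigval d l) powr s"
proof -
  define z where "z = eigval d l / (2 * real M + real d)"
  have lam: "eigval d l \<ge> 1" using eigval_ge[OF d l] by simp
  have z: "z > 0" using lam d M by (auto simp: z_def intro!: divide_pos_pos)
  \<comment> \<open>Raised to the power \<open>s\<close>, this is the bound of exp(-z) by (s /
    z)^s.\<close>
  have "z / s \<le> exp (z / s)" using exp_ge_add_one_self[of "z / s"] by linarith
  then have "(z / s) powr s \<le> exp (z / s) powr s" using z s by (intro powr_mono2) auto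
  also have "\<dots> = exp z" using s by (simp add: powr_def)
  finally have 1: "exp (- z) \<le> (s / z) powr s"
    using z s by (simp add: exp_minus powr_divide field_simps)
  have "2 * real M + real d \<le> (2 + real d) * real M"
    using M mult_left_mono[of 1 "real M" "real d"] by (simp add: algebra_simps)
  then have "s * (1 + eigval d l) * (2 * real M + real d) \<le> s * (2 * eigval d l) * ((2 + real d) * real M)"
    using lam s by (intro mult_mono) auto
  moreover define D K e where "D = 2 * real M + real d" and "K = (2 + real d) * real M" and "e = eigval d l"
  ultimately have "s * (1 + e) * D \<le> s * (2 * e) * K" by simp
  moreover have "D > 0" "e > 0" using d M lam by (auto simp: D_def e_def)
  ultimately have "s / (e / D) \<le> 2 * s * K / (1 + e)" by (simp add: field_simps)
  then have "s / z \<le> 2 * s * (2 + real d) * real M / (1 + eigval d l)"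
    by (simp add: z_def D_def K_def e_def mult.assoc)
  then have "(s / z) powr s \<le> (2 * s * (2 + real d) * real M / (1 + eigval d l)) powr s"
    using z s by (intro powr_mono2) auto
  also have "\<dots> = (2 * s * (2 + real d)) powr s * real M powr s / (1 + eigval d l) powr s"
    using lam s by (simp add: powr_divide powr_mult)
  finally show ?thesis using 1 multiplier_le_exp[OF d M, of l] by (simp add: z_def)
qed

text \<open>The hypothesis forces 2 l \<le> M, so the reciprocal of a factor is 1 + y with y \<le> 2
  (2 j + d) / M. These bounds add up to 2 \<open>eigval\<close> / M \<le> 2.\<close>

lemma exp_minus_2_le_multiplier:
  assumes d: "d \<ge> 2" and l: "l \<ge> 1" and M: "1 + eigval d l \<le> real M"
  shows "exp (- 2) \<le> multiplier d M l"
proof -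
  have lM: "2 * real l \<le> real M" "real M > 0" using eigval_ge[OF d l] M by auto
  have "- 2 \<le> - (2 * eigval d l / real M)" using M lM by (simp add: divide_le_eq)
  then have "exp (- 2) \<le> exp (- (2 * eigval d l / real M))" by simp
  also have "- (2 * eigval d l / real M) = (\<Sum>j<l. - (2 * (2 * real j + real d) / real M))"
    unfolding sum_eigval[symmetric] by (simp only: sum_divide_distrib sum_distrib_left sum_negf)
  also have "exp \<dots> = (\<Prod>j<l. exp (- (2 * (2 * real j + real d) / real M)))"
    by (simp add: exp_sum)
  also have "\<dots> \<le> multiplier d M l"
    unfolding multiplier_def
  proof (rule prod_mono)
    fix j assume "j \<in> {..<l}"
    then have j: "real M \<le> 2 * (real M - real j)" "real M - real j > 0" using lM by auto
    define y where "y = (2 * real j + real d) / (real M - real j)"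
    have "y \<le> 2 * (2 * real j + real d) / real M"
      using j lM d mult_left_mono[OF j(1), of "2 * real j + real d"] by (simp add: y_def field_simps)
    then have "exp (- (2 * (2 * real j + real d) / real M)) \<le> exp (- y)" by simp
    also have "\<dots> \<le> inverse (1 + y)"
      using exp_ge_add_one_self[of y] j by (subst exp_minus, intro le_imp_inverse_le) (auto simp: y_def intro!: add_pos_nonneg divide_nonneg_pos)
    also have "1 + y = (real M + real d + real j) / (real M - real j)"
      using j by (simp add: y_def field_simps)
    finally show "0 \<le> exp (- (2 * (2 * real j + real d) / real M)) \<and>
      exp (- (2 * (2 * real j + real d) / real M)) \<le> (real M - real j) / (real M + real d + real j)"
      by simp
  qed
  finally show ?thesis .
qed

text \<open>A power divided by a logarithmic factor is increasing up to a constant. With r = m / x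
  one has ln (2 + m) \<le> ln (2 + x) (1 + ln r), as ln (2 + x) \<ge> 1, and 1 + ln r is at most a
  multiple of r^(a/p). For x = 1 + \<open>eigval\<close> the argument 2 + x is that of the
  weight.\<close>

lemma ln_ratio_powr_le:
  fixes x m a p :: real
  assumes a: "a > 0" and p: "p > 0" and x: "1 \<le> x" "x \<le> m"
  shows "x powr a * ln (2 + x) powr (- p) \<le> (1 + p / a) powr p * (m powr a * ln (2 + m) powr (- p))"
proof -
  have m: "m \<ge> 1" using x by simp
  have l3: "ln (3::real) \<ge> 1" using exp_le by (subst ln_ge_iff) auto
  have l2x: "ln (2 + x) \<ge> 1" using l3 ln_mono[of 3 "2 + x"] x by linarith
  have l2m: "ln (2 + m) \<ge> 1" using l3 ln_mono[of 3 "2 + m"] m by linarith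
  define r where "r = m / x"
  have r: "r \<ge> 1" using x by (simp add: r_def)
  have "2 + m \<le> (2 + x) * r" using x r by (simp add: r_def field_simps)
  then have "ln (2 + m) \<le> ln ((2 + x) * r)" using m x r by (intro ln_mono) auto
  also have "\<dots> = ln (2 + x) + ln r" using x r by (simp add: ln_mult)
  also have "\<dots> \<le> ln (2 + x) + ln r * ln (2 + x)"
    using l2x r by (intro add_left_mono) (simp add: mult_le_cancel_left1)
  also have "\<dots> = ln (2 + x) * (1 + ln r)" by (simp add: algebra_simps)
  also have "1 + ln r \<le> (1 + p / a) * r powr (a / p)"
  proof -
    have "ln (r powr (a / p)) \<le> r powr (a / p) - 1" using r by (intro ln_le_minus_one) auto
    then have "ln r \<le> p / a * (r powr (a / p) - 1)" using a p r by (simp add: ln_powr field_simps)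
    also have "\<dots> \<le> p / a * r powr (a / p)" using a p by (intro mult_left_mono) auto
    finally have "ln r \<le> p / a * r powr (a / p)" .
    moreover have "1 \<le> r powr (a / p)" using r a p by (intro ge_one_powr_ge_zero) auto
    ultimately show ?thesis by (simp add: algebra_simps)
  qed
  finally have "ln (2 + m) \<le> ln (2 + x) * ((1 + p / a) * r powr (a / p))" using l2x by simp
  then have "ln (2 + m) powr p \<le> (ln (2 + x) * ((1 + p / a) * r powr (a / p))) powr p"
    using l2m p by (intro powr_mono2) auto
  also have "\<dots> = ln (2 + x) powr p * ((1 + p / a) powr p * r powr a)"
    using a p l2x r by (simp add: powr_mult powr_powr)
  also have "r powr a = m powr a / x powr a" using x m by (simp add: r_def powr_divide)
  finally have "ln (2 + m) powr p * x powr a \<le> ln (2 + x) powr p * ((1 + p / a) powr p * m powr a)"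
    using x by (simp add: field_simps)
  then show ?thesis
    using l2x l2m by (simp add: powr_minus field_simps)
qed

text \<open>The mean value theorem for x^(1-p); it makes the next sum telescope.\<close>

lemma powr_minus_diff_ge:
  assumes u: "0 < u" "u \<le> v" and p: "(p::real) > 1"
  shows "(p - 1) * (v - u) * v powr (- p) \<le> u powr (1 - p) - v powr (1 - p)"
proof (cases "u = v")
  case False
  then have uv: "u < v" using u by simp
  have "((\<lambda>x. x powr (1 - p)) has_real_derivative (1 - p) * x powr (1 - p - 1)) (at x)" if "u \<le> x" for x
    using u that by (intro has_real_derivative_powr) auto
  from MVT2[OF uv this] obtain z where z: "z > u" "z < v"
    "v powr (1 - p) - u powr (1 - p) = (v - u) * ((1 - p) * z powr (1 - p - 1))"
    by blast
  have "v powr (- p) \<le> z powr (- p)"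
    using z u p by (intro powr_mono2') auto
  then have "((p - 1) * (v - u)) * v powr (- p) \<le> ((p - 1) * (v - u)) * z powr (- p)"
    using p uv by (intro mult_left_mono) auto
  then show ?thesis using z(3) by (simp add: algebra_simps)
qed simp

text \<open>An integral test by telescoping. Since \<delta> \<le> A, consecutive terms of the
  progression differ by a factor of at most 2, which costs 2^p; the bound does not depend on
  \<open>J\<close>.\<close>

lemma sum_powr_arith_le:
  fixes A \<delta> p :: real
  assumes \<delta>: "0 < \<delta>" "\<delta> \<le> A" and p: "p > 1"
  shows "(\<Sum>j<J. (A + real j * \<delta>) powr (- p)) \<le> 2 powr p / ((p - 1) * \<delta>) * A powr (1 - p)"
proof -
  define u where "u j = A + real j * \<delta>" for j
  have u: "u j > 0" "u (Suc j) = u j + \<delta>" "\<delta> \<le> u j" for j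
    using \<delta> by (auto simp: u_def algebra_simps intro: add_pos_nonneg add_increasing2)
  have "(\<Sum>j<J. u j powr (- p)) \<le> (\<Sum>j<J. 2 powr p / ((p - 1) * \<delta>) * (u j powr (1 - p) - u (Suc j) powr (1 - p)))"
  proof (rule sum_mono)
    fix j
    have "(2 * u j) powr (- p) \<le> u (Suc j) powr (- p)"
      using u[of j] u(1)[of "Suc j"] p by (intro powr_mono2') auto
    then have "u j powr (- p) \<le> 2 powr p * u (Suc j) powr (- p)"
      using u(1)[of j] by (simp add: powr_mult powr_minus field_simps)
    also have "(p - 1) * \<delta> * u (Suc j) powr (- p) \<le> u j powr (1 - p) - u (Suc j) powr (1 - p)"
      using powr_minus_diff_ge[of "u j" "u (Suc j)" p] u[of j] \<delta> p by simp
    then have "2 powr p * u (Suc j) powr (- p) \<le> 2 powr p / ((p - 1) * \<delta>) * (u j powr (1 - p) - u (Suc j) powr (1 - p))"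
    proof -
      assume *: "(p - 1) * \<delta> * u (Suc j) powr (- p) \<le> u j powr (1 - p) - u (Suc j) powr (1 - p)"
      have c: "(p - 1) * \<delta> > 0" using p \<delta> by simp
      have "u (Suc j) powr (- p) \<le> (u j powr (1 - p) - u (Suc j) powr (1 - p)) / ((p - 1) * \<delta>)"
        unfolding pos_le_divide_eq[OF c] using * by (simp only: mult.commute)
      then have "2 powr p * u (Suc j) powr (- p) \<le> 2 powr p * ((u j powr (1 - p) - u (Suc j) powr (1 - p)) / ((p - 1) * \<delta>))"
        by (rule mult_left_mono) simp
      then show ?thesis by (simp only: times_divide_eq_left times_divide_eq_right)
    qed
    finally show "u j powr (- p) \<le> 2 powr p / ((p - 1) * \<delta>) * (u j powr (1 - p) - u (Suc j) powr (1 - p))" .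
  qed
  also have "\<dots> = 2 powr p / ((p - 1) * \<delta>) * (u 0 powr (1 - p) - u J powr (1 - p))"
    unfolding sum_distrib_left[symmetric] by (subst sum_lessThan_telescope') simp
  also have "\<dots> \<le> 2 powr p / ((p - 1) * \<delta>) * u 0 powr (1 - p)"
    using p \<delta> by (intro mult_left_mono) auto
  finally show ?thesis by (simp add: u_def)
qed

section \<open>Transfer of the error bound\<close>

text \<open>
  \<open>S l\<close> stands for the degree \<open>l\<close> part of the squared error and \<open>m \<approx> N powr (2 / d)\<close> for the
  square of the critical degree.
\<close>

locale degree_power_bounds =
  fixes d N m :: nat and s c :: real and S :: "nat \<Rightarrow> real"
  assumes d2: "d \<ge> 2" and s: "s > real d / 2" and N2: "N \<ge> 2"
    and S_nonneg: "S l \<ge> 0" and S_0: "S 0 = 1"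
    and mono: "m' \<le> M \<Longrightarrow> zonal_mass d M * (\<Sum>l\<le>M. multiplier d M l * S l)
        \<le> zonal_mass d m' * (\<Sum>l\<le>m'. multiplier d m' l * S l)"
    and sobolev: "(\<Sum>l=1..L. S l / (1 + eigval d l) powr s) \<le> c\<^sup>2 * real N powr (- 2 * s / real d)"
    and m_lower: "real N powr (2 / real d) \<le> real m" and m_upper: "real m \<le> 2 * real N powr (2 / real d)"
begin

lemma m1: "m \<ge> 1"
proof -
  have "1 \<le> real N powr (2 / real d)" using N2 by (intro ge_one_powr_ge_zero) auto
  then show ?thesis using m_lower by linarith
qed

lemma powr_m_le: "e \<ge> 0 \<Longrightarrow> real m powr e \<le> 2 powr e * real N powr (2 * e / real d)"
  using powr_mono2[OF _ _ m_upper, of e] by (simp add: powr_mult powr_powr mult.commute)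

text \<open>The 1 is degree 0, the first power comes from \<open>multiplier_le_powr\<close>, and
  \<open>2 powr s\<close> comes from rounding in \<open>m_upper\<close>.\<close>

definition "E = 1 + (2 * s * (2 + real d)) powr s * 2 powr s * c\<^sup>2"

lemma E_pos: "E > 0"
  unfolding E_def by (intro add_pos_nonneg mult_nonneg_nonneg) auto

text \<open>At the critical \<open>M = m\<close> the factor m^s from
  \<open>multiplier_le_powr\<close> cancels the rate in the Sobolev bound.\<close>

lemma multiplier_sum_critical_le: "(\<Sum>l\<le>m. multiplier d m l * S l) \<le> E"
proof -
  have s0: "s > 0" using s d2 by linarith
  define K where "K = (2 * s * (2 + real d)) powr s"
  have "(\<Sum>l\<le>m. multiplier d m l * S l) = 1 + (\<Sum>l=1..m. multiplier d m l * S l)"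
    by (simp add: sum.atMost_shift sum.atLeast1_atMost_eq S_0 multiplier_def)
  also have "(\<Sum>l=1..m. multiplier d m l * S l) \<le> (\<Sum>l=1..m. K * real m powr s * (S l / (1 + eigval d l) powr s))"
  proof (rule sum_mono)
    fix l assume "l \<in> {1..m}"
    then have "multiplier d m l * S l \<le> K * real m powr s / (1 + eigval d l) powr s * S l"
      unfolding K_def using multiplier_le_powr[OF d2 m1 _ s0, of l] S_nonneg[of l] by (intro mult_right_mono) auto
    then show "multiplier d m l * S l \<le> K * real m powr s * (S l / (1 + eigval d l) powr s)" by simp
  qed
  also have "\<dots> \<le> K * (2 powr s * real N powr (2 * s / real d)) * (c\<^sup>2 * real N powr (- 2 * s / real d))"
    unfolding sum_distrib_left[symmetric] using s0 sobolev powr_m_le[of s] d2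
    by (intro mult_mono mult_nonneg_nonneg sum_nonneg divide_nonneg_nonneg S_nonneg) (auto simp: K_def)
  also have "\<dots> = K * 2 powr s * c\<^sup>2 * (real N powr (2 * s / real d) * real N powr (- 2 * s / real d))"
    by (simp only: mult_ac)
  also have "real N powr (2 * s / real d) * real N powr (- 2 * s / real d) = 1"
    using N2 by (simp flip: powr_add)
  finally show ?thesis by (simp add: E_def K_def)
qed

text \<open>Comparison with the critical kernel costs the quotient of the masses, at most (M /
  m)^(d/2), while m^(d/2) \<ge> N.\<close>

lemma multiplier_sum_le:
  assumes M: "m \<le> M"
  shows "(\<Sum>l\<le>M. multiplier d M l * S l) \<le> E * real M powr (real d / 2) / real N"
proof -
  let ?h = "real d / 2"
  have pos: "zonal_mass d m > 0" "zonal_mass d M > 0" using zonal_mass_pos d2 by auto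
  have "real N = (real N powr (2 / real d)) powr ?h" using N2 d2 by (simp add: powr_powr)
  also have "\<dots> \<le> real m powr ?h" using m_lower by (intro powr_mono2) auto
  finally have Nm: "real N \<le> real m powr ?h" .
  have "zonal_mass d M * (\<Sum>l\<le>M. multiplier d M l * S l) \<le> zonal_mass d m * E"
    using mono[OF M] mult_left_mono[OF multiplier_sum_critical_le, of "zonal_mass d m"] pos by linarith
  then have "zonal_mass d M * (\<Sum>l\<le>M. multiplier d M l * S l) * real N \<le> zonal_mass d m * E * real m powr ?h"
    by (rule mult_mono[OF _ Nm]) (use pos E_pos in auto)
  also have "\<dots> = E * (zonal_mass d m * real m powr ?h)" by simp
  also have "\<dots> \<le> E * (zonal_mass d M * real M powr ?h)"
    using zonal_mass_powr_mono[OF d2 m1 M] E_pos by (intro mult_left_mono) auto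
  finally have "zonal_mass d M * ((\<Sum>l\<le>M. multiplier d M l * S l) * real N) \<le> zonal_mass d M * (E * real M powr ?h)"
    by (simp only: mult_ac)
  then have "(\<Sum>l\<le>M. multiplier d M l * S l) * real N \<le> E * real M powr ?h" using pos by simp
  then show ?thesis using N2 by (simp add: le_divide_eq)
qed

context
  fixes p :: real
  assumes p: "p > 1"
begin

lemma ln_N: "ln (real N) \<ge> ln 2" "ln (2::real) > 0" "ln (real N) > 0"
proof -
  show "ln (real N) \<ge> ln 2" using N2 by (intro ln_mono) auto
  show "ln (2::real) > 0" by simp
  with \<open>ln (real N) \<ge> ln 2\<close> show "ln (real N) > 0" by linarith
qed

lemma ln_m: "2 / real d * ln (real N) \<le> ln (real m)"
proof -
  have "ln (real N powr (2 / real d)) \<le> ln (real m)"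
    using m_lower m1 N2 by (intro ln_mono) auto
  then show ?thesis using N2 by (simp add: ln_powr)
qed

text \<open>In order: the constant of \<open>ln_ratio_powr_le\<close>, the rounding of
  \<open>m\<close>, the Sobolev constant, ln m \<ge> (2 / d) ln N, and the final loss of one
  logarithm.\<close>

definition "low_const = (1 + p / (s - real d / 2)) powr p * 2 powr (s - real d / 2) * c\<^sup>2
    * (2 / real d) powr (- p) / ln 2"

text \<open>Up to a constant, the logarithmic weight is traded for the Sobolev weight at the worst
  point x = m. This yields even (ln N)^(-p) / N; one logarithm is given away to match the high
  degrees.\<close>

lemma low_sum_le:
  "(\<Sum>l\<in>{l\<in>{1..L}. 1 + eigval d l \<le> real m}. S l / ((1 + eigval d l) powr (real d / 2) * ln (3 + eigval d l) powr p))
   \<le> low_const * (ln (real N) powr (1 - p) / real N)"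
proof -
  define a where "a = s - real d / 2"
  have a: "a > 0" using s by (simp add: a_def)
  define G where "G = (1 + p / a) powr p"
  have G: "G \<ge> 0" by (simp add: G_def)
  let ?F = "{l\<in>{1..L}. 1 + eigval d l \<le> real m}"
  define H where "H = G * (real m powr a * ln (2 + real m) powr (- p))"
  have H: "H \<ge> 0" using G by (simp add: H_def)
  have "(\<Sum>l\<in>?F. S l / ((1 + eigval d l) powr (real d / 2) * ln (3 + eigval d l) powr p))
     \<le> (\<Sum>l\<in>?F. H * (S l / (1 + eigval d l) powr s))"
  proof (rule sum_mono)
    fix l assume l: "l \<in> ?F"
    define x where "x = 1 + eigval d l"
    have x: "1 \<le> x" "x \<le> real m" using l eigval_nonneg[OF d2, of l] by (auto simp: x_def)
    have "x powr s = x powr (real d / 2) * x powr a" by (simp add: a_def flip: powr_add)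
    then have "S l / (x powr (real d / 2) * ln (2 + x) powr p) = S l / x powr s * (x powr a * ln (2 + x) powr (- p))"
      using x by (simp add: powr_minus field_simps)
    also have "\<dots> \<le> S l / x powr s * H"
      unfolding H_def G_def using S_nonneg[of l] a p x
      by (intro mult_left_mono ln_ratio_powr_le divide_nonneg_nonneg) auto
    finally show "S l / ((1 + eigval d l) powr (real d / 2) * ln (3 + eigval d l) powr p) \<le> H * (S l / (1 + eigval d l) powr s)"
      by (simp add: x_def mult.commute)
  qed
  also have "\<dots> \<le> (\<Sum>l=1..L. H * (S l / (1 + eigval d l) powr s))"
    using H S_nonneg by (intro sum_mono2) auto
  also have "\<dots> \<le> H * (c\<^sup>2 * real N powr (- 2 * s / real d))"
    unfolding sum_distrib_left[symmetric] using sobolev H by (intro mult_left_mono)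
  also have "\<dots> \<le> G * ((2 powr a * real N powr (2 * a / real d)) * ((2 / real d * ln (real N)) powr (- p))) * (c\<^sup>2 * real N powr (- 2 * s / real d))"
  proof -
    have "ln (real m) \<le> ln (2 + real m)" using m1 by (intro ln_mono) auto
    then have "2 / real d * ln (real N) \<le> ln (2 + real m)" using ln_m by linarith
    moreover have "2 / real d * ln (real N) > 0" using ln_N d2 by simp
    ultimately have "ln (2 + real m) powr (- p) \<le> (2 / real d * ln (real N)) powr (- p)"
      using p by (intro powr_mono2') auto
    then show ?thesis unfolding H_def using G powr_m_le[of a] a
      by (intro mult_right_mono mult_left_mono mult_mono) auto
  qed
  also have "\<dots> = G * 2 powr a * c\<^sup>2 * (2 / real d) powr (- p) * ln (real N) powr (- p) *
      (real N powr (2 * a / real d) * real N powr (- 2 * s / real d))"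
    unfolding powr_mult[of "2 / real d"] by (simp only: mult_ac)
  also have "real N powr (2 * a / real d) * real N powr (- 2 * s / real d) = 1 / real N"
  proof -
    have "2 * a / real d + - 2 * s / real d = - 1" using d2 by (simp add: a_def field_simps)
    then show ?thesis using N2 unfolding powr_add[symmetric] by (simp add: powr_minus_divide)
  qed
  also have "G * 2 powr a * c\<^sup>2 * (2 / real d) powr (- p) * ln (real N) powr (- p) * (1 / real N)
      \<le> G * 2 powr a * c\<^sup>2 * (2 / real d) powr (- p) * (ln (real N) powr (1 - p) / ln 2) * (1 / real N)"
  proof -
    have "ln (real N) powr (1 - p) = ln (real N) * ln (real N) powr (- p)"
      using ln_N powr_add[of "ln (real N)" 1 "- p"] by simp
    then have "ln 2 * ln (real N) powr (- p) \<le> ln (real N) powr (1 - p)"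
      using ln_N by (simp add: mult_right_mono)
    then have "ln (real N) powr (- p) \<le> ln (real N) powr (1 - p) / ln 2"
      using ln_N by (simp add: field_simps)
    then show ?thesis using G by (intro mult_right_mono mult_left_mono) auto
  qed
  also have "\<dots> = low_const * (ln (real N) powr (1 - p) / real N)"
    by (simp add: low_const_def G_def a_def)
  finally show ?thesis .
qed

text \<open>\<open>exp 2\<close> inverts \<open>exp_minus_2_le_multiplier\<close>, the power of 2 is
  the step from \<open>M j\<close> to \<open>M (Suc j)\<close>, and the bracket comes from
  \<open>sum_powr_arith_le\<close>.\<close>

definition "high_const = exp 2 * E * 2 powr (real d / 2) *
    (2 powr p / ((p - 1) * (2 / real d * ln 2)) * (2 / real d) powr (1 - p))"

text \<open>On the block where 1 + \<open>eigval\<close> lies between \<open>M j\<close> and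
  \<open>M (Suc j)\<close>, the power in the weight cancels the growth in
  \<open>multiplier_sum_le\<close>. What remains is about (ln N + j)^(-p) / N, summable over j since
  p > 1.\<close>

lemma high_sum_le:
  "(\<Sum>l\<in>{l\<in>{1..L}. \<not> 1 + eigval d l \<le> real m}. S l / ((1 + eigval d l) powr (real d / 2) * ln (3 + eigval d l) powr p))
   \<le> high_const * (ln (real N) powr (1 - p) / real N)"
proof -
  let ?h = "real d / 2"
  let ?F = "{l\<in>{1..L}. \<not> 1 + eigval d l \<le> real m}"
  \<comment> \<open>A lower bound for ln m, and a step below ln 2. The step is shrunk by 2 / d so
    that \<delta> \<le> A follows from N \<ge> 2, as \<open>sum_powr_arith_le\<close>
    demands.\<close>
  define A \<delta> where "A = 2 / real d * ln (real N)" and "\<delta> = 2 / real d * ln 2"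
  have \<delta>: "0 < \<delta>" "\<delta> \<le> A" using ln_N d2 by (auto simp: A_def \<delta>_def intro!: divide_right_mono)
  have \<delta>2: "\<delta> \<le> ln 2" using ln_N d2 by (simp add: \<delta>_def field_simps)
  define M where "M j = 2 ^ j * m" for j
  have Mm: "m \<le> M j" and M1: "real (M j) > 0" for j using m1 by (auto simp: M_def)
  define b where "b j = real (M j) powr (- ?h) * (A + real j * \<delta>) powr (- p)" for j
  have b: "b j \<ge> 0" for j by (simp add: b_def)
  obtain J where J: "1 + eigval d L < 2 ^ J" using real_arch_pow[of 2 "1 + eigval d L"] by auto
  have "(\<Sum>l\<in>?F. S l / ((1 + eigval d l) powr ?h * ln (3 + eigval d l) powr p))
     \<le> (\<Sum>l\<in>?F. \<Sum>j<J. b j * exp 2 * (multiplier d (M (Suc j)) l * S l))"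
  proof (rule sum_mono)
    fix l assume l: "l \<in> ?F"
    define x where "x = 1 + eigval d l"
    have l1: "l \<ge> 1" and lL: "l \<le> L" and xm: "real m < x" using l by (auto simp: x_def)
    have "eigval d l \<le> eigval d L"
      unfolding eigval_def using lL d2 by (intro mult_mono) auto
    then have "x < 2 ^ J * 1" using J by (simp add: x_def)
    also have "\<dots> \<le> real (M J)" using m1 by (simp add: M_def)
    finally have "x \<le> real (M J)" by simp
    moreover have "\<not> x \<le> real (M 0)" using xm by (simp add: M_def)
    ultimately obtain j where j: "j < J" "\<not> x \<le> real (M j)" "x \<le> real (M (Suc j))"
      using ex_least_nat_less[of "\<lambda>j. x \<le> real (M j)" J] by blast
    have x0: "x > 0" using j(2) M1[of j] by linarith
    have "A + real j * \<delta> \<le> ln (real m) + real j * ln 2"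
      using ln_m \<delta>2 by (intro add_mono mult_left_mono) (auto simp: A_def)
    also have "\<dots> = ln (real (M j))" using m1 by (simp add: M_def ln_mult ln_realpow)
    also have "\<dots> \<le> ln (2 + x)" using j(2) M1[of j] by (intro ln_mono) auto
    finally have ln: "A + real j * \<delta> \<le> ln (2 + x)" .
    have A0: "A + real j * \<delta> > 0" using \<delta> by (intro add_pos_nonneg) auto
    have "1 / (x powr ?h * ln (2 + x) powr p) = x powr (- ?h) * ln (2 + x) powr (- p)"
      by (simp add: powr_minus field_simps)
    also have "\<dots> \<le> b j"
      unfolding b_def using ln A0 j(2) M1[of j] p by (intro mult_mono powr_mono2') auto
    finally have "1 / (x powr ?h * ln (2 + x) powr p) * S l \<le> b j * S l"
      using S_nonneg by (intro mult_right_mono) auto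
    also have "\<dots> \<le> b j * S l * (exp 2 * multiplier d (M (Suc j)) l)"
    proof -
      have "exp (- 2) \<le> multiplier d (M (Suc j)) l"
        using j(3) by (intro exp_minus_2_le_multiplier d2 l1) (simp add: x_def)
      then have "exp 2 * exp (- 2) \<le> exp 2 * multiplier d (M (Suc j)) l" by (intro mult_left_mono) auto
      then have "1 \<le> exp 2 * multiplier d (M (Suc j)) l" by (simp flip: exp_add)
      then show ?thesis using mult_left_mono[of 1 _ "b j * S l"] b[of j] S_nonneg[of l] by simp
    qed
    also have "\<dots> = b j * exp 2 * (multiplier d (M (Suc j)) l * S l)" by simp
    \<comment> \<open>Adding the other blocks removes the dependence of \<open>j\<close> on
      \<open>l\<close>, so that the two sums can be exchanged.\<close>
    also have "\<dots> \<le> (\<Sum>j<J. b j * exp 2 * (multiplier d (M (Suc j)) l * S l))"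
      using j(1) b S_nonneg multiplier_nonneg d2 by (intro member_le_sum) auto
    finally show "S l / ((1 + eigval d l) powr ?h * ln (3 + eigval d l) powr p)
        \<le> (\<Sum>j<J. b j * exp 2 * (multiplier d (M (Suc j)) l * S l))"
      by (simp add: x_def)
  qed
  also have "\<dots> = (\<Sum>j<J. b j * exp 2 * (\<Sum>l\<in>?F. multiplier d (M (Suc j)) l * S l))"
    by (subst sum.swap) (simp add: sum_distrib_left)
  also have "\<dots> \<le> (\<Sum>j<J. exp 2 * E * 2 powr ?h / real N * (A + real j * \<delta>) powr (- p))"
  proof (rule sum_mono)
    fix j
    \<comment> \<open>\<open>?F\<close> may reach beyond \<open>M (Suc j)\<close>, but there the
      multipliers vanish.\<close>
    have "(\<Sum>l\<in>?F. multiplier d (M (Suc j)) l * S l) \<le> (\<Sum>l\<in>?F \<union> {..M (Suc j)}. multiplier d (M (Suc j)) l * S l)"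
      using S_nonneg multiplier_nonneg d2 by (intro sum_mono2) auto
    also have "\<dots> = (\<Sum>l\<le>M (Suc j). multiplier d (M (Suc j)) l * S l)"
      by (intro sum.mono_neutral_right) (auto simp: multiplier_eq_0)
    also have "\<dots> \<le> E * real (M (Suc j)) powr ?h / real N" by (rule multiplier_sum_le[OF Mm])
    finally have "b j * exp 2 * (\<Sum>l\<in>?F. multiplier d (M (Suc j)) l * S l) \<le> b j * exp 2 * (E * real (M (Suc j)) powr ?h / real N)"
      using b by (intro mult_left_mono) auto
    also have "real (M (Suc j)) powr ?h = 2 powr ?h * real (M j) powr ?h"
      by (simp add: M_def powr_mult mult.assoc)
    also have "b j * exp 2 * (E * (2 powr ?h * real (M j) powr ?h) / real N)
        = exp 2 * E * 2 powr ?h / real N * (A + real j * \<delta>) powr (- p) * (real (M j) powr (- ?h) * real (M j) powr ?h)"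
      by (simp add: b_def)
    also have "real (M j) powr (- ?h) * real (M j) powr ?h = 1"
      using M1[of j] by (simp flip: powr_add)
    finally show "b j * exp 2 * (\<Sum>l\<in>?F. multiplier d (M (Suc j)) l * S l)
        \<le> exp 2 * E * 2 powr ?h / real N * (A + real j * \<delta>) powr (- p)" by simp
  qed
  also have "\<dots> = exp 2 * E * 2 powr ?h / real N * (\<Sum>j<J. (A + real j * \<delta>) powr (- p))"
    by (simp only: sum_distrib_left)
  also have "\<dots> \<le> exp 2 * E * 2 powr ?h / real N * (2 powr p / ((p - 1) * \<delta>) * A powr (1 - p))"
    using E_pos by (intro mult_left_mono sum_powr_arith_le \<delta> p) auto
  also have "A powr (1 - p) = (2 / real d) powr (1 - p) * ln (real N) powr (1 - p)"
    unfolding A_def by (rule powr_mult)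
  also have "exp 2 * E * 2 powr ?h / real N * (2 powr p / ((p - 1) * \<delta>) * ((2 / real d) powr (1 - p) * ln (real N) powr (1 - p)))
      = high_const * (ln (real N) powr (1 - p) / real N)"
    unfolding high_const_def \<delta>_def by (simp add: mult_ac)
  finally show ?thesis .
qed

lemma weighted_sum_le:
  "(\<Sum>l=1..L. S l / ((1 + eigval d l) powr (real d / 2) * ln (3 + eigval d l) powr p))
   \<le> (low_const + high_const) * (ln (real N) powr (1 - p) / real N)"
proof -
  let ?f = "\<lambda>l. S l / ((1 + eigval d l) powr (real d / 2) * ln (3 + eigval d l) powr p)"
  have "(\<Sum>l=1..L. ?f l) = (\<Sum>l\<in>{l\<in>{1..L}. 1 + eigval d l \<le> real m}. ?f l) + (\<Sum>l\<in>{l\<in>{1..L}. \<not> 1 + eigval d l \<le> real m}. ?f l)"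
    by (subst sum.union_disjoint[symmetric]) (auto intro!: sum.cong)
  then show ?thesis
    using low_sum_le[of L] high_sum_le[of L] unfolding distrib_right by linarith
qed

end

end

theorem theorem5:
  fixes Y :: "nat \<Rightarrow> nat \<Rightarrow> 'a::euclidean_space \<Rightarrow> real"
    and X :: "nat \<Rightarrow> nat \<Rightarrow> 'a"
    and I :: "nat set"
    and d :: nat
    and s :: real
  assumes "DIM('a) = d + 1"
    and "d \<ge> 2"
    and "s > real d / 2"
    and "harmonic_onb Y"
    and "qmc_designs_sobolev Y d s I X"
  shows "\<forall>\<gamma>::real. \<gamma> > 1 / 2 \<longrightarrow> qmc_designs_log_sobolev Y d \<gamma> I X"
proof (intro allI impI)
  fix \<gamma> :: real assume \<gamma>: "\<gamma> > 1 / 2"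
  interpret harmonic_basis Y d "\<lambda>l. {1..harmonic_dim TYPE('a) l}"
    using assms by unfold_locales auto
  have conf: "configuration_sequence I X" using assms(5) by (simp add: qmc_designs_sobolev_def)
  obtain c where c: "c > 0" and sob: "\<And>N. N \<in> I \<Longrightarrow>
      wce (qmc_rule N (X N)) (weighted_space Y (sobolev_weight d s)) (weighted_norm Y (sobolev_weight d s))
          \<le> ereal (c * real N powr (- s / real d))"
    using assms(5) by (auto simp: qmc_designs_sobolev_def)
  define p where "p = 2 * \<gamma>"
  have p: "p > 1" using \<gamma> by (simp add: p_def)
  \<comment> \<open>Outside the locale these constants depend on \<open>d\<close>, \<open>s\<close>,
    \<open>c\<close> and \<open>p\<close> alone, not on \<open>N\<close> or the nodes: this is the
    required uniformity.\<close>
  define K where "K = degree_power_bounds.low_const d s c p + degree_power_bounds.high_const d s c p"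
  have wpos: "sobolev_weight d s l > 0" "log_sobolev_weight d \<gamma> l > 0" for l
    using eigval_nonneg[OF d2, of l] by (auto simp: sobolev_weight_def log_sobolev_weight_def)
  have main: "wce (qmc_rule N (X N)) (weighted_space Y (log_sobolev_weight d \<gamma>)) (weighted_norm Y (log_sobolev_weight d \<gamma>))
      \<le> ereal (sqrt \<bar>K\<bar> * real N powr (- 1 / 2) * ln (real N) powr (- \<gamma> + 1 / 2))"
    if N: "N \<in> I" "N \<ge> 2" for N
  proof -
    have x: "norm (X N i) = 1" if "i \<in> {1..N}" for i
      using conf N that by (auto simp: configuration_sequence_def)
    have 1: "1 \<le> real N powr (2 / real d)" using N(2) by (intro ge_one_powr_ge_zero) auto
    \<comment> \<open>Rounding up at most doubles the critical value because it is at least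
      1.\<close>
    interpret degree_power_bounds d N "nat \<lceil>real N powr (2 / real d)\<rceil>" s c "degree_power N (X N)"
    proof
      show "(\<Sum>l=1..L. degree_power N (X N) l / (1 + eigval d l) powr s) \<le> c\<^sup>2 * real N powr (- 2 * s / real d)" for L
      proof -
        have "(\<Sum>l=1..L. degree_power N (X N) l / sobolev_weight d s l) \<le> (c * real N powr (- s / real d))\<^sup>2"
          using c by (intro weighted_error_le_wce wpos sob N) auto
        also have "\<dots> = c\<^sup>2 * real N powr (- 2 * s / real d)"
          using N(2) by (simp add: power_mult_distrib powr_power)
        finally show ?thesis by (simp add: sobolev_weight_def)
      qed
      show "real N powr (2 / real d) \<le> real (nat \<lceil>real N powr (2 / real d)\<rceil>)" by (rule real_nat_ceiling_ge)
      show "real (nat \<lceil>real N powr (2 / real d)\<rceil>) \<le> 2 * real N powr (2 / real d)" using 1 by linarith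
      show "degree_power N (X N) 0 = 1" using x N(2) by (intro degree_power_0) auto
      show "zonal_mass d M * (\<Sum>l\<le>M. multiplier d M l * degree_power N (X N) l)
          \<le> zonal_mass d m' * (\<Sum>l\<le>m'. multiplier d m' l * degree_power N (X N) l)" if "m' \<le> M" for m' M
        using x that by (rule multiplier_sum_mono)
      show "degree_power N (X N) l \<ge> 0" for l by (rule degree_power_nonneg)
    qed (use assms N in auto)
    show ?thesis
    proof (rule wce_leI)
      show "(\<Sum>l=1..L. degree_power N (X N) l / log_sobolev_weight d \<gamma> l)
          \<le> (sqrt \<bar>K\<bar> * real N powr (- 1 / 2) * ln (real N) powr (- \<gamma> + 1 / 2))\<^sup>2" for L
      proof -
        have "(\<Sum>l=1..L. degree_power N (X N) l / log_sobolev_weight d \<gamma> l) \<le> K * (ln (real N) powr (1 - p) / real N)"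
          unfolding K_def log_sobolev_weight_def p_def[symmetric] by (rule weighted_sum_le[OF p])
        also have "\<dots> \<le> \<bar>K\<bar> * (ln (real N) powr (1 - p) / real N)"
          by (intro mult_right_mono) auto
        also have "\<dots> = (sqrt \<bar>K\<bar> * real N powr (- 1 / 2) * ln (real N) powr (- \<gamma> + 1 / 2))\<^sup>2"
        proof -
          have "(real N powr (- 1 / 2))\<^sup>2 = 1 / real N"
            using N(2) unfolding power2_eq_square powr_add[symmetric] by (simp add: powr_minus_divide)
          moreover have "(ln (real N) powr (- \<gamma> + 1 / 2))\<^sup>2 = ln (real N) powr (1 - p)"
            unfolding power2_eq_square powr_add[symmetric] p_def by (simp add: algebra_simps)
          ultimately show ?thesis by (simp add: power_mult_distrib)
        qed
        finally show ?thesis .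
      qed
    qed (use wpos N x in auto)
  qed
  show "qmc_designs_log_sobolev Y d \<gamma> I X"
    unfolding qmc_designs_log_sobolev_def
  \<comment> \<open>The added 1 makes the constant strictly positive.\<close>
  proof (intro conjI conf exI[of _ "sqrt \<bar>K\<bar> + 1"] ballI impI)
    fix N assume N: "N \<in> I" "N \<ge> 2"
    have "sqrt \<bar>K\<bar> * real N powr (- 1 / 2) * ln (real N) powr (- \<gamma> + 1 / 2)
        \<le> (sqrt \<bar>K\<bar> + 1) * real N powr (- 1 / 2) * ln (real N) powr (- \<gamma> + 1 / 2)"
      by (intro mult_right_mono) auto
    then show "wce (qmc_rule N (X N)) (weighted_space Y (log_sobolev_weight d \<gamma>)) (weighted_norm Y (log_sobolev_weight d \<gamma>))
      \<le> ereal ((sqrt \<bar>K\<bar> + 1) * real N powr (- 1 / 2) * ln (real N) powr (- \<gamma> + 1 / 2))"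
      by (intro order_trans[OF main[OF N]]) simp
  qed (simp add: add_nonneg_pos)
qed

end
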